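(* Let $\gamma>0$, $a>0$, $p>4$. If $0<c<c_0$, then $\Lambda(c)$ is a submanifold of codimension $2$ of $X$ and a submanifold of codimension $1$ in $S(c)$.
   Context: All functions are real-valued on $\mathbb{R}^2$. $X=\{u\in H^1(\mathbb{R}^2): \int_{\mathbb{R}^2}\log(1+|x|)u^2(x)\,dx<\infty\}$ is the Hilbert space with norm $\|u\|_X^2=\int_{\mathbb{R}^2}(|\nabla u|^2+u^2)\,dx+\int_{\mathbb{R}^2}\log(1+|x|)u^2(x)\,dx$. For $c>0$, $S(c)=\{u\in X:\int_{\mathbb{R}^2}u^2\,dx=c\}$. Put $A(u)=\int_{\mathbb{R}^2}|\nabla u|^2dx$, $C(u)=\int_{\mathbb{R}^2}|u|^p\,dx$ and $$\Lambda(c)=\{u\in S(c):Q(u)=0\},\qquad Q(u)=A(u)-a\,\frac{p-2}{p}C(u)-\gamma\,\frac{c^2}{4}.$$ Submanifolds are understood in the $C^1$ sense. $K_{GN}$ is the best (smallest) constant in the Gagliardo–Nirenberg inequality $\|u\|_p^p\le K_{GN}\|\nabla u\|_2^{p-2}\|u\|_2^{2}$ for $u\in H^1(\mathbb{R}^2)$, and $$c_0=2\left[\frac{p(p-4)^{\frac{p-4}{2}}}{(p-2)^{\frac p2}}\,\frac{1}{a\,\gamma^{\frac{p-4}{2}}K_{GN}}\right]^{\frac1{p-3}}.$$ *)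

theory Defs
  imports "HOL-Analysis.Analysis" "HOL-Computational_Algebra.Polynomial"
begin

section \<open>Test functions\<close>

primrec C_diff :: "nat \<Rightarrow> ('a::euclidean_space \<Rightarrow> real) \<Rightarrow> bool" where
  "C_diff 0 f \<longleftrightarrow> continuous_on UNIV f"
| "C_diff (Suc k) f \<longleftrightarrow> (\<forall>x. f differentiable (at x)) \<and>
     (\<forall>i\<in>Basis. C_diff k (\<lambda>x. frechet_derivative f (at x) i))"

definition smooth :: "('a::euclidean_space \<Rightarrow> real) \<Rightarrow> bool" where
  "smooth f \<longleftrightarrow> (\<forall>k. C_diff k f)"

definition test_function :: "('a::euclidean_space \<Rightarrow> real) \<Rightarrow> bool" where
  "test_function \<phi> \<longleftrightarrow> smooth \<phi> \<and> compact (closure {x. \<phi> x \<noteq> 0})"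


section \<open>The spaces $L^2$, $H^1$ and $X$ as sets of functions\<close>

text \<open>Every Lebesgue class has a Borel representative, so only Borel functions are used.\<close>

definition L2 :: "(real^2 \<Rightarrow> 'b::euclidean_space) set" where
  "L2 = {f \<in> borel_measurable lborel. integrable lborel (\<lambda>x. (norm (f x))\<^sup>2)}"

definition is_weak_gradient :: "(real^2 \<Rightarrow> real) \<Rightarrow> (real^2 \<Rightarrow> real^2) \<Rightarrow> bool" where
  "is_weak_gradient u g \<longleftrightarrow> (\<forall>\<phi>. test_function \<phi> \<longrightarrow> (\<forall>i\<in>Basis.
     (\<integral>x. u x * frechet_derivative \<phi> (at x) i \<partial>lborel) = - (\<integral>x. (g x \<bullet> i) * \<phi> x \<partial>lborel)))"

definition H1 :: "(real^2 \<Rightarrow> real) set" where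
  "H1 = {u \<in> L2. \<exists>g\<in>L2. is_weak_gradient u g}"

text \<open>The choice is unique up to null sets, see \<open>weak_gradient_unique\<close> below.\<close>

definition weak_grad :: "(real^2 \<Rightarrow> real) \<Rightarrow> real^2 \<Rightarrow> real^2" where
  "weak_grad u = (SOME g. g \<in> L2 \<and> is_weak_gradient u g)"

definition X_fun :: "(real^2 \<Rightarrow> real) set" where
  "X_fun = {u \<in> H1. integrable lborel (\<lambda>x. ln (1 + norm x) * (u x)\<^sup>2)}"


section \<open>Uniqueness of weak gradients\<close>

lemma C_diff_has_derivative:
  assumes "\<And>x. (f has_derivative D x) (at x)"
  shows "C_diff (Suc k) f \<longleftrightarrow> (\<forall>i\<in>Basis. C_diff k (\<lambda>x. D x i))"
proof -
  have "frechet_derivative f (at x) = D x" for x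
    using frechet_derivative_at[OF assms] by simp
  then show ?thesis
    using assms by (auto simp: differentiable_def)
qed

lemma C_diff_continuous: "C_diff k f \<Longrightarrow> continuous_on UNIV f"
  by (cases k) (auto intro!: differentiable_imp_continuous_on simp: differentiable_on_def
      intro: differentiable_at_withinI)

lemma C_diff_SucD: "C_diff (Suc k) f \<Longrightarrow> C_diff k f"
proof (induction k arbitrary: f)
  case 0
  then show ?case using C_diff_continuous by fastforce
next
  case (Suc k)
  then show ?case by (metis C_diff.simps(2))
qed

lemma C_diff_const: "C_diff k (\<lambda>x::'a::euclidean_space. c)"
proof (induction k arbitrary: c)
  case (Suc k)
  have "((\<lambda>x::'a. c) has_derivative (\<lambda>h. 0)) (at x)" for x by simp
  from C_diff_has_derivative[OF this] show ?case using Suc by simp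
qed simp

lemma C_diff_add: "C_diff k f \<Longrightarrow> C_diff k g \<Longrightarrow> C_diff k (\<lambda>x. f x + g x)"
proof (induction k arbitrary: f g)
  case 0
  then show ?case by (auto intro: continuous_on_add)
next
  case (Suc k)
  have "((\<lambda>x. f x + g x) has_derivative
      (\<lambda>h. frechet_derivative f (at x) h + frechet_derivative g (at x) h)) (at x)" for x
    using Suc.prems by (auto intro!: has_derivative_add simp: frechet_derivative_works[symmetric])
  from C_diff_has_derivative[OF this] show ?case
    using Suc by auto
qed

lemma C_diff_mult: "C_diff k f \<Longrightarrow> C_diff k g \<Longrightarrow> C_diff k (\<lambda>x. f x * g x)"
proof (induction k arbitrary: f g)
  case 0
  then show ?case by (auto intro: continuous_on_mult)
next
  case (Suc k)
  have "((\<lambda>x. f x * g x) has_derivative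
      (\<lambda>h. f x * frechet_derivative g (at x) h + frechet_derivative f (at x) h * g x)) (at x)" for x
    using Suc.prems by (intro has_derivative_mult) (auto simp: frechet_derivative_works[symmetric])
  from C_diff_has_derivative[OF this] show ?case
    using Suc.prems C_diff_SucD[OF Suc.prems(1)] C_diff_SucD[OF Suc.prems(2)]
    by (auto intro!: C_diff_add Suc.IH)
qed

lemma C_diff_prod:
  "finite I \<Longrightarrow> (\<And>i. i \<in> I \<Longrightarrow> C_diff k (f i)) \<Longrightarrow> C_diff k (\<lambda>x. \<Prod>i\<in>I. f i x)"
  by (induction I rule: finite_induct) (auto intro!: C_diff_mult C_diff_const)

definition bump_poly :: "real poly \<Rightarrow> real \<Rightarrow> real" where
  "bump_poly P t = (if t > 0 then poly P (1 / t) * exp (- (1 / t)) else 0)"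

lemma poly_exp_tendsto_0: "((\<lambda>s. poly P s * exp (- s)) \<longlongrightarrow> (0::real)) at_top"
proof -
  have eq: "poly P s * exp (- s) = (\<Sum>i\<le>degree P. coeff P i * (s ^ i / exp s))" for s :: real
    unfolding poly_altdef sum_distrib_right
    by (intro sum.cong refl) (simp add: exp_minus field_simps)
  have "((\<lambda>s. \<Sum>i\<le>degree P. coeff P i * (s ^ i / exp s)) \<longlongrightarrow> (\<Sum>i\<le>degree P. coeff P i * 0)) at_top"
    by (intro tendsto_sum tendsto_mult tendsto_const tendsto_power_div_exp_0)
  then show ?thesis by (simp add: eq)
qed

lemma bump_poly_DERIV:
  "(bump_poly P has_field_derivative bump_poly ([:0, 0, 1:] * (P - pderiv P)) t) (at t)"
proof -
  consider "t < 0" | "t = 0" | "t > 0" by linarith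
  then show ?thesis
  proof cases
    case 1
    have "(bump_poly P has_field_derivative 0) (at t)"
      by (rule has_field_derivative_transform_within_open[of "\<lambda>_. 0" _ _ "{..<0}"])
        (use 1 in \<open>auto simp: bump_poly_def\<close>)
    then show ?thesis using 1 by (simp add: bump_poly_def)
  next
    case 2
    have "((\<lambda>h. bump_poly P h / h) \<longlongrightarrow> 0) (at_left 0)"
      by (rule tendsto_eventually) (auto simp: eventually_at_filter bump_poly_def)
    moreover have "((\<lambda>h. bump_poly P h / h) \<longlongrightarrow> 0) (at_right 0)"
    proof (rule Lim_transform_eventually)
      show "((\<lambda>h. poly (P * [:0, 1:]) (inverse h) * exp (- inverse h)) \<longlongrightarrow> (0::real)) (at_right 0)"
        by (rule filterlim_compose[OF poly_exp_tendsto_0 filterlim_inverse_at_top_right])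
      show "\<forall>\<^sub>F h in at_right 0. poly (P * [:0, 1:]) (inverse h) * exp (- inverse h) = bump_poly P h / h"
        by (auto simp: eventually_at_filter bump_poly_def field_simps)
    qed
    ultimately have "((\<lambda>h. bump_poly P h / h) \<longlongrightarrow> 0) (at 0)"
      by (simp add: filterlim_at_split)
    then show ?thesis using 2 by (simp add: DERIV_def bump_poly_def)
  next
    case 3
    have "((\<lambda>t. poly P (1 / t) * exp (- (1 / t))) has_field_derivative
        bump_poly ([:0, 0, 1:] * (P - pderiv P)) t) (at t)"
      using 3 by (auto intro!: derivative_eq_intros
          simp: bump_poly_def field_simps power2_eq_square)
    then show ?thesis
      by (rule has_field_derivative_transform_within_open[of _ _ _ "{0<..}"])
        (use 3 in \<open>auto simp: bump_poly_def\<close>)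
  qed
qed

lemma C_diff_bump_poly: "C_diff k (\<lambda>x::'a::euclidean_space. bump_poly P (c \<bullet> x + d))"
proof (induction k arbitrary: P)
  case 0
  have "continuous_on UNIV (bump_poly P)"
    by (intro continuous_at_imp_continuous_on ballI DERIV_isCont[OF bump_poly_DERIV])
  moreover have "continuous_on UNIV (\<lambda>x. c \<bullet> x + d)"
    by (intro continuous_intros)
  ultimately show ?case
    unfolding C_diff.simps by (rule continuous_on_compose2) simp
next
  case (Suc k)
  have "((\<lambda>x. c \<bullet> x + d) has_derivative (\<lambda>h. c \<bullet> h)) (at x)" for x
    by (auto intro!: derivative_eq_intros)
  then have "((\<lambda>x. bump_poly P (c \<bullet> x + d)) has_derivative
      (\<lambda>h. bump_poly ([:0, 0, 1:] * (P - pderiv P)) (c \<bullet> x + d) * (c \<bullet> h))) (at x)" for x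
    by (rule has_derivative_compose[OF _ bump_poly_DERIV[unfolded has_field_derivative_def]])
  from C_diff_has_derivative[OF this] show ?case
    by (simp only:) (intro ballI C_diff_mult Suc.IH C_diff_const)
qed

lemma bump_poly_1_bounds: "0 \<le> bump_poly 1 t" "bump_poly 1 t \<le> 1"
  by (auto simp: bump_poly_def)

lemma bump_poly_1_tendsto:
  "(\<lambda>n. bump_poly 1 (real (Suc n) * t)) \<longlonglongrightarrow> (if t > 0 then 1 else 0)"
proof (cases "t > 0")
  case True
  have "(\<lambda>n. exp (- (1 / t * (1 / real (Suc n))))) \<longlonglongrightarrow> exp (- (1 / t * 0))"
    by (intro tendsto_intros LIMSEQ_Suc[OF lim_1_over_n])
  with True show ?thesis by (simp add: bump_poly_def mult.commute)
next
  case False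
  then have "\<not> 0 < real (Suc n) * t" for n
    by (simp add: zero_less_mult_iff)
  with False show ?thesis by (simp add: bump_poly_def)
qed

definition box_bump :: "'a::euclidean_space \<Rightarrow> 'a \<Rightarrow> nat \<Rightarrow> 'a \<Rightarrow> real" where
  "box_bump a b n x = (\<Prod>i\<in>Basis. bump_poly 1 (real (Suc n) * (x \<bullet> i - a \<bullet> i)) *
     bump_poly 1 (real (Suc n) * (b \<bullet> i - x \<bullet> i)))"

lemma box_bump_nonzero: "box_bump a b n x \<noteq> 0 \<Longrightarrow> x \<in> box a b"
  by (auto simp: box_bump_def bump_poly_def mem_box zero_less_mult_iff split: if_splits)

lemma test_function_box_bump: "test_function (box_bump a b n)"
  unfolding test_function_def
proof
  have eq: "box_bump a b n = (\<lambda>x. \<Prod>i\<in>Basis.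
      bump_poly 1 ((real (Suc n) *\<^sub>R i) \<bullet> x + (- real (Suc n) * (a \<bullet> i))) *
      bump_poly 1 ((- real (Suc n) *\<^sub>R i) \<bullet> x + real (Suc n) * (b \<bullet> i)))"
    by (rule ext) (simp add: box_bump_def algebra_simps inner_commute)
  show "smooth (box_bump a b n)"
    unfolding smooth_def eq by (intro allI C_diff_prod C_diff_mult C_diff_bump_poly) auto
  have "{x. box_bump a b n x \<noteq> 0} \<subseteq> box a b"
    by (auto dest: box_bump_nonzero)
  then show "compact (closure {x. box_bump a b n x \<noteq> 0})"
    unfolding compact_closure by (rule bounded_subset[OF bounded_box])
qed

lemma box_bump_bounds: "0 \<le> box_bump a b n x" "box_bump a b n x \<le> indicator (box a b) x"
proof -
  show "0 \<le> box_bump a b n x"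
    unfolding box_bump_def by (intro prod_nonneg mult_nonneg_nonneg bump_poly_1_bounds)
  have "box_bump a b n x \<le> 1"
    unfolding box_bump_def
    by (intro prod_le_1 conjI mult_nonneg_nonneg mult_le_one bump_poly_1_bounds)
  then show "box_bump a b n x \<le> indicator (box a b) x"
    using box_bump_nonzero[of a b n x] by (cases "box_bump a b n x = 0") auto
qed

lemma box_bump_tendsto: "(\<lambda>n. box_bump a b n x) \<longlonglongrightarrow> indicator (box a b) x"
proof -
  have "(\<lambda>n. box_bump a b n x) \<longlonglongrightarrow> (\<Prod>i\<in>Basis. (if x \<bullet> i - a \<bullet> i > 0 then 1 else 0) *
      (if b \<bullet> i - x \<bullet> i > 0 then 1 else 0))"
    unfolding box_bump_def by (intro tendsto_prod tendsto_mult bump_poly_1_tendsto)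
  also have "(\<Prod>i\<in>Basis. (if x \<bullet> i - a \<bullet> i > 0 then 1 else 0) *
      (if b \<bullet> i - x \<bullet> i > 0 then 1 else 0)) = (indicator (box a b) x :: real)"
  proof (cases "x \<in> box a b")
    case True
    then show ?thesis by (simp add: mem_box)
  next
    case False
    then obtain i where "i \<in> Basis" "\<not> (a \<bullet> i < x \<bullet> i \<and> x \<bullet> i < b \<bullet> i)"
      by (auto simp: mem_box)
    with False show ?thesis by (auto intro!: prod_zero bexI[of _ i])
  qed
  finally show ?thesis .
qed

lemma smooth_measurable: "smooth \<phi> \<Longrightarrow> \<phi> \<in> borel_measurable lborel"
  unfolding smooth_def by (auto intro: borel_measurable_continuous_onI C_diff_continuous)

lemma fundamental_lemma:
  fixes h :: "'a::euclidean_space \<Rightarrow> real"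
  assumes h[measurable]: "h \<in> borel_measurable lborel" and h2: "integrable lborel (\<lambda>x. (h x)\<^sup>2)"
    and zero: "\<And>\<phi>. test_function \<phi> \<Longrightarrow> (\<integral>x. h x * \<phi> x \<partial>lborel) = 0"
  shows "AE x in lborel. h x = 0"
proof -
  have int_box: "integrable lborel (\<lambda>x. indicator (box a b) x * \<bar>h x\<bar>)" for a b
  proof (rule Bochner_Integration.integrable_bound)
    show "integrable lborel (\<lambda>x. (h x)\<^sup>2 + indicator (box a b) x)"
      by (intro Bochner_Integration.integrable_add h2 integrable_real_indicator)
        (auto simp: emeasure_lborel_box_eq)
    have "\<bar>h x\<bar> \<le> (h x)\<^sup>2 + 1" for x
      using zero_le_power2[of "\<bar>h x\<bar> - 1"] by (simp add: power2_diff)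
    then show "AE x in lborel. norm (indicator (box a b) x * \<bar>h x\<bar>) \<le> norm ((h x)\<^sup>2 + indicator (box a b) x)"
      by (auto simp: indicator_def)
  qed measurable
  have box0: "(\<integral>x. indicator (box a b) x * h x \<partial>lborel) = 0" for a b
  proof -
    have "(\<lambda>n. \<integral>x. h x * box_bump a b n x \<partial>lborel) \<longlonglongrightarrow> (\<integral>x. h x * indicator (box a b) x \<partial>lborel)"
    proof (rule integral_dominated_convergence[OF _ _ int_box[of a b]])
      show "(\<lambda>x. h x * box_bump a b n x) \<in> borel_measurable lborel" for n
        using test_function_box_bump[of a b n] smooth_measurable[of "box_bump a b n"]
        by (intro borel_measurable_times h) (simp add: test_function_def)
      show "AE x in lborel. (\<lambda>n. h x * box_bump a b n x) \<longlonglongrightarrow> h x * indicator (box a b) x"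
        by (intro AE_I2 tendsto_mult tendsto_const box_bump_tendsto)
      show "AE x in lborel. norm (h x * box_bump a b n x) \<le> indicator (box a b) x * \<bar>h x\<bar>" for n
      proof (rule AE_I2)
        fix x
        have "\<bar>h x\<bar> * box_bump a b n x \<le> \<bar>h x\<bar> * indicator (box a b) x"
          by (intro mult_left_mono box_bump_bounds abs_ge_zero)
        then show "norm (h x * box_bump a b n x) \<le> indicator (box a b) x * \<bar>h x\<bar>"
          by (simp add: abs_mult abs_of_nonneg[OF box_bump_bounds(1)] mult.commute)
      qed
    qed measurable
    moreover have "(\<integral>x. h x * box_bump a b n x \<partial>lborel) = 0" for n
      by (rule zero[OF test_function_box_bump])
    ultimately show ?thesis
      by (simp add: LIMSEQ_const_iff mult.commute)
  qed
  have "AE x in lborel. indicator (box a b) x * h x = 0" for a b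
  proof (rule sigma_finite_measure.density_zero[OF sigma_finite_lborel])
    show int: "integrable lborel (\<lambda>x. indicator (box a b) x * h x)"
      by (rule Bochner_Integration.integrable_bound[OF int_box[of a b]]) (auto simp: abs_mult)
    fix A :: "'a set" assume "A \<in> sets lborel"
    then have A: "A \<in> sigma_sets UNIV (range (\<lambda>(a, b). box a b))"
      by (simp add: borel_eq_box)
    have "Int_stable (range (\<lambda>(a, b). box a b :: 'a set))"
      by (auto simp: Int_stable_def box_Int_box)
    moreover have "range (\<lambda>(a, b). box a b :: 'a set) \<subseteq> Pow UNIV" by auto
    moreover note A
    ultimately have "A \<in> sets borel \<and> (LINT x:A|lborel. indicator (box a b) x * h x) = 0"
    proof (induction rule: sigma_sets_induct_disjoint)
      case (basic A)
      then obtain c d where A: "A = box c d" by auto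
      obtain l u where lu: "box c d \<inter> box a b = box l u"
        by (simp add: box_Int_box)
      have "(\<lambda>x. indicator A x *\<^sub>R (indicator (box a b) x * h x)) = (\<lambda>x. indicator (box l u) x * h x)"
        unfolding A lu[symmetric] by (auto simp: indicator_def)
      then have "(LINT x:A|lborel. indicator (box a b) x * h x) = 0"
        unfolding set_lebesgue_integral_def using box0[of l u] by (simp only:)
      then show ?case using A by simp
    next
      case empty
      then show ?case by (simp add: set_lebesgue_integral_def)
    next
      case (compl A)
      then have "(LINT x:UNIV - A|lborel. indicator (box a b) x * h x) =
          (\<integral>x. indicator (box a b) x * h x - indicator A x *\<^sub>R (indicator (box a b) x * h x) \<partial>lborel)"
        unfolding set_lebesgue_integral_def
        by (intro Bochner_Integration.integral_cong) (auto simp: indicator_def)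
      also have "\<dots> = (\<integral>x. indicator (box a b) x * h x \<partial>lborel) -
          (LINT x:A|lborel. indicator (box a b) x * h x)"
        unfolding set_lebesgue_integral_def
        by (intro Bochner_Integration.integral_diff int integrable_mult_indicator) (use compl in simp)
      also have "\<dots> = 0" using compl box0[of a b] by simp
      finally show ?case using compl by auto
    next
      case (union A)
      then have sets: "A i \<in> sets lborel" for i by simp
      have "(LINT x:(\<Union>i. A i)|lborel. indicator (box a b) x * h x) =
          (\<Sum>i. LINT x:A i|lborel. indicator (box a b) x * h x)"
      proof (rule lebesgue_integral_countable_add[OF sets])
        show "A i \<inter> A j = {}" if "i \<noteq> j" for i j
          using union that by (simp add: disjoint_family_on_def)
        show "set_integrable lborel (\<Union>i. A i) (\<lambda>x. indicator (box a b) x * h x)"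
          unfolding set_integrable_def using sets
          by (intro integrable_mult_indicator int sets.countable_UN) auto
      qed
      moreover have "(\<Union>i. A i) \<in> sets borel"
        using sets by (intro sets.countable_UN) auto
      ultimately show ?case using union by simp
    qed
    then show "(LINT x:A|lborel. indicator (box a b) x * h x) = 0" by simp
  qed
  then have "AE x in lborel. \<forall>n::nat. indicator (box (- (real n *\<^sub>R One)) (real n *\<^sub>R One)) x * h x = 0"
    unfolding AE_all_countable by (rule allI)
  then show ?thesis
  proof eventually_elim
    case (elim x)
    have "x \<in> (\<Union>n::nat. box (- (real n *\<^sub>R One)) (real n *\<^sub>R One))"
      by (simp add: UN_box_eq_UNIV)
    then obtain n :: nat where "x \<in> box (- (real n *\<^sub>R One)) (real n *\<^sub>R One)" by blast
    then show ?case using elim[rule_format, of n] by simp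
  qed
qed

lemma L2_integrable_inner:
  assumes "f \<in> L2" "g \<in> L2"
  shows "integrable lborel (\<lambda>x. f x \<bullet> g x)"
proof (rule Bochner_Integration.integrable_bound)
  show "integrable lborel (\<lambda>x. (norm (f x))\<^sup>2 + (norm (g x))\<^sup>2)"
    using assms by (auto simp: L2_def)
  show "(\<lambda>x. f x \<bullet> g x) \<in> borel_measurable lborel"
    using assms by (auto simp: L2_def)
  have "\<bar>f x \<bullet> g x\<bar> \<le> (norm (f x))\<^sup>2 + (norm (g x))\<^sup>2" for x
  proof -
    have "2 * (norm (f x) * norm (g x)) \<le> (norm (f x))\<^sup>2 + (norm (g x))\<^sup>2"
      using sum_squares_bound[of "norm (f x)" "norm (g x)"] by (simp add: mult.assoc)
    moreover have "0 \<le> norm (f x) * norm (g x)" by simp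
    ultimately show ?thesis using Cauchy_Schwarz_ineq2[of "f x" "g x"] by linarith
  qed
  then show "AE x in lborel. norm (f x \<bullet> g x) \<le> norm ((norm (f x))\<^sup>2 + (norm (g x))\<^sup>2)"
    by auto
qed

lemma L2_integrable_mult:
  fixes f g :: "real^2 \<Rightarrow> real"
  shows "f \<in> L2 \<Longrightarrow> g \<in> L2 \<Longrightarrow> integrable lborel (\<lambda>x. f x * g x)"
  using L2_integrable_inner[of f g] by simp

lemma L2_zero: "(\<lambda>x. 0) \<in> L2"
  by (simp add: L2_def)

lemma L2_scaleR: "f \<in> L2 \<Longrightarrow> (\<lambda>x. r *\<^sub>R f x) \<in> L2"
  by (auto simp: L2_def power_mult_distrib)

lemma L2_add:
  assumes "f \<in> L2" "g \<in> L2"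
  shows "(\<lambda>x. f x + g x) \<in> L2"
proof -
  have "(norm (f x + g x))\<^sup>2 = (norm (f x))\<^sup>2 + 2 * (f x \<bullet> g x) + (norm (g x))\<^sup>2" for x
    by (simp add: power2_norm_eq_inner inner_add inner_commute)
  then show ?thesis
    using assms L2_integrable_inner[OF assms] by (auto simp: L2_def)
qed

lemma L2_component:
  assumes "f \<in> L2"
  shows "(\<lambda>x. f x \<bullet> i) \<in> L2"
proof -
  have m: "f \<in> borel_measurable lborel" and int: "integrable lborel (\<lambda>x. (norm (f x))\<^sup>2)"
    using assms unfolding L2_def by blast+
  have m': "(\<lambda>x. f x \<bullet> i) \<in> borel_measurable lborel"
    using m by simp
  have "integrable lborel (\<lambda>x. (norm (f x \<bullet> i))\<^sup>2)"
  proof (rule Bochner_Integration.integrable_bound)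
    show "integrable lborel (\<lambda>x. (norm (f x))\<^sup>2 * (norm i)\<^sup>2)"
      using int by (rule Bochner_Integration.integrable_mult_left)
    show "(\<lambda>x. (norm (f x \<bullet> i))\<^sup>2) \<in> borel_measurable lborel"
      using m' by simp
    show "AE x in lborel. norm ((norm (f x \<bullet> i))\<^sup>2) \<le> norm ((norm (f x))\<^sup>2 * (norm i)\<^sup>2)"
    proof (rule AE_I2)
      fix x
      show "norm ((norm (f x \<bullet> i))\<^sup>2) \<le> norm ((norm (f x))\<^sup>2 * (norm i)\<^sup>2)"
        using power_mono[OF Cauchy_Schwarz_ineq2[of "f x" i], of 2] by (simp add: power_mult_distrib)
    qed
  qed
  with m' show ?thesis unfolding L2_def by blast
qed

lemma continuous_compact_support_L2:
  assumes "continuous_on UNIV f" "compact K" "\<And>x. x \<notin> K \<Longrightarrow> f x = 0"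
  shows "f \<in> L2"
proof -
  have "integrable lborel (\<lambda>x. indicator K x *\<^sub>R (norm (f x))\<^sup>2)"
    by (intro borel_integrable_compact assms(2) continuous_intros
        continuous_on_subset[OF assms(1) subset_UNIV])
  also have "(\<lambda>x. indicator K x *\<^sub>R (norm (f x))\<^sup>2) = (\<lambda>x. (norm (f x))\<^sup>2)"
    using assms(3) by (intro ext) (auto simp: indicator_def)
  finally show ?thesis
    using borel_measurable_continuous_onI[OF assms(1)] by (simp add: L2_def)
qed

lemma test_function_L2: "test_function \<phi> \<Longrightarrow> \<phi> \<in> L2"
proof (rule continuous_compact_support_L2[of _ "closure {x. \<phi> x \<noteq> 0}"])
  show "\<phi> x = 0" if "x \<notin> closure {x. \<phi> x \<noteq> 0}" for x
    using that closure_subset[of "{x. \<phi> x \<noteq> 0}"] by blast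
qed (auto simp: test_function_def smooth_def intro: C_diff_continuous)

lemma test_function_derivative_L2:
  assumes "test_function \<phi>" "i \<in> Basis"
  shows "(\<lambda>x. frechet_derivative \<phi> (at x) i) \<in> L2"
proof (rule continuous_compact_support_L2[of _ "closure {x. \<phi> x \<noteq> 0}"])
  have "C_diff (Suc 0) \<phi>" using assms by (auto simp: test_function_def smooth_def)
  then show "continuous_on UNIV (\<lambda>x. frechet_derivative \<phi> (at x) i)"
    using assms by auto
  show "compact (closure {x. \<phi> x \<noteq> 0})" using assms by (simp add: test_function_def)
  fix x assume x: "x \<notin> closure {x. \<phi> x \<noteq> 0}"
  have "(\<phi> has_derivative (\<lambda>h. 0)) (at x)"
  proof (rule has_derivative_transform_within_open[of "\<lambda>_. 0"])
    show "open (- closure {x. \<phi> x \<noteq> 0})" by (rule open_Compl[OF closed_closure])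
    show "0 = \<phi> y" if "y \<in> - closure {x. \<phi> x \<noteq> 0}" for y
      using that closure_subset[of "{x. \<phi> x \<noteq> 0}"] by auto
  qed (use x in auto)
  then show "frechet_derivative \<phi> (at x) i = 0"
    using frechet_derivative_at by metis
qed

lemma weak_gradient_unique:
  assumes "g \<in> L2" "g' \<in> L2" "is_weak_gradient u g" "is_weak_gradient u g'"
  shows "AE x in lborel. g x = g' x"
proof -
  have "AE x in lborel. (g x + (-1) *\<^sub>R g' x) \<bullet> i = 0" if i: "i \<in> Basis" for i
  proof (rule fundamental_lemma)
    have L: "(\<lambda>x. (g x + (-1) *\<^sub>R g' x) \<bullet> i) \<in> L2"
      by (intro L2_component L2_add L2_scaleR assms)
    then show "(\<lambda>x. (g x + (-1) *\<^sub>R g' x) \<bullet> i) \<in> borel_measurable lborel"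
      "integrable lborel (\<lambda>x. ((g x + (-1) *\<^sub>R g' x) \<bullet> i)\<^sup>2)"
      by (simp_all add: L2_def)
    fix \<phi> :: "real^2 \<Rightarrow> real" assume \<phi>: "test_function \<phi>"
    have "(\<integral>x. (g x + (-1) *\<^sub>R g' x) \<bullet> i * \<phi> x \<partial>lborel) =
        (\<integral>x. (g x \<bullet> i) * \<phi> x - (g' x \<bullet> i) * \<phi> x \<partial>lborel)"
      by (simp add: inner_diff_left left_diff_distrib)
    also have "\<dots> = (\<integral>x. (g x \<bullet> i) * \<phi> x \<partial>lborel) - (\<integral>x. (g' x \<bullet> i) * \<phi> x \<partial>lborel)"
      by (intro Bochner_Integration.integral_diff L2_integrable_mult L2_component assms
          test_function_L2 \<phi>)
    also have "\<dots> = 0"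
    proof -
      have "- (\<integral>x. (g x \<bullet> i) * \<phi> x \<partial>lborel) = - (\<integral>x. (g' x \<bullet> i) * \<phi> x \<partial>lborel)"
        using assms(3,4) \<phi> i unfolding is_weak_gradient_def by (blast intro: trans[OF sym])
      then show ?thesis by linarith
    qed
    finally show "(\<integral>x. (g x + (-1) *\<^sub>R g' x) \<bullet> i * \<phi> x \<partial>lborel) = 0" .
  qed
  then have "AE x in lborel. \<forall>i\<in>Basis. (g x + (-1) *\<^sub>R g' x) \<bullet> i = 0"
    by (intro AE_finite_allI) auto
  then show ?thesis
  proof eventually_elim
    case (elim x)
    show ?case
      by (rule euclidean_eqI) (use elim in \<open>simp add: inner_diff_left\<close>)
  qed
qed

lemma is_weak_gradient_zero: "is_weak_gradient (\<lambda>x. 0) (\<lambda>x. 0)"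
  by (simp add: is_weak_gradient_def)

lemma is_weak_gradient_scaleR:
  assumes "is_weak_gradient u g"
  shows "is_weak_gradient (\<lambda>x. r * u x) (\<lambda>x. r *\<^sub>R g x)"
  unfolding is_weak_gradient_def
proof (intro allI impI ballI)
  fix \<phi> :: "real^2 \<Rightarrow> real" and i :: "real^2" assume "test_function \<phi>" "i \<in> Basis"
  then have "(\<integral>x. u x * frechet_derivative \<phi> (at x) i \<partial>lborel) = - (\<integral>x. (g x \<bullet> i) * \<phi> x \<partial>lborel)"
    using assms unfolding is_weak_gradient_def by blast
  then show "(\<integral>x. r * u x * frechet_derivative \<phi> (at x) i \<partial>lborel) =
      - (\<integral>x. (r *\<^sub>R g x \<bullet> i) * \<phi> x \<partial>lborel)"
    by (simp only: inner_scaleR_left mult.assoc integral_mult_right_zero mult_minus_right)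
qed

lemma is_weak_gradient_add:
  assumes "u \<in> L2" "v \<in> L2" "g \<in> L2" "h \<in> L2" "is_weak_gradient u g" "is_weak_gradient v h"
  shows "is_weak_gradient (\<lambda>x. u x + v x) (\<lambda>x. g x + h x)"
  unfolding is_weak_gradient_def
proof (intro allI impI ballI)
  fix \<phi> :: "real^2 \<Rightarrow> real" and i :: "real^2" assume \<phi>: "test_function \<phi>" and i: "i \<in> Basis"
  note int = L2_integrable_mult L2_component assms test_function_L2[OF \<phi>]
    test_function_derivative_L2[OF \<phi> i]
  have "(\<integral>x. (u x + v x) * frechet_derivative \<phi> (at x) i \<partial>lborel) =
      (\<integral>x. u x * frechet_derivative \<phi> (at x) i \<partial>lborel) +
      (\<integral>x. v x * frechet_derivative \<phi> (at x) i \<partial>lborel)"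
    by (simp only: distrib_right) (intro Bochner_Integration.integral_add int)
  also have "\<dots> = - ((\<integral>x. (g x \<bullet> i) * \<phi> x \<partial>lborel) + (\<integral>x. (h x \<bullet> i) * \<phi> x \<partial>lborel))"
  proof -
    have "(\<integral>x. u x * frechet_derivative \<phi> (at x) i \<partial>lborel) = - (\<integral>x. (g x \<bullet> i) * \<phi> x \<partial>lborel)"
      "(\<integral>x. v x * frechet_derivative \<phi> (at x) i \<partial>lborel) = - (\<integral>x. (h x \<bullet> i) * \<phi> x \<partial>lborel)"
      using assms(5,6) \<phi> i unfolding is_weak_gradient_def by blast+
    then show ?thesis by (simp only: minus_add_distrib)
  qed
  also have "\<dots> = - (\<integral>x. ((g x + h x) \<bullet> i) * \<phi> x \<partial>lborel)"
    by (simp only: inner_add_left distrib_right neg_equal_iff_equal,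
        rule Bochner_Integration.integral_add[symmetric]) (intro int)+
  finally show "(\<integral>x. (u x + v x) * frechet_derivative \<phi> (at x) i \<partial>lborel) =
      - (\<integral>x. ((g x + h x) \<bullet> i) * \<phi> x \<partial>lborel)" .
qed

lemma weak_grad_cong:
  assumes "u \<in> L2" "v \<in> L2" "AE x in lborel. u x = v x"
  shows "weak_grad u = weak_grad v"
proof -
  have eq: "(\<integral>x. u x * frechet_derivative \<phi> (at x) i \<partial>lborel) =
      (\<integral>x. v x * frechet_derivative \<phi> (at x) i \<partial>lborel)"
    if "test_function \<phi>" "i \<in> Basis" for \<phi> i
  proof (rule integral_cong_AE)
    have "(\<lambda>x. frechet_derivative \<phi> (at x) i) \<in> borel_measurable lborel"
      "u \<in> borel_measurable lborel" "v \<in> borel_measurable lborel"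
      using test_function_derivative_L2[OF that] assms unfolding L2_def by blast+
    then show "(\<lambda>x. u x * frechet_derivative \<phi> (at x) i) \<in> borel_measurable lborel"
      "(\<lambda>x. v x * frechet_derivative \<phi> (at x) i) \<in> borel_measurable lborel"
      by (auto intro: borel_measurable_times)
    show "AE x in lborel. u x * frechet_derivative \<phi> (at x) i = v x * frechet_derivative \<phi> (at x) i"
      using assms(3) by eventually_elim simp
  qed
  have "is_weak_gradient u g = is_weak_gradient v g" for g
  proof -
    have "((\<integral>x. u x * frechet_derivative \<phi> (at x) i \<partial>lborel) = s) \<longleftrightarrow>
        ((\<integral>x. v x * frechet_derivative \<phi> (at x) i \<partial>lborel) = s)"
      if "test_function \<phi>" "i \<in> Basis" for \<phi> i s
      by (simp only: eq[OF that])
    then show ?thesis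
      unfolding is_weak_gradient_def by (intro all_cong1 imp_cong ball_cong refl)
  qed
  then show ?thesis by (simp add: weak_grad_def)
qed

lemma weak_grad:
  assumes "u \<in> H1"
  shows "weak_grad u \<in> L2" "is_weak_gradient u (weak_grad u)"
proof -
  have "\<exists>g. g \<in> L2 \<and> is_weak_gradient u g" using assms by (auto simp: H1_def)
  from someI_ex[OF this] show "weak_grad u \<in> L2" "is_weak_gradient u (weak_grad u)"
    by (simp_all add: weak_grad_def)
qed

lemma H1I: "u \<in> L2 \<Longrightarrow> g \<in> L2 \<Longrightarrow> is_weak_gradient u g \<Longrightarrow> u \<in> H1"
  unfolding H1_def by (rule CollectI) (rule conjI, assumption, rule bexI)

lemma weak_grad_eqI:
  assumes "u \<in> L2" "g \<in> L2" "is_weak_gradient u g"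
  shows "AE x in lborel. weak_grad u x = g x"
proof -
  have "u \<in> H1" using assms by (rule H1I)
  from weak_gradient_unique[OF weak_grad(1)[OF this] assms(2) weak_grad(2)[OF this] assms(3)]
  show ?thesis .
qed

lemma H1_zero: "(\<lambda>x. 0) \<in> H1"
  by (rule H1I[OF L2_zero L2_zero is_weak_gradient_zero])

lemma H1_L2: "u \<in> H1 \<Longrightarrow> u \<in> L2"
  by (simp add: H1_def)

lemma H1_add:
  assumes "u \<in> H1" "v \<in> H1"
  shows "(\<lambda>x. u x + v x) \<in> H1" "AE x in lborel. weak_grad (\<lambda>x. u x + v x) x = weak_grad u x + weak_grad v x"
proof -
  note L = H1_L2[OF assms(1)] H1_L2[OF assms(2)] weak_grad(1)[OF assms(1)] weak_grad(1)[OF assms(2)]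
  have 1: "(\<lambda>x. u x + v x) \<in> L2" "(\<lambda>x. weak_grad u x + weak_grad v x) \<in> L2"
    "is_weak_gradient (\<lambda>x. u x + v x) (\<lambda>x. weak_grad u x + weak_grad v x)"
    by (rule L2_add[OF L(1,2)] L2_add[OF L(3,4)]
        is_weak_gradient_add[OF L weak_grad(2)[OF assms(1)] weak_grad(2)[OF assms(2)]])+
  then show "(\<lambda>x. u x + v x) \<in> H1" by (rule H1I)
  from weak_grad_eqI[OF 1]
  show "AE x in lborel. weak_grad (\<lambda>x. u x + v x) x = weak_grad u x + weak_grad v x" .
qed

lemma H1_scale:
  assumes "u \<in> H1"
  shows "(\<lambda>x. r * u x) \<in> H1" "AE x in lborel. weak_grad (\<lambda>x. r * u x) x = r *\<^sub>R weak_grad u x"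
proof -
  have 1: "(\<lambda>x. r * u x) \<in> L2" "(\<lambda>x. r *\<^sub>R weak_grad u x) \<in> L2"
    "is_weak_gradient (\<lambda>x. r * u x) (\<lambda>x. r *\<^sub>R weak_grad u x)"
    using L2_scaleR[OF H1_L2[OF assms], of r] L2_scaleR[OF weak_grad(1)[OF assms], of r]
      is_weak_gradient_scaleR[OF weak_grad(2)[OF assms], of r]
    by simp_all
  then show "(\<lambda>x. r * u x) \<in> H1" by (rule H1I)
  from weak_grad_eqI[OF 1]
  show "AE x in lborel. weak_grad (\<lambda>x. r * u x) x = r *\<^sub>R weak_grad u x" .
qed


section \<open>The Hilbert space $X$\<close>

lemma X_fun_H1: "u \<in> X_fun \<Longrightarrow> u \<in> H1"
  by (simp add: X_fun_def)

lemma X_fun_measurable: "u \<in> X_fun \<Longrightarrow> u \<in> borel_measurable borel"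
  by (simp add: X_fun_def H1_def L2_def)

lemma X_fun_integrable_weight:
  assumes "u \<in> X_fun" "v \<in> X_fun"
  shows "integrable lborel (\<lambda>x. ln (1 + norm x) * (u x * v x))"
proof (rule Bochner_Integration.integrable_bound)
  show "integrable lborel (\<lambda>x. ln (1 + norm x) * (u x)\<^sup>2 + ln (1 + norm x) * (v x)\<^sup>2)"
    using assms by (auto simp: X_fun_def)
  show "(\<lambda>x. ln (1 + norm x) * (u x * v x)) \<in> borel_measurable lborel"
    using assms[THEN X_fun_measurable] by measurable
  have "\<bar>u x * v x\<bar> \<le> (u x)\<^sup>2 + (v x)\<^sup>2" for x
  proof -
    have "0 \<le> \<bar>u x\<bar> * \<bar>v x\<bar>" by simp
    moreover have "2 * (\<bar>u x\<bar> * \<bar>v x\<bar>) \<le> (u x)\<^sup>2 + (v x)\<^sup>2"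
      using sum_squares_bound[of "\<bar>u x\<bar>" "\<bar>v x\<bar>"] by (simp add: mult.assoc)
    ultimately show ?thesis unfolding abs_mult by linarith
  qed
  then have "ln (1 + norm x) * \<bar>u x * v x\<bar> \<le> ln (1 + norm x) * (u x)\<^sup>2 + ln (1 + norm x) * (v x)\<^sup>2" for x :: "real^2"
    by (simp add: mult_left_mono flip: distrib_left)
  then show "AE x in lborel. norm (ln (1 + norm x) * (u x * v x)) \<le>
      norm (ln (1 + norm x) * (u x)\<^sup>2 + ln (1 + norm x) * (v x)\<^sup>2)"
    by (auto simp: abs_mult)
qed

lemma X_fun_zero: "(\<lambda>x. 0) \<in> X_fun"
  by (simp add: X_fun_def H1_zero)

lemma X_fun_add:
  assumes "u \<in> X_fun" "v \<in> X_fun"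
  shows "(\<lambda>x. u x + v x) \<in> X_fun"
proof -
  note int = X_fun_integrable_weight[OF assms]
  have "ln (1 + norm x) * (u x + v x)\<^sup>2 = ln (1 + norm x) * (u x)\<^sup>2
      + 2 * (ln (1 + norm x) * (u x * v x)) + ln (1 + norm x) * (v x)\<^sup>2" for x :: "real^2"
    by (simp add: power2_sum algebra_simps)
  then show ?thesis
    using assms int by (auto simp: X_fun_def H1_add)
qed

lemma X_fun_scale: "u \<in> X_fun \<Longrightarrow> (\<lambda>x. r * u x) \<in> X_fun"
  by (auto simp: X_fun_def H1_scale power_mult_distrib mult.left_commute)

definition X_eq :: "(real^2 \<Rightarrow> real) \<Rightarrow> (real^2 \<Rightarrow> real) \<Rightarrow> bool" where
  "X_eq u v \<longleftrightarrow> u \<in> X_fun \<and> v \<in> X_fun \<and> (AE x in lborel. u x = v x)"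

definition X_inner :: "(real^2 \<Rightarrow> real) \<Rightarrow> (real^2 \<Rightarrow> real) \<Rightarrow> real" where
  "X_inner u v = (\<integral>x. weak_grad u x \<bullet> weak_grad v x \<partial>lborel) + (\<integral>x. u x * v x \<partial>lborel)
     + (\<integral>x. ln (1 + norm x) * (u x * v x) \<partial>lborel)"

lemma X_inner_commute: "X_inner u v = X_inner v u"
  by (simp add: X_inner_def inner_commute mult.commute)

lemma X_inner_add_left:
  assumes "u \<in> X_fun" "v \<in> X_fun" "w \<in> X_fun"
  shows "X_inner (\<lambda>x. u x + v x) w = X_inner u w + X_inner v w"
proof -
  note H = assms[THEN X_fun_H1]
  note G = H[THEN weak_grad(1)]
  note L = H[THEN H1_L2]
  have "(\<integral>x. weak_grad (\<lambda>x. u x + v x) x \<bullet> weak_grad w x \<partial>lborel) =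
      (\<integral>x. weak_grad u x \<bullet> weak_grad w x + weak_grad v x \<bullet> weak_grad w x \<partial>lborel)"
    using H1_add(2)[OF H(1,2)] weak_grad(1)[OF H1_add(1)[OF H(1,2)]] G
    by (intro integral_cong_AE) (auto simp: L2_def inner_add_left)
  also have "\<dots> = (\<integral>x. weak_grad u x \<bullet> weak_grad w x \<partial>lborel) + (\<integral>x. weak_grad v x \<bullet> weak_grad w x \<partial>lborel)"
    by (intro Bochner_Integration.integral_add L2_integrable_inner G)
  moreover have "(\<integral>x. (u x + v x) * w x \<partial>lborel) = (\<integral>x. u x * w x \<partial>lborel) + (\<integral>x. v x * w x \<partial>lborel)"
    by (simp only: distrib_right) (intro Bochner_Integration.integral_add L2_integrable_mult L)
  moreover have "(\<integral>x. ln (1 + norm x) * ((u x + v x) * w x) \<partial>lborel) =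
      (\<integral>x. ln (1 + norm x) * (u x * w x) \<partial>lborel) + (\<integral>x. ln (1 + norm x) * (v x * w x) \<partial>lborel)"
    by (simp only: distrib_right distrib_left)
      (intro Bochner_Integration.integral_add X_fun_integrable_weight assms)
  ultimately show ?thesis by (simp add: X_inner_def)
qed

lemma X_inner_scale_left:
  assumes "u \<in> X_fun" "v \<in> X_fun"
  shows "X_inner (\<lambda>x. r * u x) v = r * X_inner u v"
proof -
  note H = assms[THEN X_fun_H1]
  have "(\<integral>x. weak_grad (\<lambda>x. r * u x) x \<bullet> weak_grad v x \<partial>lborel) =
      (\<integral>x. r * (weak_grad u x \<bullet> weak_grad v x) \<partial>lborel)"
    using H1_scale[OF H(1), of r] weak_grad(1)[OF H1_scale(1)[OF H(1)], of r] H[THEN weak_grad(1)]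
    by (intro integral_cong_AE) (auto simp: L2_def)
  then show ?thesis
    by (simp add: X_inner_def mult.assoc mult.left_commute[of _ r] distrib_left)
qed

lemma X_inner_self_nonneg: "0 \<le> X_inner u u"
  by (auto simp: X_inner_def intro!: add_nonneg_nonneg integral_nonneg_AE)

lemma X_inner_self_zero:
  assumes "u \<in> X_fun"
  shows "X_inner u u = 0 \<longleftrightarrow> (AE x in lborel. u x = 0)"
proof
  have L: "u \<in> L2" using assms by (simp add: X_fun_def H1_L2)
  assume "X_inner u u = 0"
  moreover have "0 \<le> (\<integral>x. weak_grad u x \<bullet> weak_grad u x \<partial>lborel)" "0 \<le> (\<integral>x. u x * u x \<partial>lborel)"
    "0 \<le> (\<integral>x. ln (1 + norm x) * (u x * u x) \<partial>lborel)"
    by (auto intro!: integral_nonneg_AE)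
  ultimately have "(\<integral>x. u x * u x \<partial>lborel) = 0"
    unfolding X_inner_def by linarith
  then show "AE x in lborel. u x = 0"
    using integral_nonneg_eq_0_iff_AE[OF L2_integrable_mult[OF L L]] by simp
next
  assume ae: "AE x in lborel. u x = 0"
  have "weak_grad u = weak_grad (\<lambda>x. 0)"
    using assms ae by (intro weak_grad_cong) (auto simp: X_fun_def H1_L2 L2_zero)
  moreover have "AE x in lborel. weak_grad (\<lambda>x. 0) x = 0"
    by (rule weak_grad_eqI[OF L2_zero L2_zero is_weak_gradient_zero])
  ultimately have "(\<integral>x. weak_grad u x \<bullet> weak_grad u x \<partial>lborel) = 0"
    by (intro integral_eq_zero_AE) auto
  moreover have "(\<integral>x. u x * u x \<partial>lborel) = 0" "(\<integral>x. ln (1 + norm x) * (u x * u x) \<partial>lborel) = 0"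
    using ae by (auto intro!: integral_eq_zero_AE)
  ultimately show "X_inner u u = 0" by (simp add: X_inner_def)
qed

lemma X_eq_weak_grad: "X_eq u v \<Longrightarrow> weak_grad u = weak_grad v"
  by (rule weak_grad_cong) (auto simp: X_eq_def X_fun_def H1_L2)

quotient_type X = "real^2 \<Rightarrow> real" / partial: X_eq
proof (rule part_equivpI)
  show "\<exists>u. X_eq u u" using X_fun_zero by (auto simp: X_eq_def)
  show "symp X_eq" by (auto simp: symp_def X_eq_def elim: eventually_mono)
  show "transp X_eq" by (auto simp: transp_def X_eq_def elim: eventually_elim2)
qed

instantiation X :: real_inner
begin

lift_definition zero_X :: X is "\<lambda>x. 0"
  by (simp add: X_eq_def X_fun_zero)

lift_definition plus_X :: "X \<Rightarrow> X \<Rightarrow> X" is "\<lambda>u v x. u x + v x"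
  by (auto simp: X_eq_def X_fun_add elim: eventually_elim2)

lift_definition scaleR_X :: "real \<Rightarrow> X \<Rightarrow> X" is "\<lambda>r u x. r * u x"
  by (auto simp: X_eq_def X_fun_scale elim: eventually_mono)

definition uminus_X :: "X \<Rightarrow> X" where "uminus_X u = (-1) *\<^sub>R u"

definition minus_X :: "X \<Rightarrow> X \<Rightarrow> X" where "minus_X u v = u + (- v)"

lift_definition inner_X :: "X \<Rightarrow> X \<Rightarrow> real" is X_inner
proof -
  fix u v u' v' assume *: "X_eq u v" "X_eq u' v'"
  then have m: "u \<in> borel_measurable borel" "v \<in> borel_measurable borel"
    "u' \<in> borel_measurable borel" "v' \<in> borel_measurable borel"
    and ae: "AE x in lborel. u x = v x" "AE x in lborel. u' x = v' x"
    by (auto simp: X_eq_def X_fun_measurable)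
  have ae: "AE x in lborel. u x * u' x = v x * v' x"
    using ae by eventually_elim simp
  then have "(\<integral>x. u x * u' x \<partial>lborel) = (\<integral>x. v x * v' x \<partial>lborel)"
    using m by (intro integral_cong_AE) auto
  moreover have "(\<integral>x. ln (1 + norm x) * (u x * u' x) \<partial>lborel) = (\<integral>x. ln (1 + norm x) * (v x * v' x) \<partial>lborel)"
    using m ae by (intro integral_cong_AE) auto
  ultimately show "X_inner u u' = X_inner v v'"
    using *[THEN X_eq_weak_grad] by (simp add: X_inner_def)
qed

definition norm_X :: "X \<Rightarrow> real" where "norm_X u = sqrt (u \<bullet> u)"

definition dist_X :: "X \<Rightarrow> X \<Rightarrow> real" where "dist_X u v = norm (u - v)"

definition sgn_X :: "X \<Rightarrow> X" where "sgn_X u = inverse (norm u) *\<^sub>R u"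

definition uniformity_X :: "(X \<times> X) filter" where
  "uniformity_X = (INF e\<in>{0<..}. principal {(u, v). dist u v < e})"

definition open_X :: "X set \<Rightarrow> bool" where
  "open_X U = (\<forall>u\<in>U. \<forall>\<^sub>F (u', v) in uniformity. u' = u \<longrightarrow> v \<in> U)"

instance
proof
  fix u v w :: X and r s :: real
  show "u + v + w = u + (v + w)"
    by transfer (auto simp: X_eq_def add.assoc intro!: X_fun_add)
  show "u + v = v + u"
    by transfer (auto simp: X_eq_def add.commute intro!: X_fun_add)
  show "0 + u = u"
    by transfer (auto simp: X_eq_def)
  show "- u + u = 0"
    unfolding uminus_X_def
    by transfer (auto simp: X_eq_def X_fun_zero intro!: X_fun_add X_fun_scale)
  show "u - v = u + - v" by (simp add: minus_X_def)
  show "r *\<^sub>R (u + v) = r *\<^sub>R u + r *\<^sub>R v"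
    by transfer (auto simp: X_eq_def distrib_left intro!: X_fun_add X_fun_scale)
  show "(r + s) *\<^sub>R u = r *\<^sub>R u + s *\<^sub>R u"
    by transfer (auto simp: X_eq_def distrib_right intro!: X_fun_add X_fun_scale)
  show "r *\<^sub>R s *\<^sub>R u = (r * s) *\<^sub>R u"
    by transfer (auto simp: X_eq_def mult.assoc intro!: X_fun_scale)
  show "1 *\<^sub>R u = u"
    by transfer (auto simp: X_eq_def)
  show "u \<bullet> v = v \<bullet> u"
    by transfer (rule X_inner_commute)
  show "(u + v) \<bullet> w = u \<bullet> w + v \<bullet> w"
    by transfer (auto simp: X_eq_def X_inner_add_left)
  show "(r *\<^sub>R u) \<bullet> v = r * (u \<bullet> v)"
    by transfer (auto simp: X_eq_def X_inner_scale_left)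
  show "0 \<le> u \<bullet> u"
    by transfer (rule X_inner_self_nonneg)
  show "(u \<bullet> u = 0) = (u = 0)"
    by transfer (auto simp: X_eq_def X_inner_self_zero X_fun_zero)
qed (simp_all add: dist_X_def sgn_X_def norm_X_def uniformity_X_def open_X_def)

end

section \<open>The functionals and the constraint sets\<close>

lift_definition A_fun :: "X \<Rightarrow> real" is "\<lambda>u. \<integral>x. (norm (weak_grad u x))\<^sup>2 \<partial>lborel"
  by (simp add: X_eq_weak_grad)

lift_definition C_fun :: "real \<Rightarrow> X \<Rightarrow> real" is "\<lambda>p u. \<integral>x. \<bar>u x\<bar> powr p \<partial>lborel"
  by (auto simp: X_eq_def intro!: integral_cong_AE dest: X_fun_measurable elim: eventually_mono)

lift_definition mass :: "X \<Rightarrow> real" is "\<lambda>u. \<integral>x. (u x)\<^sup>2 \<partial>lborel"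
  by (auto simp: X_eq_def intro!: integral_cong_AE dest: X_fun_measurable elim: eventually_mono)

lift_definition log_mass :: "X \<Rightarrow> real" is "\<lambda>u. \<integral>x. ln (1 + norm x) * (u x)\<^sup>2 \<partial>lborel"
  by (auto simp: X_eq_def intro!: integral_cong_AE dest: X_fun_measurable elim: eventually_mono)

lemma norm_X_square: "(norm u)\<^sup>2 = A_fun u + mass u + log_mass u"
  unfolding power2_norm_eq_inner
  by transfer (simp add: X_inner_def dot_square_norm flip: power2_eq_square)

definition S :: "real \<Rightarrow> X set" where
  "S c = {u. mass u = c}"

definition Q_fun :: "real \<Rightarrow> real \<Rightarrow> real \<Rightarrow> real \<Rightarrow> X \<Rightarrow> real" where
  "Q_fun \<gamma> a p c u = A_fun u - a * ((p - 2) / p) * C_fun p u - \<gamma> * (c\<^sup>2 / 4)"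

definition Lam :: "real \<Rightarrow> real \<Rightarrow> real \<Rightarrow> real \<Rightarrow> X set" where
  "Lam \<gamma> a p c = {u \<in> S c. Q_fun \<gamma> a p c u = 0}"

text \<open>The best constant, as the infimum of all admissible ones. The integrability clause is needed
  because a divergent Bochner integral has value 0.\<close>

definition K_GN :: "real \<Rightarrow> real" where
  "K_GN p = Inf {K. \<forall>u\<in>H1. integrable lborel (\<lambda>x. \<bar>u x\<bar> powr p) \<and>
     (\<integral>x. \<bar>u x\<bar> powr p \<partial>lborel) \<le>
       K * sqrt (\<integral>x. (norm (weak_grad u x))\<^sup>2 \<partial>lborel) powr (p - 2) * (sqrt (\<integral>x. (u x)\<^sup>2 \<partial>lborel))\<^sup>2}"

definition c0 :: "real \<Rightarrow> real \<Rightarrow> real \<Rightarrow> real" where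
  "c0 \<gamma> a p = 2 * ((p * (p - 4) powr ((p - 4) / 2) / (p - 2) powr (p / 2)) *
     (1 / (a * \<gamma> powr ((p - 4) / 2) * K_GN p))) powr (1 / (p - 3))"


section \<open>$C^1$ submanifolds\<close>

definition C1_on :: "'a::real_normed_vector set \<Rightarrow> ('a \<Rightarrow> 'b::real_normed_vector) \<Rightarrow> bool" where
  "C1_on U f \<longleftrightarrow> (\<exists>f'::'a \<Rightarrow> 'a \<Rightarrow>\<^sub>L 'b.
     (\<forall>x\<in>U. (f has_derivative blinfun_apply (f' x)) (at x)) \<and> continuous_on U f')"

definition C1_diffeo :: "'a::real_normed_vector set \<Rightarrow> 'b::real_normed_vector set \<Rightarrow> ('a \<Rightarrow> 'b) \<Rightarrow> bool" where
  "C1_diffeo U V f \<longleftrightarrow> open U \<and> open V \<and> bij_betw f U V \<and> C1_on U f \<and> C1_on V (inv_into U f)"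

text \<open>\<open>has_codim F E k\<close>: the subspace \<open>F\<close> of the vector space \<open>E\<close> has a
  \<open>k\<close>-dimensional algebraic complement in \<open>E\<close>.\<close>

definition has_codim :: "'a::real_vector set \<Rightarrow> 'a set \<Rightarrow> nat \<Rightarrow> bool" where
  "has_codim F E k \<longleftrightarrow> subspace F \<and> subspace E \<and> F \<subseteq> E \<and>
     (\<exists>B. finite B \<and> card B = k \<and> independent B \<and> F \<inter> span B = {0} \<and>
        E = {x + y | x y. x \<in> F \<and> y \<in> span B})"

definition straightens :: "('a::real_normed_vector \<Rightarrow> 'a) \<Rightarrow> 'a set \<Rightarrow> 'a set \<Rightarrow> 'a set \<Rightarrow> 'a set \<Rightarrow> bool" where
  "straightens \<Phi> U V M E \<longleftrightarrow> C1_diffeo U V \<Phi> \<and> subspace E \<and> closed E \<and> \<Phi> ` (U \<inter> M) = V \<inter> E"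

definition C1_submanifold :: "nat \<Rightarrow> 'a::real_normed_vector set \<Rightarrow> bool" where
  "C1_submanifold k M \<longleftrightarrow> (\<forall>x\<in>M. \<exists>\<Phi> U V E. x \<in> U \<and> straightens \<Phi> U V M E \<and> has_codim E UNIV k)"

text \<open>A submanifold \<open>N\<close> of a submanifold \<open>M\<close>: \<open>M\<close> carries the \<open>C\<^sup>1\<close> structure whose charts are the
  restrictions to \<open>M\<close> of the maps straightening \<open>M\<close>, and around each point of \<open>N\<close> one
  of these charts, with values in a closed subspace \<open>E\<close>, maps \<open>N\<close> to a closed subspace of
  codimension \<open>k\<close> in \<open>E\<close>.\<close>

definition C1_submanifold_in :: "nat \<Rightarrow> 'a::real_normed_vector set \<Rightarrow> 'a set \<Rightarrow> bool" where
  "C1_submanifold_in k M N \<longleftrightarrow> (\<exists>m. C1_submanifold m M) \<and> N \<subseteq> M \<and>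
     (\<forall>x\<in>N. \<exists>\<Phi> U V E F. x \<in> U \<and> straightens \<Phi> U V M E \<and> straightens \<Phi> U V N F \<and> has_codim F E k)"

end

theory Submission
  imports Defs
begin

text \<open>Put \<open>F u = (mass u - c, Q u)\<close>, a map from \<open>X\<close> to the plane; then \<open>S c\<close> and \<open>Lam\<close> are the preimages of
\<open>{0} \<times> \<real>\<close> and of \<open>{0}\<close>. Suppose that \<open>F\<close> is \<open>C\<^sup>1\<close> and that its derivative \<open>L\<close> at a point of \<open>Lam\<close> is
onto, with linear right inverse \<open>R\<close>. The map \<open>\<Phi> u = u + R (F u - L u)\<close> satisfies \<open>L (\<Phi> u) = F u\<close>, so it
carries \<open>S c\<close> into the preimage under \<open>L\<close> of \<open>{0} \<times> \<real>\<close> and \<open>Lam\<close> into the kernel of \<open>L\<close>, which has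
codimension 2 in \<open>X\<close> and codimension 1 in that preimage. Near the point, \<open>\<Phi>\<close> is the identity plus a map
of finite rank with small derivative, hence a \<open>C\<^sup>1\<close> diffeomorphism (\<open>C1_diffeo_straightening_map\<close>): the
equation \<open>\<Phi> u = y\<close> is a fixed point problem in the plane, where \<open>F\<close> takes its values. What remains is
that \<open>F\<close> is \<open>C\<^sup>1\<close> and that its derivative is onto at every point of \<open>Lam\<close>.

\<^bold>\<open>Differentiability.\<close> Gradient energy and mass are bounded quadratic forms. For the power term
\<open>C u = \<integral> \<bar>u\<bar>\<^sup>p\<close> the remainder of second order is bounded by the integral of
\<open>(\<bar>u\<bar> + \<bar>w\<bar>)\<^sup>q w\<^sup>2\<close> with \<open>q = p - 2\<close>, and two applications of the Cauchy--Schwarz inequality reduce it to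
integrals of powers of \<open>u\<close> and \<open>w\<close> (\<open>remainder_estimate\<close>). These are finite by the Gagliardo--Nirenberg
inequality, which comes from the planar estimate of \<open>\<integral> v\<^sup>2\<close> by the product of the \<open>L\<^sup>1\<close> norms of the two
partial derivatives of \<open>v\<close>, used for the powers of a mollification of \<open>u\<close>.

\<^bold>\<open>Transversality.\<close> Since \<open>mass_deriv u u = 2 c\<close>, the derivative of \<open>F\<close> fails to be onto only if
\<open>A' = \<kappa> C' + \<mu> mass'\<close> at \<open>u\<close> for some number \<open>\<mu>\<close>, where \<open>\<kappa> = a (p - 2) / p\<close>. Testing this with \<open>u\<close> gives
\<open>2 A = \<kappa> p C + 2 \<mu> c\<close>, and the Pohozaev identity in the plane says that \<open>\<kappa> C + \<mu> c = 0\<close>. Hence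
\<open>2 A = a (p - 2)\<^sup>2 / p * C\<close>, and \<open>Q u = 0\<close> turns this into \<open>A = (p - 2) / (p - 4) * \<gamma> c\<^sup>2 / 4\<close>. With these
values of \<open>A\<close> and \<open>C\<close> the Gagliardo--Nirenberg inequality with its best constant becomes \<open>c \<ge> c0\<close>
(\<open>critical_mass_bound\<close>), against the hypothesis.

\<^bold>\<open>The Pohozaev identity.\<close> The usual multiplier \<open>x \<bullet> \<nabla>u\<close> is in general not an element of \<open>X\<close>. Instead, \<open>u\<close>
is compared with \<open>u \<circ> \<phi>\<close>, where \<open>\<phi>\<close> moves each point parallel to one axis and by at most a multiple of
\<open>t\<close>. The values of \<open>A\<close>, \<open>C\<close> and \<open>mass\<close> at \<open>u \<circ> \<phi>\<close> are explicit functions of \<open>t\<close>. The difference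
\<open>w = u \<circ> \<phi> - u\<close> is an element of \<open>X\<close> with \<open>L\<^sup>2\<close> norm of order \<open>t\<close>, so the remainders of \<open>C\<close> and \<open>mass\<close> are
\<open>o(t)\<close>; the remainder of \<open>A\<close> is \<open>A w\<close>, which is bounded and nonnegative. An inequality up to
\<open>o(t)\<close> for all small \<open>t\<close> of both signs is an equality of derivatives at \<open>t = 0\<close>. When the stretch tends
to a uniform one, and the results for the two axes are added, the gradient terms cancel.\<close>

section \<open>Straightening the level sets of a submersion onto a finite-dimensional space\<close>

lemma finite_rank_perturbation_expands:
  fixes N :: "'a::real_normed_vector \<Rightarrow> 'b::real_normed_vector"
  assumes R: "linear R" "\<And>t. norm (R t) \<le> b * norm t" "0 \<le> b"
    and N: "norm (N u - N v) \<le> \<delta> * norm (u - v)" and "\<delta> * b \<le> 1 / 2"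
  shows "norm (u - v) \<le> 2 * norm ((u + R (N u)) - (v + R (N v)))"
proof -
  have "norm (R (N u - N v)) \<le> b * (\<delta> * norm (u - v))"
    by (rule order_trans[OF R(2) mult_left_mono[OF N R(3)]])
  also have "\<dots> = (\<delta> * b) * norm (u - v)" by simp
  also have "\<dots> \<le> 1 / 2 * norm (u - v)"
    by (rule mult_right_mono) (use assms in auto)
  finally have "norm (R (N u - N v)) \<le> 1 / 2 * norm (u - v)" .
  moreover have eq: "(u + R (N u)) - (v + R (N v)) = (u - v) + R (N u - N v)"
    by (simp add: linear_diff[OF R(1)])
  have "norm (u - v) \<le> norm ((u - v) + R (N u - N v)) + norm (R (N u - N v))"
    using norm_triangle_ineq4[of "(u - v) + R (N u - N v)" "R (N u - N v)"] by simp
  ultimately show ?thesis unfolding eq by linarith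
qed

text \<open>A solution of \<open>u + R (N u) = y\<close> has the form \<open>u = y - R t\<close> with \<open>t = N u\<close>, so \<open>t\<close> is a fixed point of
\<open>t \<mapsto> N (y - R t)\<close>. This is a contraction of a closed ball of the Euclidean space \<open>'b\<close>, whatever the
normed space \<open>'a\<close> is.\<close>

lemma finite_rank_perturbation_solvable:
  fixes N :: "'a::real_normed_vector \<Rightarrow> 'b::euclidean_space"
  assumes R: "linear R" "\<And>t. norm (R t) \<le> b * norm t" "0 \<le> b"
    and N: "\<And>u v. u \<in> cball a r \<Longrightarrow> v \<in> cball a r \<Longrightarrow> norm (N u - N v) \<le> \<delta> * norm (u - v)"
    and \<delta>: "0 \<le> \<delta>" "\<delta> * b \<le> 1 / 2" and r: "0 \<le> r"
    and y: "norm (y - (a + R (N a))) \<le> r / 2"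
  shows "\<exists>u\<in>cball a r. u + R (N u) = y"
proof -
  define T where "T = cball (N a) (\<delta> * r)"
  have in_ball: "y - R t \<in> cball a r" if "t \<in> T" for t
  proof -
    have "norm (R (t - N a)) \<le> b * (\<delta> * r)"
      using that by (intro order_trans[OF R(2) mult_left_mono[OF _ R(3)]])
        (auto simp: T_def dist_norm norm_minus_commute)
    also have "\<dots> = (\<delta> * b) * r" by simp
    also have "\<dots> \<le> 1 / 2 * r" by (rule mult_right_mono) (use \<delta> r in auto)
    finally have "norm (R (t - N a)) \<le> r / 2" by simp
    moreover have eq: "y - R t - a = (y - (a + R (N a))) - R (t - N a)"
      by (simp add: linear_diff[OF R(1)])
    ultimately have "norm (y - R t - a) \<le> r"
      unfolding eq using y norm_triangle_ineq4[of "y - (a + R (N a))" "R (t - N a)"] by linarith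
    then show ?thesis by (simp add: dist_norm norm_minus_commute)
  qed
  have "\<exists>!t\<in>T. N (y - R t) = t"
  proof (rule Banach_fix[of _ "1 / 2"])
    show "complete T" by (simp add: T_def complete_eq_closed)
    show "T \<noteq> {}" using mult_nonneg_nonneg[OF \<delta>(1) r] by (simp add: T_def)
    show "(\<lambda>t. N (y - R t)) ` T \<subseteq> T"
    proof safe
      fix t assume t: "t \<in> T"
      have a: "a \<in> cball a r" using r by simp
      have "norm (N (y - R t) - N a) \<le> \<delta> * norm (y - R t - a)"
        by (rule N[OF in_ball[OF t] a])
      also have "\<dots> \<le> \<delta> * r"
        using in_ball[OF t] \<delta> by (intro mult_left_mono) (auto simp: dist_norm norm_minus_commute)
      finally show "N (y - R t) \<in> T" by (simp add: T_def dist_norm norm_minus_commute)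
    qed
    fix t t' assume t: "t \<in> T" "t' \<in> T"
    have "dist (N (y - R t)) (N (y - R t')) \<le> \<delta> * norm (R (t' - t))"
      using N[OF in_ball[OF t(1)] in_ball[OF t(2)]] by (simp add: dist_norm linear_diff[OF R(1)])
    also have "\<dots> \<le> \<delta> * (b * norm (t' - t))" by (rule mult_left_mono[OF R(2) \<delta>(1)])
    also have "\<dots> = (\<delta> * b) * dist t t'" by (simp add: dist_norm norm_minus_commute)
    also have "\<dots> \<le> 1 / 2 * dist t t'" by (rule mult_right_mono) (use \<delta> in auto)
    finally show "dist (N (y - R t)) (N (y - R t')) \<le> 1 / 2 * dist t t'" .
  qed auto
  then obtain t where "t \<in> T" "N (y - R t) = t" by blast
  then show ?thesis using in_ball[of t] by (intro bexI[of _ "y - R t"]) auto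
qed

text \<open>An inverse function theorem for perturbations of the identity of finite rank. Both \<open>\<Phi>\<close> and
its derivatives have the form \<open>id + R N\<close> with \<open>N\<close> of small Lipschitz constant near \<open>u0\<close>, so the two
preceding lemmas give injectivity with a Lipschitz inverse and surjectivity for each of them.\<close>

proposition C1_diffeo_straightening_map:
  fixes F :: "'a::real_normed_vector \<Rightarrow> 'b::euclidean_space" and F' :: "'a \<Rightarrow> 'a \<Rightarrow>\<^sub>L 'b" and u0 :: 'a
  assumes F: "\<And>u. (F has_derivative blinfun_apply (F' u)) (at u)" "continuous_on UNIV F'"
    and R: "bounded_linear R"
  defines "\<Phi> \<equiv> \<lambda>u. u + R (F u - F' u0 u)"
  shows "\<exists>U V. u0 \<in> U \<and> C1_diffeo U V \<Phi>"
proof -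
  obtain b where b: "b > 0" "\<And>t. norm (R t) \<le> b * norm t"
    using bounded_linear.pos_bounded[OF R] by (auto simp: mult.commute)
  note R' = bounded_linear.linear[OF R] b(2) less_imp_le[OF b(1)]
  define \<delta> where "\<delta> = 1 / (2 * b)"
  have \<delta>: "0 < \<delta>" "0 \<le> \<delta>" "\<delta> * b \<le> 1 / 2" using b by (auto simp: \<delta>_def)
  define N where "N u = F u - F' u0 u" for u
  define M where "M u = F' u - F' u0" for u
  have \<Phi>: "\<Phi> = (\<lambda>u. u + R (N u))" by (simp add: \<Phi>_def N_def)
  have cM: "continuous_on UNIV M" unfolding M_def by (intro continuous_intros F)
  have dN: "(N has_derivative blinfun_apply (M u)) (at u)" for u
    unfolding N_def M_def by (auto intro!: derivative_eq_intros F(1) simp: blinfun.diff_left)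
  obtain r where r: "r > 0" "\<And>u. u \<in> ball u0 r \<Longrightarrow> norm (M u) \<le> \<delta>"
  proof -
    have "isCont M u0" using cM by (simp add: continuous_on_eq_continuous_at)
    then obtain r where "r > 0" "\<And>u. dist u u0 < r \<Longrightarrow> dist (M u) (M u0) < \<delta>"
      using \<delta>(1) unfolding continuous_at_eps_delta by blast
    moreover have "dist (M u) (M u0) = norm (M u)" for u by (simp add: M_def dist_norm)
    ultimately show ?thesis by (intro that[of r]) (auto simp: dist_commute less_imp_le)
  qed
  define U where "U = ball u0 r"
  have U: "open U" "u0 \<in> U" using r by (auto simp: U_def)
  have lip: "norm (N u - N v) \<le> \<delta> * norm (u - v)" if "u \<in> U" "v \<in> U" for u v
  proof (rule differentiable_bound[of U N "\<lambda>u. blinfun_apply (M u)"])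
    show "convex U" by (simp add: U_def)
    show "(N has_derivative blinfun_apply (M x)) (at x within U)" for x
      by (rule has_derivative_at_withinI[OF dN])
    show "onorm (blinfun_apply (M x)) \<le> \<delta>" if "x \<in> U" for x
      using r(2)[of x] that by (simp add: U_def norm_blinfun.rep_eq)
  qed (use that in auto)
  have expand: "norm (u - v) \<le> 2 * norm (\<Phi> u - \<Phi> v)" if "u \<in> U" "v \<in> U" for u v
    unfolding \<Phi> by (rule finite_rank_perturbation_expands[OF R' lip[OF that] \<delta>(3)])
  have inj: "inj_on \<Phi> U"
    by (rule inj_onI) (use expand in fastforce)
  have "open (\<Phi> ` U)"
    unfolding open_contains_ball
  proof
    fix z assume "z \<in> \<Phi> ` U"
    then obtain a where a: "a \<in> U" "z = \<Phi> a" by auto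
    obtain s where s: "s > 0" "cball a s \<subseteq> U"
      using U(1) a(1) open_contains_cball by blast
    have "ball z (s / 2) \<subseteq> \<Phi> ` U"
    proof
      fix y assume "y \<in> ball z (s / 2)"
      then have "norm (y - (a + R (N a))) \<le> s / 2"
        by (simp add: a(2) \<Phi> dist_norm norm_minus_commute)
      then have "\<exists>u\<in>cball a s. u + R (N u) = y"
        using s by (intro finite_rank_perturbation_solvable[OF R' _ \<delta>(2,3)] lip) auto
      then show "y \<in> \<Phi> ` U" using s(2) by (auto simp: \<Phi>)
    qed
    then show "\<exists>e>0. ball z e \<subseteq> \<Phi> ` U" using s(1) by (intro exI[of _ "s / 2"]) auto
  qed
  define \<Phi>' where "\<Phi>' u = id_blinfun + (Blinfun R o\<^sub>L M u)" for u
  have \<Phi>'_apply: "\<Phi>' u x = x + R (M u x)" for u x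
    by (simp add: \<Phi>'_def blinfun.add_left bounded_linear_Blinfun_apply[OF R])
  have d\<Phi>: "(\<Phi> has_derivative blinfun_apply (\<Phi>' u)) (at u)" for u
    unfolding \<Phi> \<Phi>'_apply
    by (intro has_derivative_add has_derivative_ident bounded_linear.has_derivative[OF R] dN)
  have c\<Phi>': "continuous_on UNIV \<Phi>'"
    unfolding \<Phi>'_def by (intro continuous_intros bounded_bilinear.continuous_on[OF bounded_bilinear_blinfun_compose] cM)
  have Mlip: "norm (M u x - M u y) \<le> \<delta> * norm (x - y)" if "u \<in> U" for u x y
  proof -
    have "norm (M u (x - y)) \<le> norm (M u) * norm (x - y)" by (rule norm_blinfun)
    also have "\<dots> \<le> \<delta> * norm (x - y)"
      using that r(2) by (intro mult_right_mono) (auto simp: U_def)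
    finally show ?thesis by (simp add: blinfun.diff_right)
  qed
  have expand': "norm (x - y) \<le> 2 * norm (\<Phi>' u x - \<Phi>' u y)" if "u \<in> U" for u x y
    unfolding \<Phi>'_apply
    by (rule finite_rank_perturbation_expands[where N = "blinfun_apply (M u)", OF R' Mlip[OF that] \<delta>(3)])
  have surj': "\<exists>x. \<Phi>' u x = y" if "u \<in> U" for u y
  proof -
    have "\<exists>x\<in>cball 0 (2 * norm y). x + R (M u x) = y"
      by (intro finite_rank_perturbation_solvable[OF R' _ \<delta>(2,3)] Mlip[OF that])
        (auto simp: blinfun.zero_right linear_0[OF R'(1)])
    then show ?thesis by (auto simp: \<Phi>'_apply)
  qed
  \<comment> \<open>The inverse of the derivative at \<open>u\<close>; its operator norm is at most 2.\<close>
  define J where "J u y = (SOME x. \<Phi>' u x = y)" for u y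
  have J: "\<Phi>' u (J u y) = y" if "u \<in> U" for u y
    unfolding J_def using surj'[OF that] by (rule someI_ex)
  have J': "J u (\<Phi>' u x) = x" if "u \<in> U" for u x
    using expand'[OF that, of "J u (\<Phi>' u x)" x] J[OF that] by simp
  have blJ: "bounded_linear (J u)" if u: "u \<in> U" for u
  proof (rule bounded_linear_intro[of _ 2])
    show "J u (x + y) = J u x + J u y" for x y
      using J'[OF u, of "J u x + J u y"] by (simp add: blinfun.add_right J[OF u])
    show "J u (s *\<^sub>R x) = s *\<^sub>R J u x" for s x
      using J'[OF u, of "s *\<^sub>R J u x"] by (simp add: blinfun.scaleR_right J[OF u])
    show "norm (J u x) \<le> norm x * 2" for x
      using expand'[OF u, of "J u x" 0] by (simp add: J[OF u] blinfun.zero_right mult.commute)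
  qed
  define g where "g = inv_into U \<Phi>"
  have g: "g z \<in> U" "\<Phi> (g z) = z" if "z \<in> \<Phi> ` U" for z
    using that unfolding g_def by (auto intro: inv_into_into f_inv_into_f)
  have glip: "dist (g y) (g z) \<le> 2 * dist y z" if "y \<in> \<Phi> ` U" "z \<in> \<Phi> ` U" for y z
    using expand[OF g(1)[OF that(1)] g(1)[OF that(2)]] by (simp add: g(2) that dist_norm)
  have cg: "continuous_on (\<Phi> ` U) g"
  proof (rule continuous_onI)
    fix x e :: real and z assume "z \<in> \<Phi> ` U" "e > 0"
    then show "\<exists>d>0. \<forall>y\<in>\<Phi> ` U. dist y z < d \<longrightarrow> dist (g y) (g z) \<le> e"
      using glip by (intro exI[of _ "e / 2"]) (force)
  qed
  have gapp: "Blinfun (J (g z)) y = J (g z) y" if "z \<in> \<Phi> ` U" for z y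
    using bounded_linear_Blinfun_apply[OF blJ[OF g(1)[OF that]]] by simp
  have Jlip: "norm (Blinfun (J (g y)) - Blinfun (J (g z))) \<le> 4 * norm (\<Phi>' (g z) - \<Phi>' (g y))"
    if yz: "y \<in> \<Phi> ` U" "z \<in> \<Phi> ` U" for y z
  proof (rule norm_blinfun_bound)
    fix x
    note gy = g(1)[OF yz(1)] and gz = g(1)[OF yz(2)]
    have Jn: "norm (J u x) \<le> 2 * norm x" if "u \<in> U" for u x
      using expand'[OF that, of "J u x" 0] by (simp add: J[OF that] blinfun.zero_right)
    \<comment> \<open>The resolvent identity, which makes inversion of operators continuous.\<close>
    have "J (g y) x - J (g z) x = J (g y) ((\<Phi>' (g z) - \<Phi>' (g y)) (J (g z) x))"
      by (simp add: blinfun.diff_left J[OF gz] linear_diff[OF bounded_linear.linear[OF blJ[OF gy]]] J'[OF gy])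
    also have "norm \<dots> \<le> 2 * (norm (\<Phi>' (g z) - \<Phi>' (g y)) * (2 * norm x))"
      by (intro order_trans[OF Jn[OF gy]] mult_left_mono order_trans[OF norm_blinfun] Jn[OF gz]) auto
    finally show "norm ((Blinfun (J (g y)) - Blinfun (J (g z))) x) \<le>
        4 * norm (\<Phi>' (g z) - \<Phi>' (g y)) * norm x"
      by (simp add: blinfun.diff_left gapp yz)
  qed auto
  have cJ: "continuous_on (\<Phi> ` U) (\<lambda>z. Blinfun (J (g z)))"
    unfolding continuous_on_def
  proof
    fix z assume z: "z \<in> \<Phi> ` U"
    have "continuous_on (\<Phi> ` U) (\<lambda>y. \<Phi>' (g y))"
      by (rule continuous_on_compose2[OF c\<Phi>' cg]) simp
    then have "((\<lambda>y. \<Phi>' (g y)) \<longlongrightarrow> \<Phi>' (g z)) (at z within \<Phi> ` U)"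
      using z unfolding continuous_on_def by blast
    then have "((\<lambda>y. norm (\<Phi>' (g z) - \<Phi>' (g y))) \<longlongrightarrow> norm (\<Phi>' (g z) - \<Phi>' (g z))) (at z within \<Phi> ` U)"
      by (intro tendsto_intros)
    then have lim: "((\<lambda>y. 4 * norm (\<Phi>' (g z) - \<Phi>' (g y))) \<longlongrightarrow> 0) (at z within \<Phi> ` U)"
      using tendsto_mult_right_zero by fastforce
    show "((\<lambda>y. Blinfun (J (g y))) \<longlongrightarrow> Blinfun (J (g z))) (at z within \<Phi> ` U)"
      unfolding tendsto_iff dist_norm
    proof (intro allI impI)
      fix e :: real assume "e > 0"
      with lim have "\<forall>\<^sub>F y in at z within \<Phi> ` U. 4 * norm (\<Phi>' (g z) - \<Phi>' (g y)) < e"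
        by (rule order_tendstoD(2))
      then show "\<forall>\<^sub>F y in at z within \<Phi> ` U. norm (Blinfun (J (g y)) - Blinfun (J (g z))) < e"
        unfolding eventually_at_topological using Jlip z by (meson order_le_less_trans)
    qed
  qed
  have "C1_diffeo U (\<Phi> ` U) \<Phi>"
    unfolding C1_diffeo_def
  proof (intro conjI)
    show "C1_on U \<Phi>"
      unfolding C1_on_def using d\<Phi> continuous_on_subset[OF c\<Phi>'] by blast
    show "C1_on (\<Phi> ` U) (inv_into U \<Phi>)"
      unfolding C1_on_def g_def[symmetric]
    proof (intro exI conjI ballI)
      show "continuous_on (\<Phi> ` U) (\<lambda>z. Blinfun (J (g z)))" by (rule cJ)
      fix z assume z: "z \<in> \<Phi> ` U"
      note gz = g(1)[OF z]
      show "(g has_derivative blinfun_apply (Blinfun (J (g z)))) (at z)"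
      proof (rule has_derivative_inverse_basic[OF d\<Phi>])
        show "blinfun_apply (Blinfun (J (g z))) \<circ> blinfun_apply (\<Phi>' (g z)) = id"
          by (rule ext) (simp add: gapp[OF z] J'[OF gz])
        show "continuous (at z) g"
          using cg z unfolding continuous_on_eq_continuous_at[OF \<open>open (\<Phi> ` U)\<close>] by blast
      qed (use \<open>open (\<Phi> ` U)\<close> z g in \<open>auto intro: blinfun.bounded_linear_right\<close>)
    qed
  qed (use U inj \<open>open (\<Phi> ` U)\<close> in \<open>auto simp: bij_betw_def\<close>)
  with U show ?thesis by blast
qed

lemma C1_diffeo_straightens_level_set:
  fixes \<Phi> :: "'a::real_normed_vector \<Rightarrow> 'a" and L :: "'a \<Rightarrow>\<^sub>L 'b::real_normed_vector"
  assumes "C1_diffeo U V \<Phi>" "\<And>u. L (\<Phi> u) = F u" "subspace W" "closed W"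
  shows "straightens \<Phi> U V {u. F u \<in> W} {x. L x \<in> W}"
proof -
  have "subspace {x. L x \<in> W}"
    using assms(3) by (auto simp: subspace_def blinfun.zero_right blinfun.add_right blinfun.scaleR_right)
  moreover have "closed {x. L x \<in> W}"
    using closed_vimage[OF assms(4), of "blinfun_apply L"]
    by (simp add: vimage_def linear_continuous_on blinfun.bounded_linear_right)
  moreover have "\<Phi> ` U = V" using assms(1) by (simp add: C1_diffeo_def bij_betw_def)
  then have "\<Phi> ` (U \<inter> {u. F u \<in> W}) = V \<inter> {x. L x \<in> W}"
    using assms(2) by (fastforce simp: image_iff)
  ultimately show ?thesis using assms(1) by (simp add: straightens_def)
qed

section \<open>Operations on test functions\<close>

lemma C_diff_inner: "C_diff k (\<lambda>x::'a::euclidean_space. x \<bullet> e)"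
proof (cases k)
  case (Suc n)
  have "((\<lambda>x::'a. x \<bullet> e) has_derivative (\<lambda>h. h \<bullet> e)) (at x)" for x
    by (auto intro!: derivative_eq_intros)
  from C_diff_has_derivative[OF this] show ?thesis by (simp add: Suc C_diff_const)
qed (auto intro!: continuous_intros)

lemma C_diff_sum:
  "(\<And>i. i \<in> I \<Longrightarrow> C_diff k (f i)) \<Longrightarrow> C_diff k (\<lambda>x. \<Sum>i\<in>I. f i x)"
  by (induction I rule: infinite_finite_induct) (auto intro!: C_diff_add C_diff_const)

text \<open>The chain rule writes a partial derivative of \<open>f \<circ> T\<close> as a sum of products of partial derivatives of
\<open>f\<close>, composed with \<open>T\<close>, and of the components of \<open>T\<close>; this is what the induction on \<open>k\<close> consumes.\<close>

lemma C_diff_compose: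
  fixes f :: "'b::euclidean_space \<Rightarrow> real" and T :: "'a::euclidean_space \<Rightarrow> 'b"
  assumes "C_diff k f" "\<And>j. j \<in> Basis \<Longrightarrow> C_diff k (\<lambda>x. T x \<bullet> j)"
  shows "C_diff k (\<lambda>x. f (T x))"
  using assms
proof (induction k arbitrary: f)
  case 0
  then have "continuous_on UNIV T" by (subst continuous_on_componentwise) auto
  with 0 show ?case by (auto intro: continuous_on_compose2)
next
  case (Suc k)
  let ?D = "\<lambda>x h. \<Sum>j\<in>Basis. frechet_derivative (\<lambda>x. T x \<bullet> j) (at x) h * frechet_derivative f (at (T x)) j"
  have "((\<lambda>x. f (T x)) has_derivative ?D x) (at x)" for x
  proof -
    have "(T has_derivative (\<lambda>h. \<Sum>j\<in>Basis. frechet_derivative (\<lambda>x. T x \<bullet> j) (at x) h *\<^sub>R j)) (at x)"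
    proof (subst has_derivative_componentwise_within, intro ballI)
      fix j :: 'b assume j: "j \<in> Basis"
      then have "((\<lambda>x. T x \<bullet> j) has_derivative frechet_derivative (\<lambda>x. T x \<bullet> j) (at x)) (at x)"
        using Suc.prems(2)[OF j] by (simp add: frechet_derivative_works[symmetric])
      moreover have "(\<lambda>h. (\<Sum>j\<in>Basis. frechet_derivative (\<lambda>x. T x \<bullet> j) (at x) h *\<^sub>R j) \<bullet> j) =
          frechet_derivative (\<lambda>x. T x \<bullet> j) (at x)"
        using j by (simp add: inner_sum_left_Basis)
      ultimately show "((\<lambda>x. T x \<bullet> j) has_derivative
          (\<lambda>h. (\<Sum>j\<in>Basis. frechet_derivative (\<lambda>x. T x \<bullet> j) (at x) h *\<^sub>R j) \<bullet> j)) (at x)" by simp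
    qed
    moreover have df: "(f has_derivative frechet_derivative f (at (T x))) (at (T x))"
      using Suc.prems(1) by (simp add: frechet_derivative_works[symmetric])
    ultimately have "((\<lambda>x. f (T x)) has_derivative
        (\<lambda>h. frechet_derivative f (at (T x))
          (\<Sum>j\<in>Basis. frechet_derivative (\<lambda>x. T x \<bullet> j) (at x) h *\<^sub>R j))) (at x)"
      by (rule has_derivative_compose)
    moreover have "linear (frechet_derivative f (at (T x)))"
      using df by (rule has_derivative_linear)
    ultimately show ?thesis by (simp add: linear_sum linear_cmul)
  qed
  then have "C_diff (Suc k) (\<lambda>x. f (T x)) \<longleftrightarrow> (\<forall>i\<in>Basis. C_diff k (\<lambda>x. ?D x i))"
    by (rule C_diff_has_derivative)
  moreover have "C_diff k (\<lambda>x. ?D x i)" if i: "i \<in> Basis" for i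
  proof (rule C_diff_sum, rule C_diff_mult)
    fix j :: 'b assume j: "j \<in> Basis"
    show "C_diff k (\<lambda>x. frechet_derivative (\<lambda>x. T x \<bullet> j) (at x) i)"
      using Suc.prems(2)[OF j] i by simp
    have "C_diff k (\<lambda>x. frechet_derivative f (at x) j)"
      using Suc.prems(1) j by simp
    then show "C_diff k (\<lambda>x. frechet_derivative f (at (T x)) j)"
      by (rule Suc.IH) (rule C_diff_SucD[OF Suc.prems(2)])
  qed
  ultimately show ?case by blast
qed

text \<open>The bound on \<open>norm x\<close> says that \<open>T\<close> moves points by at most \<open>M\<close> towards the origin, so that the support
of the composition stays bounded.\<close>

lemma test_function_compose:
  fixes T :: "'a::euclidean_space \<Rightarrow> 'b::euclidean_space"
  assumes \<phi>: "test_function \<phi>" and T: "\<And>k j. j \<in> Basis \<Longrightarrow> C_diff k (\<lambda>x. T x \<bullet> j)"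
    and M: "\<And>x. norm x \<le> norm (T x) + M"
  shows "test_function (\<lambda>x. \<phi> (T x))"
  unfolding test_function_def
proof
  show "smooth (\<lambda>x. \<phi> (T x))"
    using \<phi> C_diff_compose[OF _ T] unfolding smooth_def test_function_def by blast
  have "bounded {x. \<phi> x \<noteq> 0}" using \<phi> by (simp add: test_function_def compact_closure)
  then obtain B where B: "\<And>x. \<phi> x \<noteq> 0 \<Longrightarrow> norm x \<le> B" by (auto simp: bounded_iff)
  have "norm x \<le> B + M" if "\<phi> (T x) \<noteq> 0" for x
    using B[OF that] M[of x] by linarith
  then show "compact (closure {x. \<phi> (T x) \<noteq> 0})"
    unfolding compact_closure bounded_iff by blast
qed

lemma test_function_translate:
  fixes \<phi> :: "'a::euclidean_space \<Rightarrow> real"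
  assumes "test_function \<phi>"
  shows "test_function (\<lambda>x. \<phi> (x - z))"
proof (rule test_function_compose[OF assms])
  show "C_diff k (\<lambda>x. (x - z) \<bullet> j)" for k and j :: 'a
    using C_diff_add[OF C_diff_inner C_diff_const, of k j "- (z \<bullet> j)"]
    by (simp add: inner_diff_left)
  show "norm x \<le> norm (x - z) + norm z" for x
    using norm_triangle_ineq[of "x - z" z] by simp
qed

lemma test_function_mult:
  assumes "smooth J" "test_function \<phi>"
  shows "test_function (\<lambda>x. J x * \<phi> x)"
  unfolding test_function_def
proof
  show "smooth (\<lambda>x. J x * \<phi> x)"
    using assms C_diff_mult unfolding smooth_def test_function_def by blast
  have "bounded {x. \<phi> x \<noteq> 0}" using assms by (simp add: test_function_def compact_closure)
  then show "compact (closure {x. J x * \<phi> x \<noteq> 0})"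
    unfolding compact_closure by (rule bounded_subset) auto
qed

lemma test_function_has_derivative:
  "test_function \<phi> \<Longrightarrow> (\<phi> has_derivative frechet_derivative \<phi> (at x)) (at x)"
proof -
  assume "test_function \<phi>"
  then have "C_diff (Suc 0) \<phi>" unfolding test_function_def smooth_def by blast
  then show ?thesis by (simp add: frechet_derivative_works[symmetric])
qed

lemma test_function_derivative_expand:
  assumes "test_function \<phi>"
  shows "frechet_derivative \<phi> (at x) h = (\<Sum>i\<in>Basis. (h \<bullet> i) * frechet_derivative \<phi> (at x) i)"
proof -
  have lin: "linear (frechet_derivative \<phi> (at x))"
    by (rule has_derivative_linear[OF test_function_has_derivative[OF assms]])
  have "frechet_derivative \<phi> (at x) h = frechet_derivative \<phi> (at x) (\<Sum>i\<in>Basis. (h \<bullet> i) *\<^sub>R i)"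
    by (simp add: euclidean_representation)
  then show ?thesis by (simp add: linear_sum[OF lin] linear_cmul[OF lin])
qed

lemma test_function_measurable: "test_function \<phi> \<Longrightarrow> \<phi> \<in> borel_measurable borel"
  using smooth_measurable[of \<phi>] by (simp add: test_function_def)

lemma test_function_support:
  assumes "test_function \<phi>"
  obtains M where "0 \<le> M" "\<And>x. \<phi> x \<noteq> 0 \<Longrightarrow> norm x \<le> M"
proof -
  have "bounded {x. \<phi> x \<noteq> 0}" using assms by (simp add: test_function_def compact_closure)
  then obtain B where B: "\<And>x. \<phi> x \<noteq> 0 \<Longrightarrow> norm x \<le> B" by (auto simp: bounded_iff)
  show ?thesis
    by (rule that[of "\<bar>B\<bar>"]) (use B in \<open>auto intro: order_trans[OF _ abs_ge_self]\<close>)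
qed

lemma continuous_compact_support_bounded:
  fixes f :: "'a::euclidean_space \<Rightarrow> real"
  assumes "continuous_on UNIV f" "\<And>x. f x \<noteq> 0 \<Longrightarrow> norm x \<le> M"
  obtains B where "0 \<le> B" "\<And>x. \<bar>f x\<bar> \<le> B"
proof -
  have "bounded (f ` cball 0 M)"
    by (intro compact_imp_bounded compact_continuous_image continuous_on_subset[OF assms(1)]) auto
  then obtain B where B: "\<And>x. x \<in> cball 0 M \<Longrightarrow> \<bar>f x\<bar> \<le> B" unfolding bounded_iff by force
  have "\<bar>f x\<bar> \<le> \<bar>B\<bar>" for x
    using B[of x] assms(2)[of x] by (cases "f x = 0") auto
  then show ?thesis by (intro that[of "\<bar>B\<bar>"]) auto
qed

lemma test_function_bounded:
  assumes "test_function \<phi>"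
  obtains B where "0 \<le> B" "\<And>x. \<bar>\<phi> x\<bar> \<le> B"
proof -
  obtain M where "\<And>x. \<phi> x \<noteq> 0 \<Longrightarrow> norm x \<le> M" using test_function_support[OF assms] by blast
  moreover have "continuous_on UNIV \<phi>"
    using assms C_diff_continuous unfolding test_function_def smooth_def by blast
  ultimately obtain B where "0 \<le> B" "\<And>x. \<bar>\<phi> x\<bar> \<le> B"
    using continuous_compact_support_bounded[of \<phi> M] by blast
  then show ?thesis by (rule that)
qed

lemma test_function_lipschitz:
  fixes \<phi> :: "'a::euclidean_space \<Rightarrow> real"
  assumes "test_function \<phi>"
  obtains B where "0 \<le> B" "\<And>x y. \<bar>\<phi> x - \<phi> y\<bar> \<le> B * norm (x - y)"
proof -
  obtain M where M: "\<And>x. \<phi> x \<noteq> 0 \<Longrightarrow> norm x \<le> M" using test_function_support[OF assms] by blast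
  have "\<exists>B\<ge>0. \<forall>x. \<bar>frechet_derivative \<phi> (at x) i\<bar> \<le> B" if i: "i \<in> Basis" for i
  proof -
    have "C_diff (Suc 0) \<phi>" using assms unfolding test_function_def smooth_def by blast
    then have "continuous_on UNIV (\<lambda>x. frechet_derivative \<phi> (at x) i)" using i by auto
    moreover have "norm x \<le> M" if "frechet_derivative \<phi> (at x) i \<noteq> 0" for x
    proof (rule ccontr)
      assume "\<not> norm x \<le> M"
      then have x: "x \<in> - cball 0 M" by auto
      have "(\<phi> has_derivative (\<lambda>h. 0)) (at x)"
        by (rule has_derivative_transform_within_open[of "\<lambda>_. 0" _ _ _ "- cball 0 M"])
          (use M x in auto)
      then have "frechet_derivative \<phi> (at x) = (\<lambda>h. 0)" by (metis frechet_derivative_at)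
      with that show False by simp
    qed
    ultimately obtain B where "0 \<le> B" "\<And>x. \<bar>frechet_derivative \<phi> (at x) i\<bar> \<le> B"
      using continuous_compact_support_bounded[of "\<lambda>x. frechet_derivative \<phi> (at x) i" M] by blast
    then show ?thesis by blast
  qed
  then obtain B where B: "\<And>i. i \<in> Basis \<Longrightarrow> 0 \<le> B i"
      "\<And>i x. i \<in> Basis \<Longrightarrow> \<bar>frechet_derivative \<phi> (at x) i\<bar> \<le> B i" by metis
  have on: "onorm (frechet_derivative \<phi> (at x)) \<le> (\<Sum>i\<in>Basis. B i)" for x
  proof (rule onorm_le)
    fix h
    have "frechet_derivative \<phi> (at x) h = (\<Sum>i\<in>Basis. (h \<bullet> i) * frechet_derivative \<phi> (at x) i)"
      by (rule test_function_derivative_expand[OF assms])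
    also have "\<bar>\<dots>\<bar> \<le> (\<Sum>i\<in>Basis. norm h * B i)"
      by (intro order_trans[OF sum_abs] sum_mono) (auto simp: abs_mult intro!: mult_mono Basis_le_norm B)
    finally show "norm (frechet_derivative \<phi> (at x) h) \<le> (\<Sum>i\<in>Basis. B i) * norm h"
      by (simp add: sum_distrib_left mult.commute)
  qed
  show ?thesis
  proof (rule that)
    show "0 \<le> (\<Sum>i\<in>Basis. B i)" by (intro sum_nonneg B)
    show "\<bar>\<phi> x - \<phi> y\<bar> \<le> (\<Sum>i\<in>Basis. B i) * norm (x - y)" for x y
      using differentiable_bound[of UNIV \<phi> "\<lambda>x. frechet_derivative \<phi> (at x)" _ x y]
        test_function_has_derivative[OF assms] on by simp
  qed
qed

section \<open>Mollification and translations of functions with a weak gradient\<close>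

lemma weak_gradient_direction:
  fixes u :: "real^2 \<Rightarrow> real"
  assumes "u \<in> L2" "g \<in> L2" "is_weak_gradient u g" "test_function \<phi>"
  shows "(\<integral>x. u x * frechet_derivative \<phi> (at x) z \<partial>lborel) = - (\<integral>x. (g x \<bullet> z) * \<phi> x \<partial>lborel)"
proof -
  have "(\<integral>x. u x * frechet_derivative \<phi> (at x) z \<partial>lborel) =
      (\<integral>x. (\<Sum>i\<in>Basis. (z \<bullet> i) * (u x * frechet_derivative \<phi> (at x) i)) \<partial>lborel)"
    unfolding test_function_derivative_expand[OF assms(4), of _ z] sum_distrib_left
    by (simp add: mult.left_commute)
  also have "\<dots> = (\<Sum>i\<in>Basis. (z \<bullet> i) * (\<integral>x. u x * frechet_derivative \<phi> (at x) i \<partial>lborel))"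
    by (subst Bochner_Integration.integral_sum)
      (auto intro!: integrable_mult_right L2_integrable_mult assms(1) test_function_derivative_L2[OF assms(4)])
  also have "\<dots> = (\<Sum>i\<in>Basis. (z \<bullet> i) * - (\<integral>x. (g x \<bullet> i) * \<phi> x \<partial>lborel))"
    using assms(3,4) unfolding is_weak_gradient_def by (intro sum.cong refl) auto
  also have "\<dots> = - (\<integral>x. (\<Sum>i\<in>Basis. (z \<bullet> i) * ((g x \<bullet> i) * \<phi> x)) \<partial>lborel)"
    by (subst Bochner_Integration.integral_sum)
      (auto simp: sum_negf intro!: integrable_mult_right L2_integrable_mult L2_component assms(2) test_function_L2[OF assms(4)])
  also have "(\<lambda>x. \<Sum>i\<in>Basis. (z \<bullet> i) * ((g x \<bullet> i) * \<phi> x)) = (\<lambda>x. (g x \<bullet> z) * \<phi> x)"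
    by (rule ext) (simp add: euclidean_inner[of _ z] sum_distrib_left sum_distrib_right mult_ac)
  finally show ?thesis .
qed

text \<open>The kernel is \<open>\<phi> (y - x)\<close> rather than \<open>\<phi> (x - y)\<close>: moving \<open>x\<close> then translates the test function against
which \<open>f\<close> is integrated.\<close>

definition mollify :: "(real^2 \<Rightarrow> real) \<Rightarrow> (real^2 \<Rightarrow> real) \<Rightarrow> real^2 \<Rightarrow> real" where
  "mollify \<phi> f x = (\<integral>y. f y * \<phi> (y - x) \<partial>lborel)"

lemma L2_indicator_cball: "(indicator (cball (0::real^2) M) :: real^2 \<Rightarrow> real) \<in> L2"
proof -
  have "(\<lambda>x. (norm (indicator (cball (0::real^2) M) x :: real))\<^sup>2) = indicator (cball 0 M)"
    by (auto simp: indicator_def)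
  moreover have "integrable lborel (indicator (cball (0::real^2) M) :: real^2 \<Rightarrow> real)"
    using emeasure_bounded_finite[OF bounded_cball] by (intro integrable_real_indicator) auto
  ultimately show ?thesis by (simp add: L2_def borel_measurable_indicator)
qed

lemma L2_abs: "(f :: real^2 \<Rightarrow> real) \<in> L2 \<Longrightarrow> (\<lambda>x. \<bar>f x\<bar>) \<in> L2"
  by (auto simp: L2_def)

lemma L2_measurable: "f \<in> L2 \<Longrightarrow> f \<in> borel_measurable borel"
  by (simp add: L2_def)

lemma continuous_mollify:
  assumes f: "f \<in> L2" and \<phi>: "test_function \<phi>"
  shows "continuous_on UNIV (mollify \<phi> f)"
  unfolding continuous_on_sequentially comp_def
proof (intro allI ballI impI, elim conjE)
  fix X :: "nat \<Rightarrow> real^2" and x assume X: "X \<longlonglongrightarrow> x"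
  obtain C where C: "\<And>n. norm (X n) \<le> C"
    using X convergent_imp_Bseq[of X] unfolding convergent_def Bseq_def by blast
  obtain M where M: "0 \<le> M" "\<And>x. \<phi> x \<noteq> 0 \<Longrightarrow> norm x \<le> M" using test_function_support[OF \<phi>] by blast
  obtain B where B: "0 \<le> B" "\<And>x. \<bar>\<phi> x\<bar> \<le> B" using test_function_bounded[OF \<phi>] by blast
  note [measurable] = L2_measurable[OF f] test_function_measurable[OF \<phi>]
  have cont: "continuous_on UNIV \<phi>"
    using \<phi> C_diff_continuous unfolding test_function_def smooth_def by blast
  show "(\<lambda>n. mollify \<phi> f (X n)) \<longlonglongrightarrow> mollify \<phi> f x"
    unfolding mollify_def
  proof (rule integral_dominated_convergence)
    show "integrable lborel (\<lambda>y. B * (\<bar>f y\<bar> * indicator (cball 0 (M + C)) y))"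
      by (intro integrable_mult_right L2_integrable_mult L2_abs f L2_indicator_cball)
    show "AE y in lborel. (\<lambda>n. f y * \<phi> (y - X n)) \<longlonglongrightarrow> f y * \<phi> (y - x)"
    proof (intro AE_I2 tendsto_mult tendsto_const)
      fix y
      show "(\<lambda>n. \<phi> (y - X n)) \<longlonglongrightarrow> \<phi> (y - x)"
        by (rule continuous_on_tendsto_compose[OF cont]) (auto intro: tendsto_diff X)
    qed
    show "AE y in lborel. norm (f y * \<phi> (y - X n)) \<le> B * (\<bar>f y\<bar> * indicator (cball 0 (M + C)) y)" for n
    proof (rule AE_I2)
      fix y
      have "norm y \<le> M + C" if "\<phi> (y - X n) \<noteq> 0"
        using M(2)[OF that] C[of n] norm_triangle_ineq[of "y - X n" "X n"] by simp
      then have "\<bar>\<phi> (y - X n)\<bar> \<le> B * indicator (cball 0 (M + C)) y"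
        using B by (cases "\<phi> (y - X n) = 0") (auto simp: indicator_def)
      then show "norm (f y * \<phi> (y - X n)) \<le> B * (\<bar>f y\<bar> * indicator (cball 0 (M + C)) y)"
        using mult_left_mono[OF _ abs_ge_zero[of "f y"]] by (fastforce simp: abs_mult mult.left_commute)
    qed
  qed measurable
qed

text \<open>The difference quotients of \<open>\<phi>\<close> converge to the derivative of \<open>\<phi>\<close> in the direction \<open>- z\<close>, dominated through the Lipschitz
constant of \<open>\<phi>\<close> by a multiple of the indicator of a ball; the definition of the weak gradient moves
the derivative over to \<open>u\<close>.\<close>

lemma mollify_has_derivative_0:
  assumes u: "u \<in> L2" and g: "g \<in> L2" "is_weak_gradient u g" and \<phi>: "test_function \<phi>"
  shows "((\<lambda>s. \<integral>y. u y * \<phi> (y - s *\<^sub>R z) \<partial>lborel) has_real_derivative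
           (\<integral>y. (g y \<bullet> z) * \<phi> y \<partial>lborel)) (at 0)"
  unfolding DERIV_def tendsto_at_iff_sequentially comp_def
proof (intro allI impI)
  fix X :: "nat \<Rightarrow> real" assume X0: "\<forall>i. X i \<in> UNIV - {0}" and X: "X \<longlonglongrightarrow> 0"
  obtain C where C: "\<And>n. \<bar>X n\<bar> \<le> C"
    using X convergent_imp_Bseq[of X] unfolding convergent_def Bseq_def by (metis real_norm_def)
  obtain M where M: "0 \<le> M" "\<And>x. \<phi> x \<noteq> 0 \<Longrightarrow> norm x \<le> M" using test_function_support[OF \<phi>] by blast
  obtain B where B: "0 \<le> B" "\<And>x y. \<bar>\<phi> x - \<phi> y\<bar> \<le> B * norm (x - y)"
    using test_function_lipschitz[OF \<phi>] by blast
  note [measurable] = L2_measurable[OF u] test_function_measurable[OF \<phi>]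
  note \<phi>2 = test_function_L2[OF \<phi>] test_function_L2[OF test_function_translate[OF \<phi>]]
  have Dm[measurable]: "(\<lambda>y. frechet_derivative \<phi> (at y) z) \<in> borel_measurable borel"
  proof -
    show ?thesis unfolding test_function_derivative_expand[OF \<phi>, of _ z]
      by (intro borel_measurable_sum borel_measurable_times borel_measurable_const
          L2_measurable[OF test_function_derivative_L2[OF \<phi>]])
  qed
  have lim: "(\<lambda>n. \<integral>y. u y * ((\<phi> (y - X n *\<^sub>R z) - \<phi> y) / X n) \<partial>lborel) \<longlonglongrightarrow>
      (\<integral>y. u y * (- frechet_derivative \<phi> (at y) z) \<partial>lborel)"
  proof (rule integral_dominated_convergence)
    show "integrable lborel (\<lambda>y. (B * norm z) * (\<bar>u y\<bar> * indicator (cball 0 (M + C * norm z)) y))"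
      by (intro integrable_mult_right L2_integrable_mult L2_abs u L2_indicator_cball)
    show "AE y in lborel. (\<lambda>n. u y * ((\<phi> (y - X n *\<^sub>R z) - \<phi> y) / X n)) \<longlonglongrightarrow> u y * (- frechet_derivative \<phi> (at y) z)"
    proof (intro AE_I2 tendsto_mult tendsto_const)
      fix y
      have "((\<lambda>s. \<phi> (y - s *\<^sub>R z)) has_derivative (\<lambda>s. frechet_derivative \<phi> (at y) (- (s *\<^sub>R z)))) (at 0)"
        by (rule has_derivative_compose[of "\<lambda>s. y - s *\<^sub>R z" "\<lambda>s. - (s *\<^sub>R z)" 0 UNIV \<phi>])
          (auto intro!: derivative_eq_intros test_function_has_derivative[OF \<phi>])
      moreover have "(\<lambda>s. frechet_derivative \<phi> (at y) (- (s *\<^sub>R z))) = (*) (- frechet_derivative \<phi> (at y) z)"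
        using has_derivative_linear[OF test_function_has_derivative[OF \<phi>], of y]
        by (auto simp: linear_neg linear_cmul)
      ultimately have "((\<lambda>s. \<phi> (y - s *\<^sub>R z)) has_real_derivative (- frechet_derivative \<phi> (at y) z)) (at 0)"
        by (simp add: has_field_derivative_def)
      then show "(\<lambda>n. (\<phi> (y - X n *\<^sub>R z) - \<phi> y) / X n) \<longlonglongrightarrow> - frechet_derivative \<phi> (at y) z"
        using X X0 unfolding DERIV_def tendsto_at_iff_sequentially comp_def by auto
    qed
    show "AE y in lborel. norm (u y * ((\<phi> (y - X n *\<^sub>R z) - \<phi> y) / X n)) \<le>
        (B * norm z) * (\<bar>u y\<bar> * indicator (cball 0 (M + C * norm z)) y)" for n
    proof (rule AE_I2)
      fix y
      have Cz: "\<bar>X n\<bar> * norm z \<le> C * norm z" using C by (intro mult_right_mono) auto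
      have "norm y \<le> M + C * norm z" if "\<phi> (y - X n *\<^sub>R z) \<noteq> 0 \<or> \<phi> y \<noteq> 0"
        using that
      proof
        assume "\<phi> (y - X n *\<^sub>R z) \<noteq> 0"
        from M(2)[OF this] Cz show ?thesis using norm_triangle_ineq[of "y - X n *\<^sub>R z" "X n *\<^sub>R z"] by simp
      next
        assume "\<phi> y \<noteq> 0"
        moreover have "0 \<le> \<bar>X n\<bar> * norm z" by simp
        ultimately show ?thesis using M(2)[of y] Cz by linarith
      qed
      moreover have "\<bar>(\<phi> (y - X n *\<^sub>R z) - \<phi> y) / X n\<bar> \<le> B * norm z"
        using B(2)[of "y - X n *\<^sub>R z" y] X0 by (auto simp: field_simps abs_mult)
      ultimately have "\<bar>(\<phi> (y - X n *\<^sub>R z) - \<phi> y) / X n\<bar> \<le> (B * norm z) * indicator (cball 0 (M + C * norm z)) y"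
        by (cases "\<phi> (y - X n *\<^sub>R z) \<noteq> 0 \<or> \<phi> y \<noteq> 0") (auto simp: indicator_def B(1))
      from mult_left_mono[OF this, of "\<bar>u y\<bar>"]
      show "norm (u y * ((\<phi> (y - X n *\<^sub>R z) - \<phi> y) / X n)) \<le>
        (B * norm z) * (\<bar>u y\<bar> * indicator (cball 0 (M + C * norm z)) y)"
        by (simp only: real_norm_def abs_mult mult_ac)
    qed
  qed measurable
  have "(\<integral>y. u y * (- frechet_derivative \<phi> (at y) z) \<partial>lborel) = (\<integral>y. (g y \<bullet> z) * \<phi> y \<partial>lborel)"
    using weak_gradient_direction[OF u g \<phi>, of z] by simp
  moreover have "(\<integral>y. u y * ((\<phi> (y - X n *\<^sub>R z) - \<phi> y) / X n) \<partial>lborel) =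
      ((\<integral>y. u y * \<phi> (y - (0 + X n) *\<^sub>R z) \<partial>lborel) - (\<integral>y. u y * \<phi> (y - 0 *\<^sub>R z) \<partial>lborel)) / X n" for n
  proof -
    have "(\<lambda>y. u y * ((\<phi> (y - X n *\<^sub>R z) - \<phi> y) / X n)) =
        (\<lambda>y. (u y * \<phi> (y - X n *\<^sub>R z) - u y * \<phi> y) / X n)"
      by (simp only: right_diff_distrib times_divide_eq_right)
    then show ?thesis
      by (simp only: integral_divide_zero Bochner_Integration.integral_diff[OF
          L2_integrable_mult[OF u \<phi>2(2)] L2_integrable_mult[OF u \<phi>2(1)]] add_0 scaleR_zero_left diff_zero)
  qed
  ultimately show "(\<lambda>n. ((\<integral>y. u y * \<phi> (y - (0 + X n) *\<^sub>R z) \<partial>lborel) - (\<integral>y. u y * \<phi> (y - 0 *\<^sub>R z) \<partial>lborel)) / X n)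
      \<longlonglongrightarrow> (\<integral>y. (g y \<bullet> z) * \<phi> y \<partial>lborel)"
    using lim by (simp only:)
qed

text \<open>Along every line a mollification is continuously differentiable, and its derivative is the
mollification of the corresponding component of the weak gradient.\<close>

proposition mollify_has_derivative:
  assumes "u \<in> L2" "g \<in> L2" "is_weak_gradient u g" and \<phi>: "test_function \<phi>"
  shows "((\<lambda>s. mollify \<phi> u (x + s *\<^sub>R z)) has_real_derivative mollify \<phi> (\<lambda>y. g y \<bullet> z) (x + s *\<^sub>R z)) (at s)"
proof -
  have "((\<lambda>h. \<integral>y. u y * \<phi> (y - h *\<^sub>R z - (x + s *\<^sub>R z)) \<partial>lborel) has_real_derivative
      (\<integral>y. (g y \<bullet> z) * \<phi> (y - (x + s *\<^sub>R z)) \<partial>lborel)) (at 0)"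
    by (rule mollify_has_derivative_0[OF assms(1-3) test_function_translate[OF \<phi>]])
  then have "((\<lambda>h. mollify \<phi> u (x + (h + s) *\<^sub>R z)) has_real_derivative mollify \<phi> (\<lambda>y. g y \<bullet> z) (x + s *\<^sub>R z)) (at 0)"
    by (simp add: mollify_def algebra_simps)
  then show ?thesis
    using DERIV_shift[of "\<lambda>s. mollify \<phi> u (x + s *\<^sub>R z)" "mollify \<phi> (\<lambda>y. g y \<bullet> z) (x + s *\<^sub>R z)" 0 s] by simp
qed

subsection \<open>Translations and the approximation by mollifications\<close>

lemma ennreal_abs_integral_le:
  fixes f :: "'a \<Rightarrow> real"
  shows "ennreal \<bar>\<integral>x. f x \<partial>M\<bar> \<le> (\<integral>\<^sup>+x. ennreal \<bar>f x\<bar> \<partial>M)"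
  using integral_norm_bound_ennreal[of M f]
  by (cases "integrable M f") (auto simp: not_integrable_integral_eq)

text \<open>Used with a probability density \<open>w\<close>, where it is Jensen's inequality for the square, and with the
indicator of an interval.\<close>

lemma weighted_Cauchy_Schwarz:
  fixes f w :: "'a \<Rightarrow> real"
  assumes [measurable]: "f \<in> borel_measurable M" "w \<in> borel_measurable M" and w: "\<And>x. 0 \<le> w x"
  shows "ennreal ((\<integral>x. w x * f x \<partial>M)\<^sup>2) \<le> (\<integral>\<^sup>+x. ennreal (w x) \<partial>M) * (\<integral>\<^sup>+x. ennreal (w x * (f x)\<^sup>2) \<partial>M)"
proof -
  have "ennreal ((\<integral>x. w x * f x \<partial>M)\<^sup>2) = (ennreal \<bar>\<integral>x. w x * f x \<partial>M\<bar>)\<^sup>2"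
    by (simp add: ennreal_power)
  also have "\<dots> \<le> (\<integral>\<^sup>+x. ennreal \<bar>w x * f x\<bar> \<partial>M)\<^sup>2"
    by (intro power_mono ennreal_abs_integral_le) simp
  also have "(\<integral>\<^sup>+x. ennreal \<bar>w x * f x\<bar> \<partial>M) =
      (\<integral>\<^sup>+x. ennreal (sqrt (w x)) * ennreal (sqrt (w x) * \<bar>f x\<bar>) \<partial>M)"
    using w by (intro nn_integral_cong) (simp add: ennreal_mult[symmetric] abs_mult mult.assoc[symmetric])
  also have "\<dots>\<^sup>2 \<le> (\<integral>\<^sup>+x. (ennreal (sqrt (w x)))\<^sup>2 \<partial>M) * (\<integral>\<^sup>+x. (ennreal (sqrt (w x) * \<bar>f x\<bar>))\<^sup>2 \<partial>M)"
    by (rule Cauchy_Schwarz_nn_integral) measurable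
  also have "\<dots> = (\<integral>\<^sup>+x. ennreal (w x) \<partial>M) * (\<integral>\<^sup>+x. ennreal (w x * (f x)\<^sup>2) \<partial>M)"
    using w by (simp add: ennreal_power power_mult_distrib)
  finally show ?thesis .
qed

lemma nn_integral_translate:
  fixes f :: "'a::euclidean_space \<Rightarrow> ennreal"
  assumes [measurable]: "f \<in> borel_measurable borel"
  shows "(\<integral>\<^sup>+x. f (x + z) \<partial>lborel) = (\<integral>\<^sup>+x. f x \<partial>lborel)"
proof -
  have "(\<integral>\<^sup>+x. f x \<partial>lborel) = (\<integral>\<^sup>+x. f x \<partial>distr lborel borel ((+) z))"
    by (simp add: lborel_distr_plus)
  also have "\<dots> = (\<integral>\<^sup>+x. f (x + z) \<partial>lborel)"
    by (subst nn_integral_distr) (auto simp: add.commute)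
  finally show ?thesis by simp
qed

lemma integral_translate:
  fixes f :: "'a::euclidean_space \<Rightarrow> real"
  assumes [measurable]: "f \<in> borel_measurable borel"
  shows "(\<integral>x. f (x + z) \<partial>lborel) = (\<integral>x. f x \<partial>lborel)"
proof -
  have "(\<integral>x. f x \<partial>lborel) = (\<integral>x. f x \<partial>distr lborel borel ((+) z))"
    by (simp add: lborel_distr_plus)
  also have "\<dots> = (\<integral>x. f (x + z) \<partial>lborel)"
    by (subst integral_distr) (auto simp: add.commute)
  finally show ?thesis by simp
qed

lemma nn_integral_L2:
  fixes f :: "real^2 \<Rightarrow> 'b::euclidean_space"
  assumes "f \<in> L2"
  shows "(\<integral>\<^sup>+x. ennreal ((norm (f x))\<^sup>2) \<partial>lborel) = ennreal (\<integral>x. (norm (f x))\<^sup>2 \<partial>lborel)"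
  using assms by (intro nn_integral_eq_integral) (auto simp: L2_def)

lemma L2I_nn_integral:
  fixes f :: "real^2 \<Rightarrow> 'b::euclidean_space"
  assumes "f \<in> borel_measurable borel" "(\<integral>\<^sup>+x. ennreal ((norm (f x))\<^sup>2) \<partial>lborel) < \<infinity>"
  shows "f \<in> L2"
  using assms by (auto simp: L2_def intro!: integrableI_bounded)

lemma L2_translate:
  fixes f :: "real^2 \<Rightarrow> 'b::euclidean_space"
  assumes "f \<in> L2"
  shows "(\<lambda>x. f (x + z)) \<in> L2"
proof (rule L2I_nn_integral)
  note [measurable] = L2_measurable[OF assms]
  show "(\<lambda>x. f (x + z)) \<in> borel_measurable borel" by measurable
  show "(\<integral>\<^sup>+x. ennreal ((norm (f (x + z)))\<^sup>2) \<partial>lborel) < \<infinity>"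
    by (subst nn_integral_translate[where f = "\<lambda>x. ennreal ((norm (f x))\<^sup>2)"])
      (auto simp: nn_integral_L2[OF assms])
qed

text \<open>For almost every \<open>x\<close> the increment \<open>u (x + z) - u x\<close> is the integral \<open>D x\<close> of the directional derivative
\<open>g \<bullet> z\<close> over the segment from \<open>x\<close> to \<open>x + z\<close>: both sides have the same integral against every test function \<open>\<eta>\<close>, by the
fundamental theorem of calculus for \<open>s \<mapsto> mollify \<eta> u (s z)\<close>. The estimate for \<open>D\<close> is Cauchy--Schwarz
and Tonelli.\<close>

lemma L2_translation_estimate:
  assumes u: "u \<in> L2" and g: "g \<in> L2" "is_weak_gradient u g"
  shows "(\<integral>\<^sup>+x. ennreal ((u (x + z) - u x)\<^sup>2) \<partial>lborel) \<le>
    ennreal ((norm z)\<^sup>2 * (\<integral>x. (norm (g x))\<^sup>2 \<partial>lborel))"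
proof -
  note [measurable] = L2_measurable[OF u] L2_measurable[OF g(1)]
  define I :: "real \<Rightarrow> real" where "I = indicator {0..1}"
  have [measurable]: "I \<in> borel_measurable borel" by (simp add: I_def)
  have I0: "0 \<le> I s" for s by (simp add: I_def)
  have I1: "(\<integral>\<^sup>+s. ennreal (I s) \<partial>lborel) = 1"
    by (simp add: I_def ennreal_indicator)
  define D where "D x = (\<integral>s. I s * (g (x + s *\<^sub>R z) \<bullet> z) \<partial>lborel)" for x
  have [measurable]: "D \<in> borel_measurable borel"
    unfolding D_def by measurable
  have gz: "(\<integral>\<^sup>+x. ennreal ((g x \<bullet> z)\<^sup>2) \<partial>lborel) \<le> ennreal ((norm z)\<^sup>2 * (\<integral>x. (norm (g x))\<^sup>2 \<partial>lborel))"
  proof -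
    have "(\<integral>\<^sup>+x. ennreal ((g x \<bullet> z)\<^sup>2) \<partial>lborel) \<le>
        (\<integral>\<^sup>+x. ennreal ((norm z)\<^sup>2) * ennreal ((norm (g x))\<^sup>2) \<partial>lborel)"
    proof (rule nn_integral_mono)
      fix x
      have "(g x \<bullet> z)\<^sup>2 \<le> (norm (g x) * norm z)\<^sup>2"
        using power_mono[OF Cauchy_Schwarz_ineq2[of "g x" z], of 2] by simp
      then show "ennreal ((g x \<bullet> z)\<^sup>2) \<le> ennreal ((norm z)\<^sup>2) * ennreal ((norm (g x))\<^sup>2)"
        by (simp add: ennreal_mult[symmetric] power_mult_distrib mult.commute ennreal_leI)
    qed
    also have "\<dots> = ennreal ((norm z)\<^sup>2) * ennreal (\<integral>x. (norm (g x))\<^sup>2 \<partial>lborel)"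
      by (simp add: nn_integral_cmult nn_integral_L2[OF g(1)])
    finally show ?thesis by (simp add: ennreal_mult)
  qed
  have tonelli: "(\<integral>\<^sup>+x. (\<integral>\<^sup>+s. ennreal (I s * (g (x + s *\<^sub>R z) \<bullet> z)\<^sup>2) \<partial>lborel) \<partial>lborel) =
      (\<integral>\<^sup>+x. ennreal ((g x \<bullet> z)\<^sup>2) \<partial>lborel)"
  proof -
    have "(\<integral>\<^sup>+x. (\<integral>\<^sup>+s. ennreal (I s * (g (x + s *\<^sub>R z) \<bullet> z)\<^sup>2) \<partial>lborel) \<partial>lborel) =
        (\<integral>\<^sup>+s. (\<integral>\<^sup>+x. ennreal (I s) * ennreal ((g (x + s *\<^sub>R z) \<bullet> z)\<^sup>2) \<partial>lborel) \<partial>lborel)"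
      by (subst lborel_pair.Fubini') (auto simp: ennreal_mult I0)
    also have "\<dots> = (\<integral>\<^sup>+s. ennreal (I s) * (\<integral>\<^sup>+x. ennreal ((g x \<bullet> z)\<^sup>2) \<partial>lborel) \<partial>lborel)"
      by (simp add: nn_integral_cmult nn_integral_translate[where f = "\<lambda>x. ennreal ((g x \<bullet> z)\<^sup>2)"])
    finally show ?thesis by (simp add: nn_integral_multc I1)
  qed
  have D2: "(\<integral>\<^sup>+x. ennreal ((D x)\<^sup>2) \<partial>lborel) \<le> ennreal ((norm z)\<^sup>2 * (\<integral>x. (norm (g x))\<^sup>2 \<partial>lborel))"
  proof -
    have "(\<integral>\<^sup>+x. ennreal ((D x)\<^sup>2) \<partial>lborel) \<le>
        (\<integral>\<^sup>+x. (\<integral>\<^sup>+s. ennreal (I s * (g (x + s *\<^sub>R z) \<bullet> z)\<^sup>2) \<partial>lborel) \<partial>lborel)"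
    proof (rule nn_integral_mono)
      fix x
      show "ennreal ((D x)\<^sup>2) \<le> (\<integral>\<^sup>+s. ennreal (I s * (g (x + s *\<^sub>R z) \<bullet> z)\<^sup>2) \<partial>lborel)"
        unfolding D_def using weighted_Cauchy_Schwarz[of "\<lambda>s. g (x + s *\<^sub>R z) \<bullet> z" lborel I] I0 I1
        by simp
    qed
    with tonelli gz show ?thesis by simp
  qed
  then have DL: "D \<in> L2"
    by (intro L2I_nn_integral) (auto simp: order_le_less_trans)
  have "AE x in lborel. u (x + z) - u x - D x = 0"
  proof (rule fundamental_lemma)
    have "(\<lambda>x. u (x + z) + (-1) *\<^sub>R u x + (-1) *\<^sub>R D x) \<in> L2"
      by (intro L2_add L2_scaleR L2_translate u DL)
    then have hL: "(\<lambda>x. u (x + z) - u x - D x) \<in> L2" by simp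
    then show "(\<lambda>x. u (x + z) - u x - D x) \<in> borel_measurable lborel"
      "integrable lborel (\<lambda>x. (u (x + z) - u x - D x)\<^sup>2)"
      by (simp_all add: L2_def)
    fix \<eta> :: "real^2 \<Rightarrow> real" assume \<eta>: "test_function \<eta>"
    note [measurable] = test_function_measurable[OF \<eta>]
    note \<eta>L = test_function_L2[OF \<eta>]
    have m: "mollify \<eta> f w = (\<integral>x. f (x + w) * \<eta> x \<partial>lborel)"
      if [measurable]: "f \<in> borel_measurable borel" for f w
      using integral_translate[of "\<lambda>y. f y * \<eta> (y - w)" w] by (simp add: mollify_def)
    have int2: "integrable (lborel \<Otimes>\<^sub>M lborel) (\<lambda>(x, s). I s * (g (x + s *\<^sub>R z) \<bullet> z) * \<eta> x)"
    proof (rule integrableI_bounded)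
      have "(\<integral>\<^sup>+ p. ennreal (norm (case p of (x, s) \<Rightarrow> I s * (g (x + s *\<^sub>R z) \<bullet> z) * \<eta> x)) \<partial>(lborel \<Otimes>\<^sub>M lborel)) =
          (\<integral>\<^sup>+x. (\<integral>\<^sup>+s. ennreal (norm (I s * (g (x + s *\<^sub>R z) \<bullet> z) * \<eta> x)) \<partial>lborel) \<partial>lborel)"
        by (subst lborel.nn_integral_fst[symmetric]) auto
      also have "\<dots> \<le> (\<integral>\<^sup>+x. (\<integral>\<^sup>+s. ennreal (I s * (g (x + s *\<^sub>R z) \<bullet> z)\<^sup>2) + ennreal (I s) * ennreal ((\<eta> x)\<^sup>2) \<partial>lborel) \<partial>lborel)"
      proof (intro nn_integral_mono)
        fix x s
        have "2 * (\<bar>g (x + s *\<^sub>R z) \<bullet> z\<bar> * \<bar>\<eta> x\<bar>) \<le> (g (x + s *\<^sub>R z) \<bullet> z)\<^sup>2 + (\<eta> x)\<^sup>2"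
          using sum_squares_bound[of "\<bar>g (x + s *\<^sub>R z) \<bullet> z\<bar>" "\<bar>\<eta> x\<bar>"] by (simp add: mult.assoc)
        moreover have "0 \<le> \<bar>g (x + s *\<^sub>R z) \<bullet> z\<bar> * \<bar>\<eta> x\<bar>" by simp
        ultimately have "\<bar>g (x + s *\<^sub>R z) \<bullet> z\<bar> * \<bar>\<eta> x\<bar> \<le> (g (x + s *\<^sub>R z) \<bullet> z)\<^sup>2 + (\<eta> x)\<^sup>2"
          by linarith
        from mult_left_mono[OF this I0[of s]]
        show "ennreal (norm (I s * (g (x + s *\<^sub>R z) \<bullet> z) * \<eta> x)) \<le>
            ennreal (I s * (g (x + s *\<^sub>R z) \<bullet> z)\<^sup>2) + ennreal (I s) * ennreal ((\<eta> x)\<^sup>2)"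
          using I0[of s]
          by (simp add: abs_mult ennreal_mult[symmetric] ennreal_plus[symmetric] distrib_left mult.assoc del: ennreal_plus)
      qed
      also have "\<dots> = (\<integral>\<^sup>+x. ennreal ((g x \<bullet> z)\<^sup>2) \<partial>lborel) + (\<integral>\<^sup>+x. ennreal ((\<eta> x)\<^sup>2) \<partial>lborel)"
        by (simp add: nn_integral_add tonelli nn_integral_multc I1)
      also have "\<dots> < \<infinity>"
        using gz nn_integral_L2[OF \<eta>L] by (simp add: order_le_less_trans)
      finally show "(\<integral>\<^sup>+ p. ennreal (norm (case p of (x, s) \<Rightarrow> I s * (g (x + s *\<^sub>R z) \<bullet> z) * \<eta> x)) \<partial>(lborel \<Otimes>\<^sub>M lborel)) < \<infinity>" .
    qed measurable
    have "(\<integral>x. D x * \<eta> x \<partial>lborel) = (\<integral>x. (\<integral>s. I s * (g (x + s *\<^sub>R z) \<bullet> z) * \<eta> x \<partial>lborel) \<partial>lborel)"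
      by (simp add: D_def)
    also have "\<dots> = (\<integral>s. (\<integral>x. I s * (g (x + s *\<^sub>R z) \<bullet> z) * \<eta> x \<partial>lborel) \<partial>lborel)"
      by (rule lborel_pair.Fubini_integral[symmetric, OF int2])
    also have "\<dots> = (\<integral>s. mollify \<eta> (\<lambda>y. g y \<bullet> z) (0 + s *\<^sub>R z) * indicator {0..1} s \<partial>lborel)"
      by (intro Bochner_Integration.integral_cong refl)
        (simp only: mult.assoc integral_mult_right_zero, simp add: m I_def mult.commute)
    also have "\<dots> = mollify \<eta> u (0 + 1 *\<^sub>R z) - mollify \<eta> u (0 + 0 *\<^sub>R z)"
    proof (rule integral_FTC_Icc_real)
      show "((\<lambda>s. mollify \<eta> u (0 + s *\<^sub>R z)) has_real_derivative mollify \<eta> (\<lambda>y. g y \<bullet> z) (0 + s *\<^sub>R z)) (at s)" for s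
        by (rule mollify_has_derivative[OF u g \<eta>])
      have "continuous_on UNIV (\<lambda>s. mollify \<eta> (\<lambda>y. g y \<bullet> z) (0 + s *\<^sub>R z))"
        by (rule continuous_on_compose2[OF continuous_mollify[OF L2_component[OF g(1)] \<eta>]])
          (auto intro!: continuous_intros)
      then show "isCont (\<lambda>s. mollify \<eta> (\<lambda>y. g y \<bullet> z) (0 + s *\<^sub>R z)) s" for s
        by (simp add: continuous_on_eq_continuous_at)
    qed simp
    also have "\<dots> = (\<integral>x. u (x + z) * \<eta> x - u x * \<eta> x \<partial>lborel)"
      by (subst Bochner_Integration.integral_diff)
        (auto simp: m intro!: L2_integrable_mult L2_translate u \<eta>L)
    finally have eq: "(\<integral>x. D x * \<eta> x \<partial>lborel) = (\<integral>x. u (x + z) * \<eta> x - u x * \<eta> x \<partial>lborel)" .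
    have "(\<integral>x. (u (x + z) - u x - D x) * \<eta> x \<partial>lborel) =
        (\<integral>x. (u (x + z) * \<eta> x - u x * \<eta> x) - D x * \<eta> x \<partial>lborel)"
      by (simp add: left_diff_distrib)
    also have "\<dots> = 0"
      unfolding eq[symmetric]
      by (subst Bochner_Integration.integral_diff)
        (auto simp: eq intro!: Bochner_Integration.integrable_diff L2_integrable_mult L2_translate u \<eta>L DL)
    finally show "(\<integral>x. (u (x + z) - u x - D x) * \<eta> x \<partial>lborel) = 0" .
  qed
  then have "(\<integral>\<^sup>+x. ennreal ((u (x + z) - u x)\<^sup>2) \<partial>lborel) = (\<integral>\<^sup>+x. ennreal ((D x)\<^sup>2) \<partial>lborel)"
    by (intro nn_integral_cong_AE) (auto elim!: eventually_mono)
  with D2 show ?thesis by simp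
qed

definition mollifier :: "real \<Rightarrow> (real^2 \<Rightarrow> real) \<Rightarrow> bool" where
  "mollifier \<epsilon> \<phi> \<longleftrightarrow> test_function \<phi> \<and> (\<forall>x. 0 \<le> \<phi> x) \<and> (\<integral>\<^sup>+x. ennreal (\<phi> x) \<partial>lborel) = 1 \<and>
     (\<forall>x. \<phi> x \<noteq> 0 \<longrightarrow> norm x \<le> \<epsilon>)"

text \<open>A normalised bump on the box with half-sides \<open>\<epsilon> / 2\<close>: in the plane the norm is at most the sum of
the two coordinates, hence at most \<open>\<epsilon>\<close> on this box.\<close>

lemma mollifier_exists:
  assumes "\<epsilon> > 0"
  shows "\<exists>\<phi>. mollifier \<epsilon> \<phi>"
proof -
  define a :: "real^2" where "a = (\<epsilon> / 2) *\<^sub>R One"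
  define b where "b = box_bump (- a) a 0"
  have ai: "a \<bullet> i = \<epsilon> / 2" if "i \<in> Basis" for i using that by (simp add: a_def)
  have b: "test_function b" unfolding b_def by (rule test_function_box_bump)
  note [measurable] = test_function_measurable[OF b]
  have b0: "0 \<le> b x" for x by (simp add: b_def box_bump_bounds)
  have small: "norm x \<le> \<epsilon>" if "b x \<noteq> 0" for x
  proof -
    have x: "x \<in> box (- a) a" using that by (auto simp: b_def dest: box_bump_nonzero)
    have "norm x \<le> (\<Sum>i\<in>Basis. \<bar>x \<bullet> i\<bar>)" by (rule norm_le_l1)
    also have "\<dots> \<le> (\<Sum>i\<in>(Basis::(real^2) set). \<epsilon> / 2)"
      using x by (intro sum_mono) (fastforce simp: mem_box ai)
    also have "\<dots> = \<epsilon>" by simp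
    finally show ?thesis .
  qed
  have pos: "b x > 0" if "x \<in> box (- a) a" for x
    using that unfolding b_def box_bump_def
    by (intro prod_pos) (auto simp: mem_box bump_poly_def)
  define m where "m = (\<integral>\<^sup>+x. ennreal (b x) \<partial>lborel)"
  have "m < \<infinity>"
  proof -
    have "m \<le> (\<integral>\<^sup>+x. indicator (box (- a) a) x \<partial>lborel)"
      unfolding m_def using box_bump_bounds(2)[of "- a" a 0]
      by (intro nn_integral_mono) (metis b_def ennreal_indicator ennreal_leI)
    also have "\<dots> < \<infinity>" by (simp add: emeasure_lborel_box_eq)
    finally show ?thesis .
  qed
  moreover have "m \<noteq> 0"
  proof
    assume "m = 0"
    then have "AE x in lborel. ennreal (b x) = 0" unfolding m_def by (subst (asm) nn_integral_0_iff_AE) auto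
    then have "AE x in lborel. x \<notin> box (- a) a"
      by eventually_elim (use pos in fastforce)
    then have "emeasure lborel (box (- a) a) = 0"
      by (subst (asm) AE_iff_measurable[of "box (- a) a"]) auto
    moreover have eq: "(a - (- a)) \<bullet> i = \<epsilon>" if "i \<in> Basis" for i
      by (simp only: inner_diff_left inner_minus_left ai[OF that])
    have "0 < (\<Prod>i\<in>(Basis::(real^2) set). (a - (- a)) \<bullet> i)"
      by (intro prod_pos ballI) (simp only: eq assms)
    moreover have "emeasure lborel (box (- a) a) = ennreal (\<Prod>i\<in>Basis. (a - (- a)) \<bullet> i)"
      by (rule emeasure_lborel_box) (use assms in \<open>simp add: ai\<close>)
    ultimately show False by (metis ennreal_eq_0_iff not_le)
  qed
  ultimately obtain r where r: "m = ennreal r" "r > 0"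
    by (metis ennreal_cases ennreal_eq_0_iff infinity_ennreal_def less_irrefl not_le top.not_eq_extremum)
  have "mollifier \<epsilon> (\<lambda>x. (1 / r) * b x)"
    unfolding mollifier_def
  proof (intro conjI allI impI)
    have "smooth (\<lambda>x::real^2. 1 / r)" by (simp only: smooth_def C_diff_const simp_thms)
    then show "test_function (\<lambda>x. (1 / r) * b x)" by (rule test_function_mult[OF _ b])
    have "(\<integral>\<^sup>+x. ennreal ((1 / r) * b x) \<partial>lborel) = ennreal (1 / r) * m"
      using r(2) by (simp add: m_def nn_integral_cmult[symmetric] ennreal_mult'[symmetric] del: ennreal_divide_numeral)
    then show "(\<integral>\<^sup>+x. ennreal ((1 / r) * b x) \<partial>lborel) = 1"
      using r by (simp add: ennreal_mult[symmetric])
  qed (use r b0 small in auto)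
  then show ?thesis by blast
qed

lemma mollify_translate:
  assumes [measurable]: "f \<in> borel_measurable borel" and \<phi>: "test_function \<phi>"
  shows "mollify \<phi> f x = (\<integral>z. \<phi> z * f (x + z) \<partial>lborel)"
proof -
  note [measurable] = test_function_measurable[OF \<phi>]
  show ?thesis
    using integral_translate[of "\<lambda>y. f y * \<phi> (y - x)" x] by (simp add: mollify_def add.commute mult.commute)
qed

lemma mollify_square_bound:
  assumes f: "f \<in> L2" and \<phi>: "mollifier \<epsilon> \<phi>"
  shows "ennreal ((mollify \<phi> f x)\<^sup>2) \<le> (\<integral>\<^sup>+z. ennreal (\<phi> z * (f (x + z))\<^sup>2) \<partial>lborel)"
proof -
  have \<phi>': "test_function \<phi>" "\<And>x. 0 \<le> \<phi> x" "(\<integral>\<^sup>+x. ennreal (\<phi> x) \<partial>lborel) = 1"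
    using \<phi> by (auto simp: mollifier_def)
  note [measurable] = L2_measurable[OF f] test_function_measurable[OF \<phi>'(1)]
  show ?thesis
    unfolding mollify_translate[OF L2_measurable[OF f] \<phi>'(1)]
    using weighted_Cauchy_Schwarz[of "\<lambda>z. f (x + z)" lborel \<phi>] \<phi>' by simp
qed

text \<open>An average over translations \<open>z\<close> with \<open>norm z \<le> \<epsilon>\<close> inherits every bound that holds for the single
translations.\<close>

lemma nn_integral_mollifier:
  assumes [measurable]: "(\<lambda>(x, z). h x z) \<in> borel_measurable (borel \<Otimes>\<^sub>M borel)" and \<phi>: "mollifier \<epsilon> \<phi>"
    and h: "\<And>x z. 0 \<le> h x z" and c: "\<And>z. norm z \<le> \<epsilon> \<Longrightarrow> (\<integral>\<^sup>+x. ennreal (h x z) \<partial>lborel) \<le> c"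
  shows "(\<integral>\<^sup>+x. (\<integral>\<^sup>+z. ennreal (\<phi> z * h x z) \<partial>lborel) \<partial>lborel) \<le> c"
proof -
  have \<phi>': "test_function \<phi>" "\<And>x. 0 \<le> \<phi> x" "(\<integral>\<^sup>+x. ennreal (\<phi> x) \<partial>lborel) = 1"
    using \<phi> by (auto simp: mollifier_def)
  note [measurable] = test_function_measurable[OF \<phi>'(1)]
  have "(\<integral>\<^sup>+x. (\<integral>\<^sup>+z. ennreal (\<phi> z * h x z) \<partial>lborel) \<partial>lborel) =
      (\<integral>\<^sup>+z. (\<integral>\<^sup>+x. ennreal (\<phi> z) * ennreal (h x z) \<partial>lborel) \<partial>lborel)"
    by (subst lborel_pair.Fubini') (auto simp: ennreal_mult \<phi>' h)
  also have "\<dots> = (\<integral>\<^sup>+z. ennreal (\<phi> z) * (\<integral>\<^sup>+x. ennreal (h x z) \<partial>lborel) \<partial>lborel)"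
    by (intro nn_integral_cong nn_integral_cmult) measurable
  also have "\<dots> \<le> (\<integral>\<^sup>+z. ennreal (\<phi> z) * c \<partial>lborel)"
  proof (rule nn_integral_mono)
    fix z
    show "ennreal (\<phi> z) * (\<integral>\<^sup>+x. ennreal (h x z) \<partial>lborel) \<le> ennreal (\<phi> z) * c"
      using \<phi> c[of z] by (cases "\<phi> z = 0") (auto simp: mollifier_def intro!: mult_left_mono)
  qed
  also have "\<dots> = c" by (simp add: nn_integral_multc \<phi>')
  finally show ?thesis .
qed

lemma mollify_L2_bound:
  assumes f: "f \<in> L2" and \<phi>: "mollifier \<epsilon> \<phi>"
  shows "(\<integral>\<^sup>+x. ennreal ((mollify \<phi> f x)\<^sup>2) \<partial>lborel) \<le> (\<integral>\<^sup>+x. ennreal ((f x)\<^sup>2) \<partial>lborel)"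
proof -
  note [measurable] = L2_measurable[OF f]
  have "(\<integral>\<^sup>+x. ennreal ((mollify \<phi> f x)\<^sup>2) \<partial>lborel) \<le>
      (\<integral>\<^sup>+x. (\<integral>\<^sup>+z. ennreal (\<phi> z * (f (x + z))\<^sup>2) \<partial>lborel) \<partial>lborel)"
    by (intro nn_integral_mono mollify_square_bound[OF f \<phi>])
  also have "\<dots> \<le> (\<integral>\<^sup>+x. ennreal ((f x)\<^sup>2) \<partial>lborel)"
    by (rule nn_integral_mollifier[OF _ \<phi>])
      (auto simp: nn_integral_translate[where f = "\<lambda>x. ennreal ((f x)\<^sup>2)"])
  finally show ?thesis .
qed

lemma mollify_bounded:
  assumes f: "f \<in> L2" and \<phi>: "mollifier \<epsilon> \<phi>"
  obtains B where "0 \<le> B" "\<And>x. \<bar>mollify \<phi> f x\<bar> \<le> B"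
proof -
  have \<phi>': "test_function \<phi>" "\<And>x. 0 \<le> \<phi> x" using \<phi> by (auto simp: mollifier_def)
  obtain C where C: "0 \<le> C" "\<And>x. \<bar>\<phi> x\<bar> \<le> C" using test_function_bounded[OF \<phi>'(1)] by blast
  note [measurable] = L2_measurable[OF f]
  define N where "N = (\<integral>x. (norm (f x))\<^sup>2 \<partial>lborel)"
  have N: "0 \<le> N" by (simp add: N_def)
  have "\<bar>mollify \<phi> f x\<bar> \<le> sqrt (C * N)" for x
  proof -
    have "ennreal ((mollify \<phi> f x)\<^sup>2) \<le> (\<integral>\<^sup>+z. ennreal (\<phi> z * (f (x + z))\<^sup>2) \<partial>lborel)"
      by (rule mollify_square_bound[OF f \<phi>])
    also have "\<dots> \<le> (\<integral>\<^sup>+z. ennreal C * ennreal ((f (z + x))\<^sup>2) \<partial>lborel)"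
      using C by (intro nn_integral_mono)
        (auto simp: ennreal_mult[symmetric] add.commute intro!: ennreal_leI mult_right_mono intro: order_trans[OF abs_ge_self])
    also have "\<dots> = ennreal (C * N)"
      using nn_integral_L2[OF f] C N
      by (simp add: nn_integral_cmult nn_integral_translate[where f = "\<lambda>x. ennreal ((f x)\<^sup>2)"] N_def ennreal_mult)
    finally have "(mollify \<phi> f x)\<^sup>2 \<le> C * N" using C N by (simp add: ennreal_le_iff)
    then show ?thesis by (metis real_sqrt_abs real_sqrt_le_iff)
  qed
  then show ?thesis using C N by (intro that[of "sqrt (C * N)"]) auto
qed

text \<open>The error \<open>mollify \<phi> u - u\<close> is an average of the increments \<open>u (x + z) - u x\<close> with \<open>norm z \<le> \<epsilon>\<close>, whose \<open>L\<^sup>2\<close> norms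
are at most \<open>\<epsilon>\<close> times that of the weak gradient.\<close>

proposition mollify_approx:
  assumes u: "u \<in> L2" and g: "g \<in> L2" "is_weak_gradient u g" and \<phi>: "mollifier \<epsilon> \<phi>" and \<epsilon>: "0 \<le> \<epsilon>"
  shows "(\<integral>\<^sup>+x. ennreal ((mollify \<phi> u x - u x)\<^sup>2) \<partial>lborel) \<le>
    ennreal (\<epsilon>\<^sup>2 * (\<integral>x. (norm (g x))\<^sup>2 \<partial>lborel))"
proof -
  have \<phi>': "test_function \<phi>" "\<And>x. 0 \<le> \<phi> x" "(\<integral>\<^sup>+x. ennreal (\<phi> x) \<partial>lborel) = 1"
    using \<phi> by (auto simp: mollifier_def)
  note [measurable] = L2_measurable[OF u] test_function_measurable[OF \<phi>'(1)]
  have \<phi>int: "integrable lborel \<phi>" "(\<integral>x. \<phi> x \<partial>lborel) = 1"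
  proof -
    show "integrable lborel \<phi>" using \<phi>' by (intro integrableI_nonneg) auto
    show "(\<integral>x. \<phi> x \<partial>lborel) = 1" using \<phi>' by (subst integral_eq_nn_integral) auto
  qed
  have "ennreal ((mollify \<phi> u x - u x)\<^sup>2) \<le> (\<integral>\<^sup>+z. ennreal (\<phi> z * (u (x + z) - u x)\<^sup>2) \<partial>lborel)" for x
  proof -
    have "(\<lambda>z. u (x + z)) \<in> L2" using L2_translate[OF u, of x] by (simp add: add.commute)
    then have "mollify \<phi> u x - u x = (\<integral>z. \<phi> z * u (x + z) - \<phi> z * u x \<partial>lborel)"
      unfolding mollify_translate[OF L2_measurable[OF u] \<phi>'(1)]
      by (subst Bochner_Integration.integral_diff)
        (auto simp: \<phi>int intro!: L2_integrable_mult test_function_L2[OF \<phi>'(1)])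
    then have eq: "mollify \<phi> u x - u x = (\<integral>z. \<phi> z * (u (x + z) - u x) \<partial>lborel)"
      by (simp add: right_diff_distrib)
    show ?thesis
      unfolding eq using weighted_Cauchy_Schwarz[of "\<lambda>z. u (x + z) - u x" lborel \<phi>] \<phi>' by simp
  qed
  then have "(\<integral>\<^sup>+x. ennreal ((mollify \<phi> u x - u x)\<^sup>2) \<partial>lborel) \<le>
      (\<integral>\<^sup>+x. (\<integral>\<^sup>+z. ennreal (\<phi> z * (u (x + z) - u x)\<^sup>2) \<partial>lborel) \<partial>lborel)"
    by (intro nn_integral_mono)
  also have "\<dots> \<le> ennreal (\<epsilon>\<^sup>2 * (\<integral>x. (norm (g x))\<^sup>2 \<partial>lborel))"
  proof (rule nn_integral_mollifier[OF _ \<phi>])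
    fix z :: "real^2" assume "norm z \<le> \<epsilon>"
    then have "(norm z)\<^sup>2 * (\<integral>x. (norm (g x))\<^sup>2 \<partial>lborel) \<le> \<epsilon>\<^sup>2 * (\<integral>x. (norm (g x))\<^sup>2 \<partial>lborel)"
      by (intro mult_right_mono power_mono) auto
    then show "(\<integral>\<^sup>+x. ennreal ((u (x + z) - u x)\<^sup>2) \<partial>lborel) \<le> ennreal (\<epsilon>\<^sup>2 * (\<integral>x. (norm (g x))\<^sup>2 \<partial>lborel))"
      by (intro order_trans[OF L2_translation_estimate[OF u g]] ennreal_leI)
  qed auto
  finally show ?thesis .
qed

section \<open>The Gagliardo--Nirenberg inequality in the plane\<close>

abbreviation (input) "e1 \<equiv> (axis 1 1 :: real^2)"
abbreviation (input) "e2 \<equiv> (axis 2 1 :: real^2)"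

lemma Basis_real2: "(Basis :: (real^2) set) = {e1, e2}" and e1_neq_e2: "e1 \<noteq> e2"
  by (auto simp: Basis_vec_def UNIV_2 axis_eq_axis)

text \<open>Identifies the measure on the vector type with a product measure, so that Tonelli's theorem can be
applied to the two coordinates.\<close>

lemma distr_real2:
  "distr (lborel \<Otimes>\<^sub>M lborel) borel (\<lambda>(a, b). a *\<^sub>R e1 + b *\<^sub>R e2) = lborel"
proof (rule lborel_eqI[symmetric])
  fix l u :: "real^2" assume le: "\<And>b. b \<in> Basis \<Longrightarrow> l \<bullet> b \<le> u \<bullet> b"
  have ip: "e1 \<bullet> e1 = 1" "e2 \<bullet> e2 = 1" "e1 \<bullet> e2 = 0" "e2 \<bullet> e1 = 0"
    by (simp_all add: inner_axis_axis)
  have "(\<lambda>(a, b). a *\<^sub>R e1 + b *\<^sub>R e2) -` box l u \<inter> space (lborel \<Otimes>\<^sub>M lborel) =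
      {l \<bullet> e1<..<u \<bullet> e1} \<times> {l \<bullet> e2<..<u \<bullet> e2}"
    by (auto simp: space_pair_measure mem_box Basis_real2 inner_add_left ip)
  then have "emeasure (distr (lborel \<Otimes>\<^sub>M lborel) borel (\<lambda>(a, b). a *\<^sub>R e1 + b *\<^sub>R e2)) (box l u) =
      emeasure (lborel \<Otimes>\<^sub>M lborel) ({l \<bullet> e1<..<u \<bullet> e1} \<times> {l \<bullet> e2<..<u \<bullet> e2})"
    by (subst emeasure_distr) auto
  also have "\<dots> = ennreal (u \<bullet> e1 - l \<bullet> e1) * ennreal (u \<bullet> e2 - l \<bullet> e2)"
    using le by (subst lborel.emeasure_pair_measure_Times) (auto simp: Basis_real2)
  also have "\<dots> = (\<Prod>b\<in>Basis. (u - l) \<bullet> b)"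
    using le e1_neq_e2 by (simp add: Basis_real2 inner_diff_left ennreal_mult[symmetric])
  finally show "emeasure (distr (lborel \<Otimes>\<^sub>M lborel) borel (\<lambda>(a, b). a *\<^sub>R e1 + b *\<^sub>R e2)) (box l u) =
      (\<Prod>b\<in>Basis. (u - l) \<bullet> b)" .
qed simp

lemma nn_integral_real2:
  fixes f :: "real^2 \<Rightarrow> ennreal"
  assumes [measurable]: "f \<in> borel_measurable borel"
  shows "(\<integral>\<^sup>+x. f x \<partial>lborel) = (\<integral>\<^sup>+a. (\<integral>\<^sup>+b. f (a *\<^sub>R e1 + b *\<^sub>R e2) \<partial>lborel) \<partial>lborel)"
    and "(\<integral>\<^sup>+x. f x \<partial>lborel) = (\<integral>\<^sup>+b. (\<integral>\<^sup>+a. f (a *\<^sub>R e1 + b *\<^sub>R e2) \<partial>lborel) \<partial>lborel)"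
proof -
  have "(\<integral>\<^sup>+x. f x \<partial>lborel) = (\<integral>\<^sup>+x. f x \<partial>distr (lborel \<Otimes>\<^sub>M lborel) borel (\<lambda>(a, b). a *\<^sub>R e1 + b *\<^sub>R e2))"
    by (simp only: distr_real2)
  also have "\<dots> = (\<integral>\<^sup>+p. f (fst p *\<^sub>R e1 + snd p *\<^sub>R e2) \<partial>(lborel \<Otimes>\<^sub>M lborel))"
    by (subst nn_integral_distr) (auto simp: case_prod_beta)
  also have "\<dots> = (\<integral>\<^sup>+a. (\<integral>\<^sup>+b. f (a *\<^sub>R e1 + b *\<^sub>R e2) \<partial>lborel) \<partial>lborel)"
    by (subst lborel.nn_integral_fst[symmetric]) auto
  finally show 1: "(\<integral>\<^sup>+x. f x \<partial>lborel) = (\<integral>\<^sup>+a. (\<integral>\<^sup>+b. f (a *\<^sub>R e1 + b *\<^sub>R e2) \<partial>lborel) \<partial>lborel)" .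
  show "(\<integral>\<^sup>+x. f x \<partial>lborel) = (\<integral>\<^sup>+b. (\<integral>\<^sup>+a. f (a *\<^sub>R e1 + b *\<^sub>R e2) \<partial>lborel) \<partial>lborel)"
    unfolding 1 by (rule lborel_pair.Fubini'[symmetric]) measurable
qed

text \<open>Values at two points differ by at most \<open>\<integral> \<bar>d\<bar>\<close>. If \<open>\<bar>v s\<bar>\<close> exceeded this integral, \<open>\<bar>v\<bar>\<close> would be bounded
below by a positive constant on the whole line and could not be integrable.\<close>

lemma integrable_on_line_bound:
  fixes v d :: "real \<Rightarrow> real"
  assumes d: "\<And>s. (v has_real_derivative d s) (at s)" "continuous_on UNIV d"
    and v: "(\<integral>\<^sup>+s. ennreal \<bar>v s\<bar> \<partial>lborel) < \<infinity>"
  shows "ennreal \<bar>v s\<bar> \<le> (\<integral>\<^sup>+s. ennreal \<bar>d s\<bar> \<partial>lborel)"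
proof (rule ccontr)
  assume "\<not> ?thesis"
  then have less: "(\<integral>\<^sup>+s. ennreal \<bar>d s\<bar> \<partial>lborel) < ennreal \<bar>v s\<bar>" by simp
  then obtain j where j: "(\<integral>\<^sup>+s. ennreal \<bar>d s\<bar> \<partial>lborel) = ennreal j" "0 \<le> j"
    by (cases "\<integral>\<^sup>+s. ennreal \<bar>d s\<bar> \<partial>lborel") auto
  with less have js: "j < \<bar>v s\<bar>" by (simp add: ennreal_less_iff)
  have diff: "\<bar>v b - v a\<bar> \<le> j" if "a \<le> b" for a b
  proof -
    have "v b - v a = (\<integral>x. d x * indicator {a..b} x \<partial>lborel)"
      using d that by (subst integral_FTC_Icc_real) (auto simp: continuous_on_eq_continuous_at)
    then have "ennreal \<bar>v b - v a\<bar> \<le> (\<integral>\<^sup>+x. ennreal \<bar>d x * indicator {a..b} x\<bar> \<partial>lborel)"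
      using ennreal_abs_integral_le by simp
    also have "\<dots> \<le> (\<integral>\<^sup>+x. ennreal \<bar>d x\<bar> \<partial>lborel)"
      by (intro nn_integral_mono ennreal_leI) (auto simp: indicator_def)
    finally show ?thesis using j by simp
  qed
  have "\<bar>v s\<bar> - j \<le> \<bar>v t\<bar>" for t
    using diff[of s t] diff[of t s] by (cases "s \<le> t") auto
  then have "(\<integral>\<^sup>+t. ennreal (\<bar>v s\<bar> - j) \<partial>(lborel :: real measure)) \<le> (\<integral>\<^sup>+t. ennreal \<bar>v t\<bar> \<partial>lborel)"
    by (intro nn_integral_mono ennreal_leI)
  moreover have "(\<integral>\<^sup>+t. ennreal (\<bar>v s\<bar> - j) \<partial>(lborel :: real measure)) = \<infinity>"
    using js by (simp add: ennreal_mult_top)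
  ultimately show False using v by simp
qed

text \<open>On almost every horizontal line \<open>\<bar>v\<bar>\<close> is bounded by \<open>P\<close>, the integral of \<open>\<bar>D e1\<bar>\<close> over that line, and on
almost every vertical line by the analogous \<open>Q\<close>. Hence \<open>v\<^sup>2 \<le> P Q\<close>, where \<open>P\<close> depends only on the second
coordinate and \<open>Q\<close> only on the first, so the integral of the product factors.\<close>

proposition planar_Sobolev_inequality:
  fixes v :: "real^2 \<Rightarrow> real" and D :: "real^2 \<Rightarrow> real^2 \<Rightarrow> real"
  assumes D: "\<And>e x s. e \<in> Basis \<Longrightarrow> ((\<lambda>s. v (x + s *\<^sub>R e)) has_real_derivative D e (x + s *\<^sub>R e)) (at s)"
      "\<And>e. e \<in> Basis \<Longrightarrow> continuous_on UNIV (D e)"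
    and v: "continuous_on UNIV v" "(\<integral>\<^sup>+x. ennreal \<bar>v x\<bar> \<partial>lborel) < \<infinity>"
  shows "(\<integral>\<^sup>+x. ennreal ((v x)\<^sup>2) \<partial>lborel) \<le>
    (\<integral>\<^sup>+x. ennreal \<bar>D e1 x\<bar> \<partial>lborel) * (\<integral>\<^sup>+x. ennreal \<bar>D e2 x\<bar> \<partial>lborel)"
proof -
  have e: "e1 \<in> Basis" "e2 \<in> Basis" by (simp_all add: Basis_real2)
  note [measurable] = borel_measurable_continuous_onI[OF v(1)]
    borel_measurable_continuous_onI[OF D(2)[OF e(1)]] borel_measurable_continuous_onI[OF D(2)[OF e(2)]]
  define P where "P b = (\<integral>\<^sup>+a. ennreal \<bar>D e1 (a *\<^sub>R e1 + b *\<^sub>R e2)\<bar> \<partial>lborel)" for b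
  define Q where "Q a = (\<integral>\<^sup>+b. ennreal \<bar>D e2 (a *\<^sub>R e1 + b *\<^sub>R e2)\<bar> \<partial>lborel)" for a
  have [measurable]: "P \<in> borel_measurable borel" "Q \<in> borel_measurable borel"
    unfolding P_def Q_def by measurable
  have "AE b in lborel. (\<integral>\<^sup>+a. ennreal \<bar>v (a *\<^sub>R e1 + b *\<^sub>R e2)\<bar> \<partial>lborel) \<noteq> \<infinity>"
    using v(2) by (intro nn_integral_PInf_AE) (auto simp: nn_integral_real2(2))
  then have vP: "AE b in lborel. \<forall>a. ennreal \<bar>v (a *\<^sub>R e1 + b *\<^sub>R e2)\<bar> \<le> P b"
  proof eventually_elim
    case (elim b)
    show ?case
      unfolding P_def
    proof (intro allI integrable_on_line_bound[where v = "\<lambda>a. v (a *\<^sub>R e1 + b *\<^sub>R e2)"])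
      show "((\<lambda>a. v (a *\<^sub>R e1 + b *\<^sub>R e2)) has_real_derivative D e1 (s *\<^sub>R e1 + b *\<^sub>R e2)) (at s)" for s
        using D(1)[OF e(1), of "b *\<^sub>R e2" s] by (simp add: add.commute)
      show "continuous_on UNIV (\<lambda>s. D e1 (s *\<^sub>R e1 + b *\<^sub>R e2))"
        by (rule continuous_on_compose2[OF D(2)[OF e(1)]]) (auto intro!: continuous_intros)
    qed (use elim in \<open>simp add: less_top\<close>)
  qed
  have "AE a in lborel. (\<integral>\<^sup>+b. ennreal \<bar>v (a *\<^sub>R e1 + b *\<^sub>R e2)\<bar> \<partial>lborel) \<noteq> \<infinity>"
    using v(2) by (intro nn_integral_PInf_AE) (auto simp: nn_integral_real2(1))
  then have vQ: "AE a in lborel. \<forall>b. ennreal \<bar>v (a *\<^sub>R e1 + b *\<^sub>R e2)\<bar> \<le> Q a"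
  proof eventually_elim
    case (elim a)
    show ?case
      unfolding Q_def
    proof (intro allI integrable_on_line_bound[where v = "\<lambda>b. v (a *\<^sub>R e1 + b *\<^sub>R e2)"])
      show "((\<lambda>b. v (a *\<^sub>R e1 + b *\<^sub>R e2)) has_real_derivative D e2 (a *\<^sub>R e1 + s *\<^sub>R e2)) (at s)" for s
        using D(1)[OF e(2), of "a *\<^sub>R e1" s] by simp
      show "continuous_on UNIV (\<lambda>s. D e2 (a *\<^sub>R e1 + s *\<^sub>R e2))"
        by (rule continuous_on_compose2[OF D(2)[OF e(2)]]) (auto intro!: continuous_intros)
    qed (use elim in \<open>simp add: less_top\<close>)
  qed
  have "(\<integral>\<^sup>+x. ennreal ((v x)\<^sup>2) \<partial>lborel) =
      (\<integral>\<^sup>+a. (\<integral>\<^sup>+b. ennreal ((v (a *\<^sub>R e1 + b *\<^sub>R e2))\<^sup>2) \<partial>lborel) \<partial>lborel)"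
    by (rule nn_integral_real2) measurable
  also have "\<dots> \<le> (\<integral>\<^sup>+a. (\<integral>\<^sup>+b. Q a * P b \<partial>lborel) \<partial>lborel)"
  proof (rule nn_integral_mono_AE)
    show "AE a in lborel. (\<integral>\<^sup>+b. ennreal ((v (a *\<^sub>R e1 + b *\<^sub>R e2))\<^sup>2) \<partial>lborel) \<le> (\<integral>\<^sup>+b. Q a * P b \<partial>lborel)"
      using vQ
    proof eventually_elim
      case (elim a)
      show ?case
      proof (rule nn_integral_mono_AE)
        show "AE b in lborel. ennreal ((v (a *\<^sub>R e1 + b *\<^sub>R e2))\<^sup>2) \<le> Q a * P b"
          using vP
        proof eventually_elim
          case (elim b)
          have "ennreal ((v (a *\<^sub>R e1 + b *\<^sub>R e2))\<^sup>2) =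
              ennreal \<bar>v (a *\<^sub>R e1 + b *\<^sub>R e2)\<bar> * ennreal \<bar>v (a *\<^sub>R e1 + b *\<^sub>R e2)\<bar>"
            by (simp add: ennreal_mult[symmetric] power2_eq_square)
          also have "\<dots> \<le> Q a * P b"
            using elim \<open>\<forall>b. ennreal \<bar>v (a *\<^sub>R e1 + b *\<^sub>R e2)\<bar> \<le> Q a\<close> by (intro mult_mono) auto
          finally show ?case .
        qed
      qed
    qed
  qed
  also have "\<dots> = (\<integral>\<^sup>+a. Q a \<partial>lborel) * (\<integral>\<^sup>+b. P b \<partial>lborel)"
    by (simp add: nn_integral_cmult nn_integral_multc)
  also have "\<dots> = (\<integral>\<^sup>+x. ennreal \<bar>D e1 x\<bar> \<partial>lborel) * (\<integral>\<^sup>+x. ennreal \<bar>D e2 x\<bar> \<partial>lborel)"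
    by (simp add: P_def Q_def nn_integral_real2(2)[where f = "\<lambda>x. ennreal \<bar>D e1 x\<bar>"]
        nn_integral_real2(1)[where f = "\<lambda>x. ennreal \<bar>D e2 x\<bar>"] mult.commute)
  finally show ?thesis .
qed

text \<open>The planar inequality for \<open>v\<^bsup>k + 2\<^esup>\<close>, whose partial derivatives are \<open>(k + 2) v\<^bsup>k + 1\<^esup> \<partial>v\<close>, and
Cauchy--Schwarz bound the moment of order \<open>2 k + 4\<close> by \<open>(k + 2)\<^sup>2 A\<close> times the moment of order \<open>2 k + 2\<close>.
The mollification \<open>v\<close> is bounded, so all these powers are integrable.\<close>

lemma mollified_even_moments:
  assumes u: "u \<in> L2" and g: "g \<in> L2" "is_weak_gradient u g" and \<phi>: "mollifier \<epsilon> \<phi>"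
  defines "A \<equiv> \<integral>x. (norm (g x))\<^sup>2 \<partial>lborel" and "m \<equiv> \<integral>x. (u x)\<^sup>2 \<partial>lborel"
  shows "(\<integral>\<^sup>+x. ennreal ((mollify \<phi> u x) ^ (2 * Suc k)) \<partial>lborel) \<le> ennreal ((fact (Suc k))\<^sup>2 * A ^ k * m)"
proof -
  have \<phi>': "test_function \<phi>" using \<phi> by (simp add: mollifier_def)
  define v where "v = mollify \<phi> u"
  define d where "d e = mollify \<phi> (\<lambda>y. g y \<bullet> e)" for e
  have Am: "0 \<le> A" "0 \<le> m" by (simp_all add: A_def m_def)
  have cv: "continuous_on UNIV v" unfolding v_def by (rule continuous_mollify[OF u \<phi>'])
  have cd: "continuous_on UNIV (d e)" for e
    unfolding d_def by (rule continuous_mollify[OF L2_component[OF g(1)] \<phi>'])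
  note [measurable] = borel_measurable_continuous_onI[OF cv] borel_measurable_continuous_onI[OF cd]
  have dv: "((\<lambda>s. v (x + s *\<^sub>R e)) has_real_derivative d e (x + s *\<^sub>R e)) (at s)" for x s e
    unfolding v_def d_def by (rule mollify_has_derivative[OF u g \<phi>'])
  obtain B where B: "0 \<le> B" "\<And>x. \<bar>v x\<bar> \<le> B" unfolding v_def using mollify_bounded[OF u \<phi>] by blast
  have v2: "(\<integral>\<^sup>+x. ennreal ((v x)\<^sup>2) \<partial>lborel) \<le> ennreal m"
    using mollify_L2_bound[OF u \<phi>] nn_integral_L2[OF u] by (simp add: v_def m_def)
  have d2: "(\<integral>\<^sup>+x. ennreal ((d e x)\<^sup>2) \<partial>lborel) \<le> ennreal A" if e: "e \<in> Basis" for e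
  proof -
    have "(\<integral>\<^sup>+x. ennreal ((d e x)\<^sup>2) \<partial>lborel) \<le> (\<integral>\<^sup>+x. ennreal ((g x \<bullet> e)\<^sup>2) \<partial>lborel)"
      unfolding d_def by (rule mollify_L2_bound[OF L2_component[OF g(1)] \<phi>])
    also have "\<dots> \<le> (\<integral>\<^sup>+x. ennreal ((norm (g x))\<^sup>2) \<partial>lborel)"
      using Basis_le_norm[OF e] by (intro nn_integral_mono ennreal_leI) (simp add: abs_le_square_iff[symmetric])
    also have "\<dots> = ennreal A" by (simp add: nn_integral_L2[OF g(1)] A_def)
    finally show ?thesis .
  qed
  show ?thesis
    unfolding v_def[symmetric]
  proof (induction k)
    case 0
    show ?case using v2 by simp
  next
    case (Suc k)
    define D where "D e x = real (k + 2) * v x ^ Suc k * d e x" for e x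
    have D1: "(\<integral>\<^sup>+x. ennreal \<bar>D e x\<bar> \<partial>lborel)\<^sup>2 \<le>
        ennreal ((real (k + 2))\<^sup>2 * ((fact (Suc k))\<^sup>2 * A ^ k * m) * A)" if e: "e \<in> Basis" for e
    proof -
      have "(\<integral>\<^sup>+x. ennreal \<bar>D e x\<bar> \<partial>lborel) =
          (\<integral>\<^sup>+x. ennreal (real (k + 2) * \<bar>v x\<bar> ^ Suc k) * ennreal \<bar>d e x\<bar> \<partial>lborel)"
        unfolding D_def by (intro nn_integral_cong) (simp add: abs_mult power_abs ennreal_mult[symmetric] del: power_Suc)
      then have "(\<integral>\<^sup>+x. ennreal \<bar>D e x\<bar> \<partial>lborel)\<^sup>2 \<le>
          (\<integral>\<^sup>+x. (ennreal (real (k + 2) * \<bar>v x\<bar> ^ Suc k))\<^sup>2 \<partial>lborel) * (\<integral>\<^sup>+x. (ennreal \<bar>d e x\<bar>)\<^sup>2 \<partial>lborel)"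
        by (simp only:) (rule Cauchy_Schwarz_nn_integral; measurable)
      also have "(\<integral>\<^sup>+x. (ennreal (real (k + 2) * \<bar>v x\<bar> ^ Suc k))\<^sup>2 \<partial>lborel) =
          (\<integral>\<^sup>+x. ennreal ((real (k + 2))\<^sup>2) * ennreal (v x ^ (2 * Suc k)) \<partial>lborel)"
      proof (rule nn_integral_cong)
        fix x
        have "(real (k + 2) * \<bar>v x\<bar> ^ Suc k)\<^sup>2 = (real (k + 2))\<^sup>2 * v x ^ (2 * Suc k)"
          by (simp add: power_mult_distrib power_mult[symmetric] power_abs[symmetric] mult.commute[of _ 2] power_even_abs del: power_Suc mult_Suc_right)
        then show "(ennreal (real (k + 2) * \<bar>v x\<bar> ^ Suc k))\<^sup>2 =
            ennreal ((real (k + 2))\<^sup>2) * ennreal (v x ^ (2 * Suc k))"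
          by (simp only: ennreal_power ennreal_mult'[symmetric] zero_le_power2 mult_nonneg_nonneg
              of_nat_0_le_iff zero_le_power abs_ge_zero)
      qed
      also have "\<dots> * (\<integral>\<^sup>+x. (ennreal \<bar>d e x\<bar>)\<^sup>2 \<partial>lborel) \<le>
          (ennreal ((real (k + 2))\<^sup>2) * ennreal ((fact (Suc k))\<^sup>2 * A ^ k * m)) * ennreal A"
        using Suc.IH d2[OF e]
        by (intro mult_mono) (auto simp: nn_integral_cmult ennreal_power simp del: power_Suc mult_Suc_right fact_Suc intro!: mult_left_mono)
      also have "\<dots> = ennreal ((real (k + 2))\<^sup>2 * ((fact (Suc k))\<^sup>2 * A ^ k * m) * A)"
        using Am by (simp only: ennreal_mult'[symmetric] zero_le_power2 mult_nonneg_nonneg zero_le_power)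
      finally show ?thesis .
    qed
    have e: "e1 \<in> Basis" "e2 \<in> Basis" by (simp_all add: Basis_real2)
    have "(\<integral>\<^sup>+x. ennreal ((v x ^ (k + 2))\<^sup>2) \<partial>lborel) \<le>
        (\<integral>\<^sup>+x. ennreal \<bar>D e1 x\<bar> \<partial>lborel) * (\<integral>\<^sup>+x. ennreal \<bar>D e2 x\<bar> \<partial>lborel)"
    proof (rule planar_Sobolev_inequality)
      show "((\<lambda>s. v (x + s *\<^sub>R e) ^ (k + 2)) has_real_derivative D e (x + s *\<^sub>R e)) (at s)" for e x s
        unfolding D_def by (rule DERIV_cong[OF DERIV_power[OF dv]]) simp
      show "continuous_on UNIV (D e)" for e
        unfolding D_def by (intro continuous_intros cv cd)
      show "continuous_on UNIV (\<lambda>x. v x ^ (k + 2))" by (intro continuous_intros cv)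
      have "(\<integral>\<^sup>+x. ennreal \<bar>v x ^ (k + 2)\<bar> \<partial>lborel) \<le> (\<integral>\<^sup>+x. ennreal (B ^ k) * ennreal ((v x)\<^sup>2) \<partial>lborel)"
      proof (rule nn_integral_mono)
        fix x
        have "\<bar>v x ^ (k + 2)\<bar> = \<bar>v x\<bar> ^ k * (v x)\<^sup>2" by (simp only: power_add abs_mult power_abs) simp
        also have "\<dots> \<le> B ^ k * (v x)\<^sup>2" using B by (intro mult_right_mono power_mono) auto
        finally show "ennreal \<bar>v x ^ (k + 2)\<bar> \<le> ennreal (B ^ k) * ennreal ((v x)\<^sup>2)"
          using B(1) by (simp only: ennreal_mult'[symmetric] zero_le_power ennreal_leI)
      qed
      also have "\<dots> \<le> ennreal (B ^ k) * ennreal m"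
        using v2 by (simp add: nn_integral_cmult mult_left_mono)
      also have "\<dots> < \<infinity>" by (simp add: ennreal_mult_less_top)
      finally show "(\<integral>\<^sup>+x. ennreal \<bar>v x ^ (k + 2)\<bar> \<partial>lborel) < \<infinity>" .
    qed
    also have "\<dots> \<le> ennreal ((real (k + 2))\<^sup>2 * ((fact (Suc k))\<^sup>2 * A ^ k * m) * A)"
    proof -
      have *: "a * b \<le> (c::ennreal)" if "a\<^sup>2 \<le> c" "b\<^sup>2 \<le> c" for a b c
      proof (cases "a \<le> b")
        case True
        then have "a * b \<le> b * b" by (intro mult_right_mono) auto
        with that show ?thesis by (simp add: power2_eq_square)
      next
        case False
        then have "a * b \<le> a * a" by (intro mult_left_mono) auto
        with that show ?thesis by (simp add: power2_eq_square)
      qed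
      show ?thesis by (rule *[OF D1[OF e(1)] D1[OF e(2)]])
    qed
    also have "(real (k + 2))\<^sup>2 * ((fact (Suc k))\<^sup>2 * A ^ k * m) * A = (fact (Suc (Suc k)))\<^sup>2 * A ^ Suc k * m"
      by (simp add: fact_Suc[of "Suc k"] power_mult_distrib del: fact_Suc of_nat_Suc)
    also have "(\<lambda>x. ennreal ((v x ^ (k + 2))\<^sup>2)) = (\<lambda>x. ennreal (v x ^ (2 * Suc (Suc k))))"
    proof
      fix x
      have "(k + 2) * 2 = 2 * Suc (Suc k)" by simp
      then show "ennreal ((v x ^ (k + 2))\<^sup>2) = ennreal (v x ^ (2 * Suc (Suc k)))"
        by (simp only: power_mult[symmetric])
    qed
    finally show ?case .
  qed
qed

lemma mollified_sequence_AE: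
  assumes u: "u \<in> L2" and g: "g \<in> L2" "is_weak_gradient u g"
  obtains \<phi> where "\<And>n. \<exists>\<epsilon>. mollifier \<epsilon> (\<phi> n)" "AE x in lborel. (\<lambda>n::nat. mollify (\<phi> n) u x) \<longlonglongrightarrow> u x"
proof -
  obtain \<phi> where \<phi>: "\<And>n::nat. mollifier (1 / real (Suc n)) (\<phi> n)"
    using mollifier_exists[of "1 / real (Suc n)" for n] by (metis of_nat_0_less_iff zero_less_Suc zero_less_divide_1_iff)
  have \<phi>': "test_function (\<phi> n)" for n using \<phi>[of n] by (simp add: mollifier_def)
  define A where "A = (\<integral>x. (norm (g x))\<^sup>2 \<partial>lborel)"
  define w where "w n x = (mollify (\<phi> n) u x - u x)\<^sup>2" for n x
  note [measurable] = L2_measurable[OF u] borel_measurable_continuous_onI[OF continuous_mollify[OF u \<phi>']]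
  have nn: "(\<integral>\<^sup>+x. ennreal (w n x) \<partial>lborel) \<le> ennreal ((1 / real (Suc n))\<^sup>2 * A)" for n
    unfolding w_def A_def by (rule mollify_approx[OF u g \<phi>]) simp
  have [measurable]: "w n \<in> borel_measurable borel" for n unfolding w_def by measurable
  have int: "integrable lborel (w n)" for n
    using nn[of n] by (intro integrableI_nonneg) (auto simp: w_def order_le_less_trans)
  have "(\<integral>x. norm (w n x) \<partial>lborel) \<le> (1 / real (Suc n))\<^sup>2 * A" for n
  proof -
    have "(\<integral>\<^sup>+x. ennreal (w n x) \<partial>lborel) = ennreal (\<integral>x. w n x \<partial>lborel)"
      by (rule nn_integral_eq_integral[OF int]) (simp add: w_def)
    with nn[of n] have "(\<integral>x. w n x \<partial>lborel) \<le> (1 / real (Suc n))\<^sup>2 * A"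
      by (simp add: A_def)
    then show ?thesis by (simp add: w_def)
  qed
  then have upper: "\<forall>n. (\<integral>x. norm (w n x) \<partial>lborel) \<le> (1 / real (Suc n))\<^sup>2 * A" by (rule allI)
  have "(\<lambda>n. (1 / real (Suc n))\<^sup>2 * A) \<longlonglongrightarrow> 0\<^sup>2 * A"
    by (intro tendsto_intros LIMSEQ_Suc[OF lim_1_over_n])
  then have lim0: "(\<lambda>n. (1 / real (Suc n))\<^sup>2 * A) \<longlonglongrightarrow> 0"
    by (simp only: power_zero_numeral mult_zero_left)
  have "0 \<le> (\<integral>x. norm (w n x) \<partial>lborel)" for n
    by (rule Bochner_Integration.integral_nonneg) simp
  then have lower: "\<forall>n. 0 \<le> (\<integral>x. norm (w n x) \<partial>lborel)" by (rule allI)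
  have "(\<lambda>n. \<integral>x. norm (w n x) \<partial>lborel) \<longlonglongrightarrow> 0"
    by (rule tendsto_sandwich[OF always_eventually[OF lower] always_eventually[OF upper] tendsto_const lim0])
  from tendsto_L1_AE_subseq[OF int this] obtain r where "AE x in lborel. (\<lambda>n. w (r n) x) \<longlonglongrightarrow> 0"
    by auto
  then have "AE x in lborel. (\<lambda>n. mollify (\<phi> (r n)) u x) \<longlonglongrightarrow> u x"
  proof eventually_elim
    case (elim x)
    then have "(\<lambda>n. sqrt (w (r n) x)) \<longlonglongrightarrow> sqrt 0" by (rule tendsto_real_sqrt)
    then have "(\<lambda>n. \<bar>mollify (\<phi> (r n)) u x - u x\<bar>) \<longlonglongrightarrow> 0" by (simp add: w_def)
    then show ?case by (simp add: tendsto_rabs_zero_iff LIM_zero_iff)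
  qed
  then show ?thesis using \<phi> by (intro that[of "\<lambda>n. \<phi> (r n)"]) auto
qed

text \<open>Fatou's lemma along mollifications that converge almost everywhere.\<close>

lemma even_moments:
  assumes u: "u \<in> L2" and g: "g \<in> L2" "is_weak_gradient u g"
  shows "(\<integral>\<^sup>+x. ennreal ((u x) ^ (2 * Suc k)) \<partial>lborel) \<le>
    ennreal ((fact (Suc k))\<^sup>2 * (\<integral>x. (norm (g x))\<^sup>2 \<partial>lborel) ^ k * (\<integral>x. (u x)\<^sup>2 \<partial>lborel))" (is "_ \<le> ?R")
proof -
  obtain \<phi> where \<phi>: "\<And>n. \<exists>\<epsilon>. mollifier \<epsilon> (\<phi> n)"
    and lim: "AE x in lborel. (\<lambda>n::nat. mollify (\<phi> n) u x) \<longlonglongrightarrow> u x"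
    using mollified_sequence_AE[OF u g] by blast
  have \<phi>': "test_function (\<phi> n)" for n using \<phi>[of n] by (auto simp: mollifier_def)
  note [measurable] = L2_measurable[OF u] borel_measurable_continuous_onI[OF continuous_mollify[OF u \<phi>']]
  have "(\<integral>\<^sup>+x. ennreal ((u x) ^ (2 * Suc k)) \<partial>lborel) =
      (\<integral>\<^sup>+x. liminf (\<lambda>n. ennreal ((mollify (\<phi> n) u x) ^ (2 * Suc k))) \<partial>lborel)"
  proof (rule nn_integral_cong_AE, use lim in eventually_elim)
    case (elim x)
    then have "(\<lambda>n. ennreal ((mollify (\<phi> n) u x) ^ (2 * Suc k))) \<longlonglongrightarrow> ennreal ((u x) ^ (2 * Suc k))"
      by (intro tendsto_ennrealI tendsto_power)
    then show ?case by (simp only: lim_imp_Liminf[OF sequentially_bot])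
  qed
  also have "\<dots> \<le> liminf (\<lambda>n. \<integral>\<^sup>+x. ennreal ((mollify (\<phi> n) u x) ^ (2 * Suc k)) \<partial>lborel)"
    by (rule nn_integral_liminf) measurable
  also have "\<dots> \<le> ?R"
  proof (rule Liminf_le[OF sequentially_bot], rule always_eventually, rule allI)
    fix n
    obtain \<epsilon> where "mollifier \<epsilon> (\<phi> n)" using \<phi> by blast
    then show "(\<integral>\<^sup>+x. ennreal ((mollify (\<phi> n) u x) ^ (2 * Suc k)) \<partial>lborel) \<le> ?R"
      by (rule mollified_even_moments[OF u g])
  qed
  finally show ?thesis .
qed

text \<open>One admissible constant; \<open>K_GN\<close> is the infimum of all of them.\<close>

definition GN_bound :: "real \<Rightarrow> real" where
  "GN_bound q = 1 + (fact (Suc (nat \<lceil>q\<rceil>)))\<^sup>2"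

text \<open>Between the orders \<open>2\<close> and \<open>2 k + 2\<close> one has \<open>\<bar>u\<bar>\<^sup>q \<le> s\<^bsup>q - 2\<^esup> u\<^sup>2 + s\<^bsup>q - 2 k - 2\<^esup> u\<^bsup>2 k + 2\<^esup>\<close> for every \<open>s > 0\<close>, by the
first term where \<open>\<bar>u\<bar> \<le> s\<close> and by the second elsewhere. The choice \<open>s = sqrt A\<close> gives both terms the
same power of \<open>A\<close>, the one that the inequality requires.\<close>

proposition Gagliardo_Nirenberg:
  assumes u: "u \<in> H1" and q: "2 < q"
  defines "A \<equiv> \<integral>x. (norm (weak_grad u x))\<^sup>2 \<partial>lborel" and "m \<equiv> \<integral>x. (u x)\<^sup>2 \<partial>lborel"
  shows "integrable lborel (\<lambda>x. \<bar>u x\<bar> powr q)"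
    and "(\<integral>x. \<bar>u x\<bar> powr q \<partial>lborel) \<le> GN_bound q * A powr ((q - 2) / 2) * m"
proof -
  note uL = H1_L2[OF u] and g = weak_grad[OF u]
  note [measurable] = L2_measurable[OF uL]
  define k where "k = nat \<lceil>q\<rceil>"
  \<comment> \<open>The moment of order \<open>2 k + 2\<close> controls the part where \<open>\<bar>u\<bar>\<close> is large.\<close>
  have k: "q \<le> real (2 * Suc k)" using real_nat_ceiling_ge[of q] unfolding k_def by simp
  have k0: "k > 0" using q by (simp add: k_def)
  have Am: "0 \<le> A" "0 \<le> m" by (simp_all add: A_def m_def)
  have mom: "(\<integral>\<^sup>+x. ennreal ((u x) ^ (2 * Suc k)) \<partial>lborel) \<le> ennreal ((fact (Suc k))\<^sup>2 * A ^ k * m)" for k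
    unfolding A_def m_def by (rule even_moments[OF uL g])
  have mu: "(\<integral>\<^sup>+x. ennreal ((u x)\<^sup>2) \<partial>lborel) = ennreal m"
    using nn_integral_L2[OF uL] by (simp add: m_def)
  have "(\<integral>\<^sup>+x. ennreal (\<bar>u x\<bar> powr q) \<partial>lborel) \<le> ennreal (GN_bound q * A powr ((q - 2) / 2) * m)"
  proof (cases "A = 0")
    case True
    have "(\<integral>\<^sup>+x. ennreal ((u x) ^ (2 * Suc k)) \<partial>lborel) = 0"
      using mom[of k] k0 by (simp add: True power_0_left)
    then have "AE x in lborel. ennreal ((u x) ^ (2 * Suc k)) = 0"
      by (subst (asm) nn_integral_0_iff_AE) auto
    then have "AE x in lborel. ennreal (\<bar>u x\<bar> powr q) = 0"
      by eventually_elim (simp add: power_mult zero_less_power2 del: power_Suc mult_Suc_right)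
    then have "(\<integral>\<^sup>+x. ennreal (\<bar>u x\<bar> powr q) \<partial>lborel) = 0"
      by (subst nn_integral_0_iff_AE) auto
    then show ?thesis by simp
  next
    case False
    define s where "s = sqrt A"
    have s: "s > 0" "A = s\<^sup>2" using False Am by (auto simp: s_def)
    have pw: "\<bar>u x\<bar> powr q \<le> s powr (q - 2) * (u x)\<^sup>2 + s powr (q - real (2 * Suc k)) * (u x) ^ (2 * Suc k)" for x
    proof (cases "u x = 0")
      case False
      then have a: "\<bar>u x\<bar> > 0" by simp
      have p2: "\<bar>u x\<bar> powr 2 = (u x)\<^sup>2" using a by (simp add: powr_numeral)
      have pk: "\<bar>u x\<bar> powr real (2 * Suc k) = (u x) ^ (2 * Suc k)"
        using a by (simp only: powr_realpow) (simp add: power_mult)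
      have nn: "0 \<le> (u x) ^ (2 * Suc k)" by (simp only: pk[symmetric] powr_ge_zero)
      show ?thesis
      proof (cases "\<bar>u x\<bar> \<le> s")
        case True
        have "\<bar>u x\<bar> powr q = \<bar>u x\<bar> powr (q - 2) * (u x)\<^sup>2"
          by (simp only: p2[symmetric] powr_add[symmetric]) simp
        also have "\<dots> \<le> s powr (q - 2) * (u x)\<^sup>2"
          using True q by (intro mult_right_mono powr_mono2) auto
        finally show ?thesis using nn by (simp add: add_increasing2 del: mult_Suc_right power_Suc)
      next
        case False
        have "\<bar>u x\<bar> powr q = \<bar>u x\<bar> powr (q - real (2 * Suc k)) * (u x) ^ (2 * Suc k)"
          by (simp only: powr_add[symmetric] pk[symmetric]) simp
        also have "\<dots> \<le> s powr (q - real (2 * Suc k)) * (u x) ^ (2 * Suc k)"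
          using False s k nn by (intro mult_right_mono powr_mono2') auto
        finally show ?thesis by (simp add: add_increasing del: mult_Suc_right power_Suc)
      qed
    qed (use q in auto)
    have "(\<integral>\<^sup>+x. ennreal (\<bar>u x\<bar> powr q) \<partial>lborel) \<le>
        (\<integral>\<^sup>+x. ennreal (s powr (q - 2)) * ennreal ((u x)\<^sup>2) +
          ennreal (s powr (q - real (2 * Suc k))) * ennreal ((u x) ^ (2 * Suc k)) \<partial>lborel)"
    proof (rule nn_integral_mono)
      fix x
      have "0 \<le> (u x) ^ (2 * Suc k)" by (rule zero_le_even_power')
      then show "ennreal (\<bar>u x\<bar> powr q) \<le> ennreal (s powr (q - 2)) * ennreal ((u x)\<^sup>2) +
          ennreal (s powr (q - real (2 * Suc k))) * ennreal ((u x) ^ (2 * Suc k))"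
        using ennreal_leI[OF pw[of x]]
        by (simp add: ennreal_mult[symmetric] ennreal_plus[symmetric] del: ennreal_plus mult_Suc_right power_Suc)
    qed
    also have "\<dots> = ennreal (s powr (q - 2)) * ennreal m +
        ennreal (s powr (q - real (2 * Suc k))) * (\<integral>\<^sup>+x. ennreal ((u x) ^ (2 * Suc k)) \<partial>lborel)"
      by (simp add: nn_integral_add nn_integral_cmult mu del: mult_Suc_right power_Suc)
    also have "\<dots> \<le> ennreal (s powr (q - 2)) * ennreal m +
        ennreal (s powr (q - real (2 * Suc k))) * ennreal ((fact (Suc k))\<^sup>2 * A ^ k * m)"
      by (intro add_left_mono mult_left_mono mom) auto
    also have "\<dots> = ennreal (s powr (q - 2) * m + s powr (q - real (2 * Suc k)) * ((fact (Suc k))\<^sup>2 * A ^ k * m))"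
      using Am by (simp add: ennreal_mult[symmetric] ennreal_plus[symmetric] del: ennreal_plus fact_Suc mult_Suc_right)
    also have "s powr (q - real (2 * Suc k)) * ((fact (Suc k))\<^sup>2 * A ^ k * m) = s powr (q - 2) * ((fact (Suc k))\<^sup>2 * m)"
    proof -
      have "A ^ k = s powr real (2 * k)" using s by (simp only: powr_realpow power_mult)
      then have "s powr (q - real (2 * Suc k)) * A ^ k = s powr (q - 2)"
        by (simp add: powr_add[symmetric])
      then show ?thesis by (metis mult.assoc mult.left_commute)
    qed
    also have "s powr (q - 2) * m + s powr (q - 2) * ((fact (Suc k))\<^sup>2 * m) = GN_bound q * A powr ((q - 2) / 2) * m"
    proof -
      have "A = s powr 2" using s by (simp add: powr_numeral)
      then have "A powr ((q - 2) / 2) = s powr (2 * ((q - 2) / 2))" by (simp only: powr_powr)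
      moreover have "2 * ((q - 2) / 2) = q - 2"
        by (simp only: times_divide_eq_right) (rule nonzero_mult_div_cancel_left, simp)
      ultimately have "A powr ((q - 2) / 2) = s powr (q - 2)" by (simp only:)
      then show ?thesis
        unfolding GN_bound_def k_def by (simp only: distrib_right distrib_left mult_1 mult_ac)
    qed
    finally show ?thesis .
  qed
  note nn = this
  show int: "integrable lborel (\<lambda>x. \<bar>u x\<bar> powr q)"
    using nn by (intro integrableI_nonneg) (auto simp: order_le_less_trans)
  have "ennreal (\<integral>x. \<bar>u x\<bar> powr q \<partial>lborel) \<le> ennreal (GN_bound q * A powr ((q - 2) / 2) * m)"
    using nn by (simp add: nn_integral_eq_integral[OF int])
  moreover have "0 \<le> GN_bound q * A powr ((q - 2) / 2) * m"
    using Am by (auto simp: GN_bound_def simp del: fact_Suc)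
  ultimately show "(\<integral>x. \<bar>u x\<bar> powr q \<partial>lborel) \<le> GN_bound q * A powr ((q - 2) / 2) * m"
    by (simp add: ennreal_le_iff)
qed

section \<open>Taylor estimates for the power functional\<close>

lemma has_real_derivative_signed_powr:
  fixes q t :: real
  assumes "q > 0"
  shows "((\<lambda>t. \<bar>t\<bar> powr q * t) has_real_derivative (q + 1) * \<bar>t\<bar> powr q) (at t)"
proof -
  consider "t > 0" | "t < 0" | "t = 0" by linarith
  then show ?thesis
  proof cases
    case 1
    have "((\<lambda>t. t powr (q + 1)) has_real_derivative (q + 1) * t powr (q + 1 - 1)) (at t)"
      using 1 by (rule has_real_derivative_powr)
    then have "((\<lambda>t. t powr (q + 1)) has_real_derivative (q + 1) * \<bar>t\<bar> powr q) (at t)"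
      using 1 by simp
    then show ?thesis
      by (rule has_field_derivative_transform_within_open[of _ _ _ "{0<..}"])
        (use 1 in \<open>auto simp: powr_add\<close>)
  next
    case 2
    have "((\<lambda>t. - ((- t) powr (q + 1))) has_real_derivative (q + 1) * (- t) powr (q + 1 - 1)) (at t)"
      using 2 by (auto intro!: derivative_eq_intros simp: powr_diff field_simps)
    then have "((\<lambda>t. - ((- t) powr (q + 1))) has_real_derivative (q + 1) * \<bar>t\<bar> powr q) (at t)"
      using 2 by simp
    then show ?thesis
      by (rule has_field_derivative_transform_within_open[of _ _ _ "{..<0}"])
        (use 2 in \<open>auto simp: powr_add\<close>)
  next
    case 3
    have "((\<lambda>h. \<bar>h\<bar> powr q) \<longlongrightarrow> \<bar>0\<bar> powr q) (at (0::real))"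
      using assms by (intro tendsto_powr' tendsto_intros) auto
    then have "((\<lambda>h. \<bar>h\<bar> powr q) \<longlongrightarrow> 0) (at (0::real))" by simp
    then have "((\<lambda>h. (\<bar>0 + h\<bar> powr q * (0 + h) - \<bar>0\<bar> powr q * 0) / h) \<longlongrightarrow> 0) (at (0::real))"
      by (rule Lim_transform_eventually) (auto simp: eventually_at_filter assms)
    then show ?thesis using assms 3 by (simp add: DERIV_def)
  qed
qed

lemma powr_abs_add_2: "\<bar>t\<bar> powr (q + 2) = \<bar>t\<bar> powr q * t * t" for t q :: real
  by (cases "t = 0") (auto simp: powr_add powr_numeral power2_eq_square)

lemma has_real_derivative_abs_powr:
  fixes q t :: real
  assumes "q > 0"
  shows "((\<lambda>t. \<bar>t\<bar> powr (q + 2)) has_real_derivative (q + 2) * (\<bar>t\<bar> powr q * t)) (at t)"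
  unfolding powr_abs_add_2
  by (rule DERIV_cong[OF DERIV_mult[OF has_real_derivative_signed_powr[OF assms] DERIV_ident]])
    (simp add: algebra_simps)

lemma mean_value_between:
  fixes f :: "real \<Rightarrow> real"
  assumes "\<And>t. (f has_real_derivative f' t) (at t)"
  obtains \<theta> where "\<bar>\<theta>\<bar> \<le> \<bar>b\<bar>" "f (a + b) - f a = f' (a + \<theta>) * b"
proof (cases b "0::real" rule: linorder_cases)
  case less
  then obtain z where "z > a + b" "z < a" "f a - f (a + b) = (a - (a + b)) * f' z"
    using MVT2[of "a + b" a f f'] assms by auto
  then show ?thesis using less by (intro that[of "z - a"]) (auto simp: algebra_simps)
next
  case greater
  then obtain z where "z > a" "z < a + b" "f (a + b) - f a = (a + b - a) * f' z"
    using MVT2[of a "a + b" f f'] assms by auto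
  then show ?thesis using greater by (intro that[of "z - a"]) (auto simp: algebra_simps)
qed (use that[of 0] in auto)

lemma signed_powr_increment:
  fixes q a b :: real
  assumes "q > 0"
  shows "\<bar>\<bar>a + b\<bar> powr q * (a + b) - \<bar>a\<bar> powr q * a\<bar> \<le> (q + 1) * ((\<bar>a\<bar> + \<bar>b\<bar>) powr q * \<bar>b\<bar>)"
proof -
  obtain \<theta> where \<theta>: "\<bar>\<theta>\<bar> \<le> \<bar>b\<bar>"
    "\<bar>a + b\<bar> powr q * (a + b) - \<bar>a\<bar> powr q * a = (q + 1) * \<bar>a + \<theta>\<bar> powr q * b"
    using mean_value_between[OF has_real_derivative_signed_powr[OF assms], of b a] by blast
  have "\<bar>a + \<theta>\<bar> powr q \<le> (\<bar>a\<bar> + \<bar>b\<bar>) powr q"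
    using \<theta>(1) assms by (intro powr_mono2) auto
  then show ?thesis
    unfolding \<theta>(2) using assms by (auto simp: abs_mult mult.assoc intro!: mult_left_mono mult_right_mono)
qed

lemma abs_powr_second_order:
  fixes q a b :: real
  assumes "q > 0"
  shows "\<bar>\<bar>a + b\<bar> powr (q + 2) - \<bar>a\<bar> powr (q + 2) - (q + 2) * (\<bar>a\<bar> powr q * a) * b\<bar> \<le>
    (q + 2) * (q + 1) * ((\<bar>a\<bar> + \<bar>b\<bar>) powr q * \<bar>b\<bar> * \<bar>b\<bar>)"
proof -
  obtain \<theta> where \<theta>: "\<bar>\<theta>\<bar> \<le> \<bar>b\<bar>"
    "\<bar>a + b\<bar> powr (q + 2) - \<bar>a\<bar> powr (q + 2) = (q + 2) * (\<bar>a + \<theta>\<bar> powr q * (a + \<theta>)) * b"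
    using mean_value_between[OF has_real_derivative_abs_powr[OF assms], of b a] by blast
  have "\<bar>\<bar>a + \<theta>\<bar> powr q * (a + \<theta>) - \<bar>a\<bar> powr q * a\<bar> \<le> (q + 1) * ((\<bar>a\<bar> + \<bar>\<theta>\<bar>) powr q * \<bar>\<theta>\<bar>)"
    by (rule signed_powr_increment[OF assms])
  also have "\<dots> \<le> (q + 1) * ((\<bar>a\<bar> + \<bar>b\<bar>) powr q * \<bar>b\<bar>)"
    using \<theta>(1) assms by (intro mult_left_mono mult_mono powr_mono2) auto
  finally have "(q + 2) * \<bar>\<bar>a + \<theta>\<bar> powr q * (a + \<theta>) - \<bar>a\<bar> powr q * a\<bar> * \<bar>b\<bar> \<le>
      (q + 2) * ((q + 1) * ((\<bar>a\<bar> + \<bar>b\<bar>) powr q * \<bar>b\<bar>)) * \<bar>b\<bar>"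
    using assms by (intro mult_right_mono mult_left_mono) auto
  moreover have "\<bar>\<bar>a + b\<bar> powr (q + 2) - \<bar>a\<bar> powr (q + 2) - (q + 2) * (\<bar>a\<bar> powr q * a) * b\<bar> =
      (q + 2) * \<bar>\<bar>a + \<theta>\<bar> powr q * (a + \<theta>) - \<bar>a\<bar> powr q * a\<bar> * \<bar>b\<bar>"
  proof -
    have "\<bar>a + b\<bar> powr (q + 2) - \<bar>a\<bar> powr (q + 2) - (q + 2) * (\<bar>a\<bar> powr q * a) * b =
        (q + 2) * (\<bar>a + \<theta>\<bar> powr q * (a + \<theta>) - \<bar>a\<bar> powr q * a) * b"
      unfolding \<theta>(2) by (simp only: right_diff_distrib left_diff_distrib)
    then show ?thesis using assms by (simp add: abs_mult)
  qed
  ultimately show ?thesis by (simp add: mult.assoc)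
qed

lemma L2_Cauchy_Schwarz:
  fixes f g :: "real^2 \<Rightarrow> real"
  assumes "f \<in> L2" "g \<in> L2"
  shows "(\<integral>x. \<bar>f x * g x\<bar> \<partial>lborel) \<le> sqrt (\<integral>x. (f x)\<^sup>2 \<partial>lborel) * sqrt (\<integral>x. (g x)\<^sup>2 \<partial>lborel)"
proof -
  note [measurable] = L2_measurable[OF assms(1)] L2_measurable[OF assms(2)]
  have "ennreal ((\<integral>x. \<bar>f x * g x\<bar> \<partial>lborel)\<^sup>2) = (\<integral>\<^sup>+x. ennreal \<bar>f x\<bar> * ennreal \<bar>g x\<bar> \<partial>lborel)\<^sup>2"
    by (simp add: nn_integral_eq_integral L2_integrable_mult assms ennreal_power ennreal_mult[symmetric] abs_mult[symmetric])
  also have "\<dots> \<le> (\<integral>\<^sup>+x. (ennreal \<bar>f x\<bar>)\<^sup>2 \<partial>lborel) * (\<integral>\<^sup>+x. (ennreal \<bar>g x\<bar>)\<^sup>2 \<partial>lborel)"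
    by (rule Cauchy_Schwarz_nn_integral) measurable
  also have "\<dots> = ennreal ((\<integral>x. (f x)\<^sup>2 \<partial>lborel) * (\<integral>x. (g x)\<^sup>2 \<partial>lborel))"
    using nn_integral_L2[OF assms(1)] nn_integral_L2[OF assms(2)] by (simp add: ennreal_power ennreal_mult)
  finally have "(\<integral>x. \<bar>f x * g x\<bar> \<partial>lborel)\<^sup>2 \<le> (\<integral>x. (f x)\<^sup>2 \<partial>lborel) * (\<integral>x. (g x)\<^sup>2 \<partial>lborel)"
    by (simp add: ennreal_le_iff)
  then show ?thesis by (simp add: real_le_rsqrt real_sqrt_mult[symmetric])
qed

definition H1_grad :: "(real^2 \<Rightarrow> real) \<Rightarrow> real" where
  "H1_grad u = (\<integral>x. (norm (weak_grad u x))\<^sup>2 \<partial>lborel)"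

definition H1_mass :: "(real^2 \<Rightarrow> real) \<Rightarrow> real" where
  "H1_mass u = (\<integral>x. (u x)\<^sup>2 \<partial>lborel)"

lemma H1_grad_nonneg: "0 \<le> H1_grad u" and H1_mass_nonneg: "0 \<le> H1_mass u"
  by (simp_all add: H1_grad_def H1_mass_def)

lemma H1_powr_bound:
  assumes u: "u \<in> H1" and s: "2 < s" and r: "H1_grad u \<le> r" "H1_mass u \<le> r"
  shows "integrable lborel (\<lambda>x. \<bar>u x\<bar> powr s)"
    and "(\<integral>x. \<bar>u x\<bar> powr s \<partial>lborel) \<le> GN_bound s * r powr ((s - 2) / 2) * r"
proof -
  note GN = Gagliardo_Nirenberg[OF u s, folded H1_grad_def H1_mass_def]
  show "integrable lborel (\<lambda>x. \<bar>u x\<bar> powr s)" by (rule GN(1))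
  note GN(2)
  also have "GN_bound s * H1_grad u powr ((s - 2) / 2) * H1_mass u \<le> GN_bound s * r powr ((s - 2) / 2) * r"
    using r s H1_grad_nonneg[of u] H1_mass_nonneg[of u]
    by (intro mult_mono powr_mono2) (auto simp: GN_bound_def simp del: fact_Suc)
  finally show "(\<integral>x. \<bar>u x\<bar> powr s \<partial>lborel) \<le> GN_bound s * r powr ((s - 2) / 2) * r" .
qed

lemma powr_add_le: "(a + b) powr s \<le> 2 powr s * (a powr s + b powr s)" if "0 \<le> a" "0 \<le> b" "0 \<le> s" for a b s :: real
proof -
  have "(a + b) powr s \<le> (2 * max a b) powr s" using that by (intro powr_mono2) auto
  also have "\<dots> = 2 powr s * max a b powr s" using that by (simp add: powr_mult)
  also have "\<dots> \<le> 2 powr s * (a powr s + b powr s)"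
    by (intro mult_left_mono) (auto simp: max_def)
  finally show ?thesis .
qed

lemma square_powr: "(a powr q)\<^sup>2 = a powr (2 * q)" for a q :: real
  by (simp add: power2_eq_square powr_add[symmetric])

text \<open>The value that the two Cauchy--Schwarz steps of \<open>remainder_estimate\<close> produce; \<open>r\<close> bounds the
gradient energies and masses of the functions involved.\<close>

definition remainder_const :: "real \<Rightarrow> real \<Rightarrow> real" where
  "remainder_const q r =
     sqrt (sqrt (2 powr (4 * q) * (2 * (GN_bound (4 * q) * r powr ((4 * q - 2) / 2) * r))) * sqrt (GN_bound 4))"

lemma remainder_const_nonneg: "0 \<le> r \<Longrightarrow> 0 \<le> remainder_const q r"
  by (auto simp: remainder_const_def GN_bound_def simp del: fact_Suc intro!: mult_nonneg_nonneg add_nonneg_nonneg)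

text \<open>With \<open>U = \<bar>u\<bar> + \<bar>w\<bar>\<close>, Cauchy--Schwarz splits off \<open>v\<close> from \<open>U\<^sup>q w v\<close>, and then splits \<open>U\<^bsup>2 q\<^esup> w\<^sup>2\<close> into the
moment of order \<open>4 q\<close> of \<open>U\<close> and the fourth moment of \<open>w\<close>. The fourth moment is at most a constant times
\<open>H1_grad w * H1_mass w\<close>. For \<open>v = w\<close> the bound has the mass of \<open>w\<close> to the power \<open>3 / 4\<close>: this is quadratic in
the norm of \<open>X\<close>, and still of order \<open>t\<^bsup>3 / 2\<^esup>\<close> when only the \<open>L\<^sup>2\<close> norm of \<open>w\<close> is of order \<open>t\<close>.\<close>

proposition remainder_estimate:
  assumes u: "u \<in> H1" and w: "w \<in> H1" and v: "v \<in> H1" and q: "q > 1"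
    and r: "H1_grad u \<le> r" "H1_mass u \<le> r" "H1_grad w \<le> r" "H1_mass w \<le> r"
  shows "integrable lborel (\<lambda>x. (\<bar>u x\<bar> + \<bar>w x\<bar>) powr q * \<bar>w x\<bar> * \<bar>v x\<bar>)"
    and "(\<integral>x. (\<bar>u x\<bar> + \<bar>w x\<bar>) powr q * \<bar>w x\<bar> * \<bar>v x\<bar> \<partial>lborel) \<le>
      remainder_const q r * sqrt (sqrt (H1_grad w * H1_mass w)) * sqrt (H1_mass v)"
proof -
  note L = H1_L2[OF u] H1_L2[OF w] H1_L2[OF v]
  note [measurable] = L[THEN L2_measurable]
  have r0: "0 \<le> r" using r(2) H1_mass_nonneg[of u] by linarith
  define U where "U x = \<bar>u x\<bar> + \<bar>w x\<bar>" for x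
  have U: "0 \<le> U x" for x by (simp add: U_def)
  have [measurable]: "U \<in> borel_measurable borel" unfolding U_def by measurable
  define b where "b = GN_bound (4 * q) * r powr ((4 * q - 2) / 2) * r"
  have b0: "0 \<le> b" using r0 by (auto simp: b_def GN_bound_def simp del: fact_Suc)
  have s: "2 < 4 * q" using q by simp
  note Nu = H1_powr_bound[OF u s r(1,2), folded b_def] and Nw = H1_powr_bound[OF w s r(3,4), folded b_def]
  have pw: "U x powr (4 * q) \<le> 2 powr (4 * q) * (\<bar>u x\<bar> powr (4 * q) + \<bar>w x\<bar> powr (4 * q))" for x
    unfolding U_def using q by (intro powr_add_le) auto
  have int_dom: "integrable lborel (\<lambda>x. 2 powr (4 * q) * (\<bar>u x\<bar> powr (4 * q) + \<bar>w x\<bar> powr (4 * q)))"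
    using Nu(1) Nw(1) by simp
  have intU: "integrable lborel (\<lambda>x. U x powr (4 * q))"
    by (rule Bochner_Integration.integrable_bound[OF int_dom]) (auto intro!: AE_I2 order_trans[OF pw])
  have U4: "(\<integral>x. U x powr (4 * q) \<partial>lborel) \<le> 2 powr (4 * q) * (2 * b)"
  proof -
    have "(\<integral>x. U x powr (4 * q) \<partial>lborel) \<le>
        (\<integral>x. 2 powr (4 * q) * (\<bar>u x\<bar> powr (4 * q) + \<bar>w x\<bar> powr (4 * q)) \<partial>lborel)"
      by (rule integral_mono[OF intU int_dom pw])
    also have "\<dots> = 2 powr (4 * q) * ((\<integral>x. \<bar>u x\<bar> powr (4 * q) \<partial>lborel) + (\<integral>x. \<bar>w x\<bar> powr (4 * q) \<partial>lborel))"
      using Nu(1) Nw(1) by simp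
    also have "\<dots> \<le> 2 powr (4 * q) * (2 * b)" using Nu(2) Nw(2) by (intro mult_left_mono) auto
    finally show ?thesis .
  qed
  have U2L: "(\<lambda>x. U x powr (2 * q)) \<in> L2"
    using intU by (auto simp: L2_def square_powr)
  have w4: "\<bar>w x\<bar> powr 4 = ((w x)\<^sup>2)\<^sup>2" for x
    by (cases "w x = 0") (simp_all add: powr_numeral power_mult[symmetric])
  note GNw = Gagliardo_Nirenberg[OF w, of 4, folded H1_grad_def H1_mass_def]
  have w2L: "(\<lambda>x. (w x)\<^sup>2) \<in> L2"
    using GNw(1) by (auto simp: L2_def w4)
  have W4: "(\<integral>x. ((w x)\<^sup>2)\<^sup>2 \<partial>lborel) \<le> GN_bound 4 * (H1_grad w * H1_mass w)"
    using GNw(2) H1_grad_nonneg[of w] by (simp add: w4 mult.assoc)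
  have sq: "(U x powr q * w x)\<^sup>2 = U x powr (2 * q) * (w x)\<^sup>2" for x
    by (simp add: power_mult_distrib square_powr)
  have UwL: "(\<lambda>x. U x powr q * w x) \<in> L2"
    using L2_integrable_mult[OF U2L w2L] by (simp add: L2_def sq)
  have Uw: "(\<integral>x. (U x powr q * w x)\<^sup>2 \<partial>lborel) \<le>
      sqrt (2 powr (4 * q) * (2 * b)) * sqrt (GN_bound 4) * sqrt (H1_grad w * H1_mass w)"
  proof -
    have "(\<integral>x. (U x powr q * w x)\<^sup>2 \<partial>lborel) = (\<integral>x. \<bar>U x powr (2 * q) * (w x)\<^sup>2\<bar> \<partial>lborel)"
      by (simp add: sq)
    also have "\<dots> \<le> sqrt (\<integral>x. (U x powr (2 * q))\<^sup>2 \<partial>lborel) * sqrt (\<integral>x. ((w x)\<^sup>2)\<^sup>2 \<partial>lborel)"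
      by (rule L2_Cauchy_Schwarz[OF U2L w2L])
    also have "\<dots> \<le> sqrt (2 powr (4 * q) * (2 * b)) * sqrt (GN_bound 4 * (H1_grad w * H1_mass w))"
      using U4 W4 b0 by (intro mult_mono real_sqrt_le_mono) (auto simp: square_powr)
    finally show ?thesis by (simp add: real_sqrt_mult)
  qed
  have eq: "(\<bar>u x\<bar> + \<bar>w x\<bar>) powr q * \<bar>w x\<bar> * \<bar>v x\<bar> = \<bar>(U x powr q * w x) * v x\<bar>" for x
    by (simp add: U_def abs_mult)
  show "integrable lborel (\<lambda>x. (\<bar>u x\<bar> + \<bar>w x\<bar>) powr q * \<bar>w x\<bar> * \<bar>v x\<bar>)"
    unfolding eq by (intro integrable_abs L2_integrable_mult UwL L)
  have "(\<integral>x. \<bar>(U x powr q * w x) * v x\<bar> \<partial>lborel) \<le>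
      sqrt (\<integral>x. (U x powr q * w x)\<^sup>2 \<partial>lborel) * sqrt (H1_mass v)"
    unfolding H1_mass_def by (rule L2_Cauchy_Schwarz[OF UwL L(3)])
  also have "\<dots> \<le> sqrt (sqrt (2 powr (4 * q) * (2 * b)) * sqrt (GN_bound 4) * sqrt (H1_grad w * H1_mass w)) * sqrt (H1_mass v)"
    using Uw by (intro mult_right_mono real_sqrt_le_mono) (auto simp: H1_mass_nonneg)
  finally show "(\<integral>x. (\<bar>u x\<bar> + \<bar>w x\<bar>) powr q * \<bar>w x\<bar> * \<bar>v x\<bar> \<partial>lborel) \<le>
      remainder_const q r * sqrt (sqrt (H1_grad w * H1_mass w)) * sqrt (H1_mass v)"
    unfolding eq remainder_const_def b_def by (simp only: real_sqrt_mult)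
qed

section \<open>The functionals on $X$ are continuously differentiable\<close>

lemma rep_X_fun: "rep_X u \<in> X_fun"
  using Quotient_rep_reflp[OF Quotient_X, of u] by (simp add: X_eq_def)

lemma rep_X_H1: "rep_X u \<in> H1"
  by (rule X_fun_H1[OF rep_X_fun])

lemma rep_X_measurable: "rep_X u \<in> borel_measurable borel"
  by (rule X_fun_measurable[OF rep_X_fun])

lemma rep_abs_X: "f \<in> X_fun \<Longrightarrow> AE x in lborel. rep_X (abs_X f) x = f x"
  using Quotient_rep_abs[OF Quotient_X, of f] by (simp add: X_eq_def)

lemma rep_X_add: "AE x in lborel. rep_X (u + v) x = rep_X u x + rep_X v x"
  unfolding plus_X_def map_fun_def comp_def id_def by (intro rep_abs_X X_fun_add rep_X_fun)

lemma rep_X_scale: "AE x in lborel. rep_X (r *\<^sub>R u) x = r * rep_X u x"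
  unfolding scaleR_X_def map_fun_def comp_def id_def by (intro rep_abs_X X_fun_scale rep_X_fun)

lemma weak_grad_rep_add:
  "AE x in lborel. weak_grad (rep_X (u + v)) x = weak_grad (rep_X u) x + weak_grad (rep_X v) x"
proof -
  have "weak_grad (rep_X (u + v)) = weak_grad (\<lambda>x. rep_X u x + rep_X v x)"
    by (intro weak_grad_cong rep_X_add H1_L2 rep_X_H1 H1_add)
  then show ?thesis using H1_add(2)[OF rep_X_H1 rep_X_H1, of u v] by simp
qed

lemma weak_grad_rep_scale:
  "AE x in lborel. weak_grad (rep_X (r *\<^sub>R u)) x = r *\<^sub>R weak_grad (rep_X u) x"
proof -
  have "weak_grad (rep_X (r *\<^sub>R u)) = weak_grad (\<lambda>x. r * rep_X u x)"
    by (intro weak_grad_cong rep_X_scale H1_L2 rep_X_H1 H1_scale)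
  then show ?thesis using H1_scale(2)[OF rep_X_H1[of u], of r] by simp
qed

lemma A_fun_rep: "A_fun u = H1_grad (rep_X u)"
  by (simp add: A_fun_def H1_grad_def)

lemma mass_rep: "mass u = H1_mass (rep_X u)"
  by (simp add: mass_def H1_mass_def)

lemma C_fun_rep: "C_fun p u = (\<integral>x. \<bar>rep_X u x\<bar> powr p \<partial>lborel)"
  by (simp add: C_fun_def)

lemma A_fun_nonneg: "0 \<le> A_fun u" and mass_nonneg: "0 \<le> mass u"
  by (simp_all add: A_fun_rep mass_rep H1_grad_nonneg H1_mass_nonneg)

lemma log_mass_nonneg: "0 \<le> log_mass u"
  by (auto simp: log_mass_def intro!: integral_nonneg_AE)

lemma A_fun_le_norm: "A_fun u \<le> (norm u)\<^sup>2" and mass_le_norm: "mass u \<le> (norm u)\<^sup>2"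
  using A_fun_nonneg[of u] mass_nonneg[of u] log_mass_nonneg[of u] by (simp_all add: norm_X_square)

definition mass_form :: "X \<Rightarrow> X \<Rightarrow> real" where
  "mass_form u v = (\<integral>x. rep_X u x * rep_X v x \<partial>lborel)"

definition grad_form :: "X \<Rightarrow> X \<Rightarrow> real" where
  "grad_form u v = (\<integral>x. weak_grad (rep_X u) x \<bullet> weak_grad (rep_X v) x \<partial>lborel)"

definition power_form :: "real \<Rightarrow> X \<Rightarrow> X \<Rightarrow> real" where
  "power_form q u v = (\<integral>x. \<bar>rep_X u x\<bar> powr q * rep_X u x * rep_X v x \<partial>lborel)"

lemma rep_integrable_mult: "integrable lborel (\<lambda>x. rep_X u x * rep_X v x)"
  by (intro L2_integrable_mult H1_L2 rep_X_H1)

lemma rep_integrable_grad: "integrable lborel (\<lambda>x. weak_grad (rep_X u) x \<bullet> weak_grad (rep_X v) x)"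
  by (intro L2_integrable_inner weak_grad rep_X_H1)

lemma weak_grad_rep_measurable: "weak_grad (rep_X u) \<in> borel_measurable borel"
  by (intro L2_measurable weak_grad rep_X_H1)

lemma mass_form_add: "mass_form u (v + w) = mass_form u v + mass_form u w"
proof -
  note [measurable] = rep_X_measurable
  have "mass_form u (v + w) = (\<integral>x. rep_X u x * rep_X v x + rep_X u x * rep_X w x \<partial>lborel)"
    unfolding mass_form_def using rep_X_add[of v w]
    by (intro integral_cong_AE) (auto simp: distrib_left elim!: eventually_mono)
  then show ?thesis by (simp add: mass_form_def rep_integrable_mult)
qed

lemma mass_form_scale: "mass_form u (r *\<^sub>R v) = r * mass_form u v"
proof -
  note [measurable] = rep_X_measurable
  have "mass_form u (r *\<^sub>R v) = (\<integral>x. r * (rep_X u x * rep_X v x) \<partial>lborel)"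
    unfolding mass_form_def using rep_X_scale[of r v]
    by (intro integral_cong_AE) (auto elim!: eventually_mono)
  then show ?thesis by (simp add: mass_form_def)
qed

lemma mass_form_commute: "mass_form u v = mass_form v u"
  by (simp add: mass_form_def mult.commute)

lemma mass_form_self: "mass_form u u = mass u"
  by (simp add: mass_form_def mass_rep H1_mass_def power2_eq_square)

lemma grad_form_add: "grad_form u (v + w) = grad_form u v + grad_form u w"
proof -
  note [measurable] = weak_grad_rep_measurable
  have "grad_form u (v + w) = (\<integral>x. weak_grad (rep_X u) x \<bullet> weak_grad (rep_X v) x
      + weak_grad (rep_X u) x \<bullet> weak_grad (rep_X w) x \<partial>lborel)"
    unfolding grad_form_def using weak_grad_rep_add[of v w]
    by (intro integral_cong_AE) (auto simp: inner_add_right elim!: eventually_mono)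
  then show ?thesis by (simp add: grad_form_def rep_integrable_grad)
qed

lemma grad_form_scale: "grad_form u (r *\<^sub>R v) = r * grad_form u v"
proof -
  note [measurable] = weak_grad_rep_measurable
  have "grad_form u (r *\<^sub>R v) = (\<integral>x. r * (weak_grad (rep_X u) x \<bullet> weak_grad (rep_X v) x) \<partial>lborel)"
    unfolding grad_form_def using weak_grad_rep_scale[of r v]
    by (intro integral_cong_AE) (auto elim!: eventually_mono)
  then show ?thesis by (simp add: grad_form_def)
qed

lemma grad_form_commute: "grad_form u v = grad_form v u"
  by (simp add: grad_form_def inner_commute)

lemma grad_form_self: "grad_form u u = A_fun u"
  by (simp add: grad_form_def A_fun_rep H1_grad_def dot_square_norm)

lemma mass_form_bound: "\<bar>mass_form u v\<bar> \<le> norm u * norm v"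
proof -
  have "\<bar>mass_form u v\<bar> \<le> (\<integral>x. \<bar>rep_X u x * rep_X v x\<bar> \<partial>lborel)"
    unfolding mass_form_def by (rule integral_abs_bound)
  also have "\<dots> \<le> sqrt (mass u) * sqrt (mass v)"
    unfolding mass_rep H1_mass_def by (intro L2_Cauchy_Schwarz H1_L2 rep_X_H1)
  also have "\<dots> \<le> norm u * norm v"
    using mass_le_norm[of u] mass_le_norm[of v] mass_nonneg
    by (intro mult_mono real_le_lsqrt) auto
  finally show ?thesis .
qed

lemma L2_norm: "f \<in> L2 \<Longrightarrow> (\<lambda>x. norm (f x)) \<in> L2"
  by (auto simp: L2_def)

lemma grad_form_bound: "\<bar>grad_form u v\<bar> \<le> norm u * norm v"
proof -
  have "\<bar>grad_form u v\<bar> \<le> (\<integral>x. \<bar>weak_grad (rep_X u) x \<bullet> weak_grad (rep_X v) x\<bar> \<partial>lborel)"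
    unfolding grad_form_def by (rule integral_abs_bound)
  also have "\<dots> \<le> (\<integral>x. \<bar>norm (weak_grad (rep_X u) x) * norm (weak_grad (rep_X v) x)\<bar> \<partial>lborel)"
    by (intro integral_mono integrable_abs rep_integrable_grad L2_integrable_mult L2_norm weak_grad rep_X_H1)
      (simp add: Cauchy_Schwarz_ineq2)
  also have "\<dots> \<le> sqrt (A_fun u) * sqrt (A_fun v)"
    unfolding A_fun_rep H1_grad_def by (intro L2_Cauchy_Schwarz L2_norm weak_grad rep_X_H1)
  also have "\<dots> \<le> norm u * norm v"
    using A_fun_le_norm[of u] A_fun_le_norm[of v] A_fun_nonneg
    by (intro mult_mono real_le_lsqrt) auto
  finally show ?thesis .
qed

lemma mass_add: "mass (u + w) = mass u + 2 * mass_form u w + mass w"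
proof -
  have "mass (u + w) = mass_form (u + w) u + mass_form (u + w) w"
    by (simp add: mass_form_self[symmetric] mass_form_add)
  then show ?thesis
    using mass_form_add[of u u w] mass_form_add[of w u w]
    by (simp add: mass_form_commute[of "u + w"] mass_form_self mass_form_commute[of w u])
qed

lemma A_fun_add: "A_fun (u + w) = A_fun u + 2 * grad_form u w + A_fun w"
proof -
  have "A_fun (u + w) = grad_form (u + w) u + grad_form (u + w) w"
    by (simp add: grad_form_self[symmetric] grad_form_add)
  then show ?thesis
    using grad_form_add[of u u w] grad_form_add[of w u w]
    by (simp add: grad_form_commute[of "u + w"] grad_form_self grad_form_commute[of w u])
qed

lemma power_form_integrable_bound:
  assumes "q > 1" "A_fun u \<le> r" "mass u \<le> r"
  shows "integrable lborel (\<lambda>x. \<bar>rep_X u x\<bar> powr q * rep_X u x * rep_X v x)"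
    and "\<bar>power_form q u v\<bar> \<le> remainder_const q r * sqrt (sqrt (A_fun u * mass u)) * sqrt (mass v)"
proof -
  note [measurable] = rep_X_measurable
  note est = remainder_estimate[OF rep_X_H1[of u] rep_X_H1[of u] rep_X_H1[of v] assms(1)
      assms(2,3,2,3)[unfolded A_fun_rep mass_rep], folded A_fun_rep mass_rep]
  have le: "\<bar>\<bar>rep_X u x\<bar> powr q * rep_X u x * rep_X v x\<bar> \<le>
      (\<bar>rep_X u x\<bar> + \<bar>rep_X u x\<bar>) powr q * \<bar>rep_X u x\<bar> * \<bar>rep_X v x\<bar>" for x
    using assms(1) by (auto simp: abs_mult intro!: mult_right_mono powr_mono2)
  show int: "integrable lborel (\<lambda>x. \<bar>rep_X u x\<bar> powr q * rep_X u x * rep_X v x)"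
    by (rule Bochner_Integration.integrable_bound[OF est(1)]) (auto intro!: AE_I2 order_trans[OF le])
  have "\<bar>power_form q u v\<bar> \<le> (\<integral>x. \<bar>\<bar>rep_X u x\<bar> powr q * rep_X u x * rep_X v x\<bar> \<partial>lborel)"
    unfolding power_form_def by (rule integral_abs_bound)
  also have "\<dots> \<le> (\<integral>x. (\<bar>rep_X u x\<bar> + \<bar>rep_X u x\<bar>) powr q * \<bar>rep_X u x\<bar> * \<bar>rep_X v x\<bar> \<partial>lborel)"
    by (intro integral_mono integrable_abs int est(1) le)
  also note est(2)
  finally show "\<bar>power_form q u v\<bar> \<le> remainder_const q r * sqrt (sqrt (A_fun u * mass u)) * sqrt (mass v)" .
qed

lemma power_form_add:
  assumes "q > 1"
  shows "power_form q u (v + w) = power_form q u v + power_form q u w"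
proof -
  note [measurable] = rep_X_measurable
  note int = power_form_integrable_bound(1)[OF assms max.cobounded1 max.cobounded2, of u]
  have "power_form q u (v + w) = (\<integral>x. \<bar>rep_X u x\<bar> powr q * rep_X u x * rep_X v x
      + \<bar>rep_X u x\<bar> powr q * rep_X u x * rep_X w x \<partial>lborel)"
    unfolding power_form_def using rep_X_add[of v w]
    by (intro integral_cong_AE) (auto simp: distrib_left elim!: eventually_mono)
  then show ?thesis by (simp add: power_form_def int)
qed

lemma power_form_scale: "power_form q u (r *\<^sub>R v) = r * power_form q u v"
proof -
  note [measurable] = rep_X_measurable
  have "power_form q u (r *\<^sub>R v) = (\<integral>x. r * (\<bar>rep_X u x\<bar> powr q * rep_X u x * rep_X v x) \<partial>lborel)"
    unfolding power_form_def using rep_X_scale[of r v]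
    by (intro integral_cong_AE) (auto elim!: eventually_mono)
  then show ?thesis by (simp add: power_form_def)
qed

lemma power_form_self: "power_form q u u = C_fun (q + 2) u"
  by (simp add: power_form_def C_fun_rep powr_abs_add_2)

lemma C_fun_integrable: "2 < p \<Longrightarrow> integrable lborel (\<lambda>x. \<bar>rep_X u x\<bar> powr p)"
  by (rule Gagliardo_Nirenberg(1)[OF rep_X_H1])

text \<open>The sharper form, with mass and gradient energy of \<open>w\<close> instead of its norm, is the one that the
Pohozaev identity needs.\<close>

proposition C_fun_remainder:
  assumes q: "q > 1" and r: "A_fun u \<le> r" "mass u \<le> r" "A_fun w \<le> r" "mass w \<le> r"
  shows "\<bar>C_fun (q + 2) (u + w) - C_fun (q + 2) u - (q + 2) * power_form q u w\<bar> \<le>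
    (q + 2) * (q + 1) * (remainder_const q r * sqrt (sqrt (A_fun w * mass w)) * sqrt (mass w))"
proof -
  note [measurable] = rep_X_measurable
  note est = remainder_estimate[OF rep_X_H1[of u] rep_X_H1[of w] rep_X_H1[of w] q
      r[unfolded A_fun_rep mass_rep], folded A_fun_rep mass_rep]
  note int = power_form_integrable_bound(1)[OF q r(1,2)]
  have p: "2 < q + 2" using q by simp
  have int': "integrable lborel (\<lambda>x. \<bar>rep_X u x + rep_X w x\<bar> powr (q + 2))"
    using C_fun_integrable[OF p, of "u + w"]
  proof (rule integrable_cong_AE_imp)
    show "AE x in lborel. \<bar>rep_X (u + w) x\<bar> powr (q + 2) = \<bar>rep_X u x + rep_X w x\<bar> powr (q + 2)"
      using rep_X_add[of u w] by eventually_elim simp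
  qed measurable
  define h where "h x = \<bar>rep_X u x + rep_X w x\<bar> powr (q + 2) - \<bar>rep_X u x\<bar> powr (q + 2)
      - (q + 2) * (\<bar>rep_X u x\<bar> powr q * rep_X u x * rep_X w x)" for x
  have inth: "integrable lborel h"
    unfolding h_def by (intro Bochner_Integration.integrable_diff int' C_fun_integrable p integrable_mult_right int)
  have "C_fun (q + 2) (u + w) = (\<integral>x. \<bar>rep_X u x + rep_X w x\<bar> powr (q + 2) \<partial>lborel)"
    unfolding C_fun_rep using rep_X_add[of u w]
    by (intro integral_cong_AE) (auto elim!: eventually_mono)
  then have "C_fun (q + 2) (u + w) - C_fun (q + 2) u - (q + 2) * power_form q u w = (\<integral>x. h x \<partial>lborel)"
    unfolding h_def C_fun_rep power_form_def using int' C_fun_integrable[OF p, of u] int[of w] by simp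
  also have "\<bar>\<dots>\<bar> \<le> (\<integral>x. \<bar>h x\<bar> \<partial>lborel)" by (rule integral_abs_bound)
  also have "\<dots> \<le> (\<integral>x. (q + 2) * (q + 1) * ((\<bar>rep_X u x\<bar> + \<bar>rep_X w x\<bar>) powr q * \<bar>rep_X w x\<bar> * \<bar>rep_X w x\<bar>) \<partial>lborel)"
    using q abs_powr_second_order[of q]
    by (intro integral_mono integrable_abs inth integrable_mult_right est(1)) (simp add: h_def mult.assoc)
  also have "\<dots> \<le> (q + 2) * (q + 1) * (remainder_const q r * sqrt (sqrt (A_fun w * mass w)) * sqrt (mass w))"
    using q est(2) by (simp only: integral_mult_right_zero) (intro mult_left_mono, auto)
  finally show ?thesis .
qed

lemma power_form_increment:
  assumes q: "q > 1" and r: "A_fun u \<le> r" "mass u \<le> r" "A_fun w \<le> r" "mass w \<le> r"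
  shows "\<bar>power_form q (u + w) v - power_form q u v\<bar> \<le>
    (q + 1) * (remainder_const q r * sqrt (sqrt (A_fun w * mass w)) * sqrt (mass v))"
proof -
  note [measurable] = rep_X_measurable
  note est = remainder_estimate[OF rep_X_H1[of u] rep_X_H1[of w] rep_X_H1[of v] q
      r[unfolded A_fun_rep mass_rep], folded A_fun_rep mass_rep]
  note int = power_form_integrable_bound(1)[OF q r(1,2)]
  define k where "k x = \<bar>rep_X u x + rep_X w x\<bar> powr q * (rep_X u x + rep_X w x) * rep_X v x" for x
  have [measurable]: "k \<in> borel_measurable borel" unfolding k_def by measurable
  have ae: "AE x in lborel. \<bar>rep_X (u + w) x\<bar> powr q * rep_X (u + w) x * rep_X v x = k x"
    using rep_X_add[of u w] by eventually_elim (simp add: k_def)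
  have intk: "integrable lborel k"
    using power_form_integrable_bound(1)[OF q max.cobounded1 max.cobounded2, of "u + w" v] _ ae
    by (rule integrable_cong_AE_imp) measurable
  have "power_form q (u + w) v = (\<integral>x. k x \<partial>lborel)"
    unfolding power_form_def using ae by (intro integral_cong_AE) auto
  then have "power_form q (u + w) v - power_form q u v =
      (\<integral>x. k x - \<bar>rep_X u x\<bar> powr q * rep_X u x * rep_X v x \<partial>lborel)"
    unfolding power_form_def using intk int[of v] by simp
  also have "\<bar>\<dots>\<bar> \<le> (\<integral>x. \<bar>k x - \<bar>rep_X u x\<bar> powr q * rep_X u x * rep_X v x\<bar> \<partial>lborel)"
    by (rule integral_abs_bound)
  also have "\<dots> \<le> (\<integral>x. (q + 1) * ((\<bar>rep_X u x\<bar> + \<bar>rep_X w x\<bar>) powr q * \<bar>rep_X w x\<bar> * \<bar>rep_X v x\<bar>) \<partial>lborel)"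
  proof (intro integral_mono integrable_abs Bochner_Integration.integrable_diff intk int integrable_mult_right est(1))
    fix x
    have "\<bar>\<bar>rep_X u x + rep_X w x\<bar> powr q * (rep_X u x + rep_X w x) - \<bar>rep_X u x\<bar> powr q * rep_X u x\<bar> * \<bar>rep_X v x\<bar> \<le>
        (q + 1) * ((\<bar>rep_X u x\<bar> + \<bar>rep_X w x\<bar>) powr q * \<bar>rep_X w x\<bar>) * \<bar>rep_X v x\<bar>"
      using q by (intro mult_right_mono signed_powr_increment) auto
    then show "\<bar>k x - \<bar>rep_X u x\<bar> powr q * rep_X u x * rep_X v x\<bar> \<le>
        (q + 1) * ((\<bar>rep_X u x\<bar> + \<bar>rep_X w x\<bar>) powr q * \<bar>rep_X w x\<bar> * \<bar>rep_X v x\<bar>)"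
      by (simp add: k_def abs_mult[symmetric] left_diff_distrib mult.assoc)
  qed
  also have "\<dots> \<le> (q + 1) * (remainder_const q r * sqrt (sqrt (A_fun w * mass w)) * sqrt (mass v))"
    using q est(2) by (simp only: integral_mult_right_zero) (intro mult_left_mono, auto)
  finally show ?thesis .
qed

lemma sqrt_sqrt_energy_le: "sqrt (sqrt (A_fun w * mass w)) \<le> norm w"
proof -
  have "A_fun w * mass w \<le> ((norm w)\<^sup>2)\<^sup>2"
    unfolding power2_eq_square[of "(norm w)\<^sup>2"]
    by (intro mult_mono A_fun_le_norm mass_le_norm mass_nonneg) auto
  then have "sqrt (A_fun w * mass w) \<le> (norm w)\<^sup>2"
    by (intro real_le_lsqrt) (auto intro!: mult_nonneg_nonneg A_fun_nonneg mass_nonneg)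
  then have "sqrt (sqrt (A_fun w * mass w)) \<le> sqrt ((norm w)\<^sup>2)" by (rule real_sqrt_le_mono)
  then show ?thesis by simp
qed

lemma sqrt_mass_le: "sqrt (mass w) \<le> norm w"
  using mass_le_norm[of w] mass_nonneg[of w] by (intro real_le_lsqrt) auto

text \<open>All three functionals have a remainder that is quadratic and a derivative that is Lipschitz near each point;
this lemma and the next one turn such bounds into continuous differentiability.\<close>

lemma has_derivative_from_quadratic_remainder:
  fixes f :: "'a::real_normed_vector \<Rightarrow> real"
  assumes D: "bounded_linear D"
    and rem: "\<And>w. norm w \<le> 1 \<Longrightarrow> \<bar>f (u + w) - f u - D w\<bar> \<le> K * (norm w)\<^sup>2"
  shows "(f has_derivative D) (at u)"
  unfolding has_derivative_at
proof (intro conjI D)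
  show "(\<lambda>h. norm (f (u + h) - f u - D h) / norm h) \<midarrow>0\<rightarrow> 0"
  proof (rule Lim_null_comparison)
    show "((\<lambda>h. K * norm h) \<longlongrightarrow> 0) (at (0::'a))"
      by (auto intro!: tendsto_eq_intros)
    have "\<forall>\<^sub>F h in at (0::'a). norm h < 1 \<and> h \<noteq> 0"
      unfolding eventually_at by (intro exI[of _ 1]) (auto simp: dist_norm)
    then show "\<forall>\<^sub>F h in at 0. norm (norm (f (u + h) - f u - D h) / norm h) \<le> K * norm h"
    proof eventually_elim
      case (elim h)
      then have "\<bar>f (u + h) - f u - D h\<bar> \<le> K * norm h * norm h"
        using rem[of h] by (simp add: power2_eq_square mult.assoc)
      then show ?case using elim by (simp add: divide_le_eq)
    qed
  qed
qed

lemma continuous_on_from_lipschitz_increment: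
  fixes D :: "'a::real_normed_vector \<Rightarrow> 'a \<Rightarrow>\<^sub>L real"
  assumes "\<And>u. \<exists>K. \<forall>w v. norm w \<le> 1 \<longrightarrow> \<bar>D (u + w) v - D u v\<bar> \<le> K * norm w * norm v"
  shows "continuous_on UNIV D"
  unfolding continuous_on_eq_continuous_at[OF open_UNIV]
proof
  fix u
  obtain K where K: "\<And>w v. norm w \<le> 1 \<Longrightarrow> \<bar>D (u + w) v - D u v\<bar> \<le> K * norm w * norm v"
    using assms[of u] by blast
  have bound: "norm (D (u + w) - D u) \<le> \<bar>K\<bar> * norm w" if "norm w \<le> 1" for w
  proof (rule norm_blinfun_bound)
    fix v :: 'a
    have "K * norm w * norm v \<le> \<bar>K\<bar> * norm w * norm v"
      by (intro mult_right_mono) auto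
    then show "norm ((D (u + w) - D u) v) \<le> \<bar>K\<bar> * norm w * norm v"
      using K[OF that, of v] by (simp add: blinfun.diff_left)
  qed auto
  have "((\<lambda>w. D (u + w) - D u) \<longlongrightarrow> 0) (at 0)"
  proof (rule Lim_null_comparison)
    show "((\<lambda>w. \<bar>K\<bar> * norm w) \<longlongrightarrow> 0) (at (0::'a))"
      by (auto intro!: tendsto_eq_intros)
    show "\<forall>\<^sub>F w in at 0. norm (D (u + w) - D u) \<le> \<bar>K\<bar> * norm w"
      unfolding eventually_at by (intro exI[of _ 1]) (auto simp: dist_norm intro: bound)
  qed
  then have "((\<lambda>w. D (u + w)) \<longlongrightarrow> D u) (at 0)" by (rule LIM_zero_cancel)
  then show "isCont D u" by (simp add: isCont_iff)
qed

definition mass_deriv :: "X \<Rightarrow> X \<Rightarrow>\<^sub>L real" where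
  "mass_deriv u = Blinfun (\<lambda>v. 2 * mass_form u v)"

definition A_deriv :: "X \<Rightarrow> X \<Rightarrow>\<^sub>L real" where
  "A_deriv u = Blinfun (\<lambda>v. 2 * grad_form u v)"

definition C_deriv :: "real \<Rightarrow> X \<Rightarrow> X \<Rightarrow>\<^sub>L real" where
  "C_deriv q u = Blinfun (\<lambda>v. (q + 2) * power_form q u v)"

lemma mass_deriv_apply: "mass_deriv u v = 2 * mass_form u v"
proof -
  have "bounded_linear (\<lambda>v. 2 * mass_form u v)"
    using mass_form_bound[of u]
    by (intro bounded_linear_intro[of _ "2 * norm u"])
      (auto simp: mass_form_add mass_form_scale abs_mult mult_ac)
  then show ?thesis by (simp add: mass_deriv_def bounded_linear_Blinfun_apply)
qed

lemma A_deriv_apply: "A_deriv u v = 2 * grad_form u v"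
proof -
  have "bounded_linear (\<lambda>v. 2 * grad_form u v)"
    using grad_form_bound[of u]
    by (intro bounded_linear_intro[of _ "2 * norm u"])
      (auto simp: grad_form_add grad_form_scale abs_mult mult_ac)
  then show ?thesis by (simp add: A_deriv_def bounded_linear_Blinfun_apply)
qed

lemma C_deriv_apply:
  assumes q: "q > 1"
  shows "C_deriv q u v = (q + 2) * power_form q u v"
proof -
  define r where "r = (norm u)\<^sup>2"
  define K where "K = remainder_const q r * sqrt (sqrt (A_fun u * mass u))"
  have K: "0 \<le> K"
    unfolding K_def r_def
    by (intro mult_nonneg_nonneg remainder_const_nonneg real_sqrt_ge_zero A_fun_nonneg mass_nonneg) auto
  have "bounded_linear (\<lambda>v. (q + 2) * power_form q u v)"
  proof (rule bounded_linear_intro[of _ "(q + 2) * K"])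
    fix v
    have "\<bar>power_form q u v\<bar> \<le> K * sqrt (mass v)"
      using power_form_integrable_bound(2)[OF q A_fun_le_norm mass_le_norm] by (simp add: K_def r_def)
    also have "\<dots> \<le> K * norm v" by (intro mult_left_mono sqrt_mass_le K)
    finally show "norm ((q + 2) * power_form q u v) \<le> norm v * ((q + 2) * K)"
      using q by (simp add: abs_mult mult_ac)
  qed (use q in \<open>auto simp: power_form_add power_form_scale distrib_left\<close>)
  then show ?thesis by (simp add: C_deriv_def bounded_linear_Blinfun_apply)
qed

lemma mass_C1:
  "(mass has_derivative mass_deriv u) (at u)" "continuous_on UNIV mass_deriv"
proof -
  show "(mass has_derivative mass_deriv u) (at u)"
  proof (rule has_derivative_from_quadratic_remainder[of _ _ _ 1])
    show "\<bar>mass (u + w) - mass u - mass_deriv u w\<bar> \<le> 1 * (norm w)\<^sup>2" for w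
      using mass_le_norm[of w] mass_nonneg[of w] by (simp add: mass_add mass_deriv_apply)
  qed (rule blinfun.bounded_linear_right)
  show "continuous_on UNIV mass_deriv"
  proof (rule continuous_on_from_lipschitz_increment, intro exI[of _ 2] allI impI)
    fix u w v
    show "\<bar>mass_deriv (u + w) v - mass_deriv u v\<bar> \<le> 2 * norm w * norm v"
      using mass_form_bound[of w v] mass_form_add[of v u w]
      by (simp add: mass_deriv_apply mass_form_commute[of _ v] mult.assoc)
  qed
qed

lemma A_fun_C1:
  "(A_fun has_derivative A_deriv u) (at u)" "continuous_on UNIV A_deriv"
proof -
  show "(A_fun has_derivative A_deriv u) (at u)"
  proof (rule has_derivative_from_quadratic_remainder[of _ _ _ 1])
    show "\<bar>A_fun (u + w) - A_fun u - A_deriv u w\<bar> \<le> 1 * (norm w)\<^sup>2" for w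
      using A_fun_le_norm[of w] A_fun_nonneg[of w] by (simp add: A_fun_add A_deriv_apply)
  qed (rule blinfun.bounded_linear_right)
  show "continuous_on UNIV A_deriv"
  proof (rule continuous_on_from_lipschitz_increment, intro exI[of _ 2] allI impI)
    fix u w v
    show "\<bar>A_deriv (u + w) v - A_deriv u v\<bar> \<le> 2 * norm w * norm v"
      using grad_form_bound[of w v] grad_form_add[of v u w]
      by (simp add: A_deriv_apply grad_form_commute[of _ v] mult.assoc)
  qed
qed

proposition C_fun_C1:
  assumes q: "q > 1"
  shows "(C_fun (q + 2) has_derivative C_deriv q u) (at u)" "continuous_on UNIV (C_deriv q)"
proof -
  define r where "r u = max ((norm u)\<^sup>2) 1" for u :: X
  have r: "A_fun u \<le> r u" "mass u \<le> r u" "0 \<le> r u" for u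
    using A_fun_le_norm[of u] mass_le_norm[of u] by (auto simp: r_def)
  have rw: "A_fun w \<le> r u" "mass w \<le> r u" if "norm w \<le> 1" for u w
  proof -
    have "(norm w)\<^sup>2 \<le> 1" using that by (simp add: power_le_one)
    then show "A_fun w \<le> r u" "mass w \<le> r u"
      using A_fun_le_norm[of w] mass_le_norm[of w] by (auto simp: r_def)
  qed
  show "(C_fun (q + 2) has_derivative C_deriv q u) (at u)"
  proof (rule has_derivative_from_quadratic_remainder[of _ _ _ "(q + 2) * (q + 1) * remainder_const q (r u)"])
    fix w :: X assume w: "norm w \<le> 1"
    have "\<bar>C_fun (q + 2) (u + w) - C_fun (q + 2) u - C_deriv q u w\<bar> \<le>
        (q + 2) * (q + 1) * (remainder_const q (r u) * sqrt (sqrt (A_fun w * mass w)) * sqrt (mass w))"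
      unfolding C_deriv_apply[OF q] by (rule C_fun_remainder[OF q r(1,2) rw[OF w]])
    also have "\<dots> \<le> (q + 2) * (q + 1) * (remainder_const q (r u) * norm w * norm w)"
      using q by (intro mult_left_mono mult_mono sqrt_sqrt_energy_le sqrt_mass_le mult_nonneg_nonneg
          remainder_const_nonneg r) (auto simp: mass_nonneg)
    finally show "\<bar>C_fun (q + 2) (u + w) - C_fun (q + 2) u - C_deriv q u w\<bar> \<le>
        (q + 2) * (q + 1) * remainder_const q (r u) * (norm w)\<^sup>2"
      by (simp add: power2_eq_square mult.assoc)
  qed (rule blinfun.bounded_linear_right)
  show "continuous_on UNIV (C_deriv q)"
  proof (rule continuous_on_from_lipschitz_increment, intro exI allI impI)
    fix u w v :: X assume w: "norm w \<le> 1"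
    have "\<bar>C_deriv q (u + w) v - C_deriv q u v\<bar> = (q + 2) * \<bar>power_form q (u + w) v - power_form q u v\<bar>"
      using q by (simp add: C_deriv_apply[OF q] abs_mult flip: right_diff_distrib)
    also have "\<dots> \<le> (q + 2) * ((q + 1) * (remainder_const q (r u) * sqrt (sqrt (A_fun w * mass w)) * sqrt (mass v)))"
      using q by (intro mult_left_mono power_form_increment r(1,2) rw[OF w]) auto
    also have "\<dots> \<le> (q + 2) * ((q + 1) * (remainder_const q (r u) * norm w * norm v))"
      using q by (intro mult_left_mono mult_mono sqrt_sqrt_energy_le sqrt_mass_le mult_nonneg_nonneg
          remainder_const_nonneg r) (auto simp: mass_nonneg)
    finally show "\<bar>C_deriv q (u + w) v - C_deriv q u v\<bar> \<le>
        ((q + 2) * (q + 1) * remainder_const q (r u)) * norm w * norm v"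
      by (simp add: mult.assoc)
  qed
qed

section \<open>Stretching along a coordinate axis\<close>

text \<open>By the fundamental theorem of calculus the increment over the segment of length \<open>\<bar>d x\<bar>\<close> is at most an
integral over the segment of half-length \<open>\<tau>\<close> centred at \<open>x\<close>, which does not depend on \<open>d\<close>; after
Cauchy--Schwarz, Tonelli applies.\<close>

lemma axis_displacement_estimate:
  assumes u: "u \<in> L2" and g: "g \<in> L2" "is_weak_gradient u g" and \<phi>: "mollifier \<epsilon> \<phi>"
    and [measurable]: "d \<in> borel_measurable borel" and d: "\<And>x. \<bar>d x\<bar> \<le> \<tau>" and e: "e \<in> Basis" and \<tau>: "0 \<le> \<tau>"
  shows "(\<integral>\<^sup>+x. ennreal ((mollify \<phi> u (x + d x *\<^sub>R e) - mollify \<phi> u x)\<^sup>2) \<partial>lborel) \<le>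
    ennreal (2 * \<tau>\<^sup>2 * (\<integral>x. (norm (g x))\<^sup>2 \<partial>lborel))"
proof -
  have \<phi>': "test_function \<phi>" using \<phi> by (simp add: mollifier_def)
  define v where "v = mollify \<phi> u"
  define D where "D = mollify \<phi> (\<lambda>y. g y \<bullet> e)"
  define A where "A = (\<integral>x. (norm (g x))\<^sup>2 \<partial>lborel)"
  define I :: "real \<Rightarrow> real" where "I = indicator {-\<tau>..\<tau>}"
  have cv: "continuous_on UNIV v" unfolding v_def by (rule continuous_mollify[OF u \<phi>'])
  have cD: "continuous_on UNIV D"
    unfolding D_def by (rule continuous_mollify[OF L2_component[OF g(1)] \<phi>'])
  note [measurable] = borel_measurable_continuous_onI[OF cv] borel_measurable_continuous_onI[OF cD]
  have [measurable]: "I \<in> borel_measurable borel" by (simp add: I_def)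
  have I0: "0 \<le> I s" for s by (simp add: I_def)
  have I1: "(\<integral>\<^sup>+s. ennreal (I s) \<partial>lborel) = ennreal (2 * \<tau>)"
    using \<tau> by (simp add: I_def ennreal_indicator)
  have DA: "(\<integral>\<^sup>+x. ennreal ((D x)\<^sup>2) \<partial>lborel) \<le> ennreal A"
  proof -
    have "(\<integral>\<^sup>+x. ennreal ((D x)\<^sup>2) \<partial>lborel) \<le> (\<integral>\<^sup>+x. ennreal ((g x \<bullet> e)\<^sup>2) \<partial>lborel)"
      unfolding D_def by (rule mollify_L2_bound[OF L2_component[OF g(1)] \<phi>])
    also have "\<dots> \<le> (\<integral>\<^sup>+x. ennreal ((norm (g x))\<^sup>2) \<partial>lborel)"
      using Basis_le_norm[OF e] by (intro nn_integral_mono ennreal_leI) (simp add: abs_le_square_iff[symmetric])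
    also have "\<dots> = ennreal A" by (simp add: nn_integral_L2[OF g(1)] A_def)
    finally show ?thesis .
  qed
  have pw: "ennreal ((v (x + d x *\<^sub>R e) - v x)\<^sup>2) \<le> ennreal \<tau> * (\<integral>\<^sup>+s. ennreal (I s * (D (x + s *\<^sub>R e))\<^sup>2) \<partial>lborel)" for x
  proof -
    define a where "a = min 0 (d x)"
    define b where "b = max 0 (d x)"
    have ab: "a \<le> b" "-\<tau> \<le> a" "b \<le> \<tau>" "b - a \<le> \<tau>" using d[of x] by (auto simp: a_def b_def)
    define w :: "real \<Rightarrow> real" where "w = indicator {a..b}"
    have [measurable]: "w \<in> borel_measurable borel" by (simp add: w_def)
    have "(\<integral>s. D (x + s *\<^sub>R e) * indicator {a..b} s \<partial>lborel) = v (x + b *\<^sub>R e) - v (x + a *\<^sub>R e)"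
    proof (rule integral_FTC_Icc_real[OF ab(1)])
      show "((\<lambda>s. v (x + s *\<^sub>R e)) has_real_derivative D (x + s *\<^sub>R e)) (at s)" for s
        unfolding v_def D_def by (rule mollify_has_derivative[OF u g \<phi>'])
      have "continuous_on UNIV (\<lambda>s. D (x + s *\<^sub>R e))"
        by (rule continuous_on_compose2[OF cD]) (auto intro!: continuous_intros)
      then show "isCont (\<lambda>s. D (x + s *\<^sub>R e)) s" for s
        by (simp add: continuous_on_eq_continuous_at)
    qed
    then have "(v (x + d x *\<^sub>R e) - v x)\<^sup>2 = (\<integral>s. w s * D (x + s *\<^sub>R e) \<partial>lborel)\<^sup>2"
      by (cases "0 \<le> d x") (auto simp: w_def a_def b_def min_def max_def mult.commute power2_commute)
    then have "ennreal ((v (x + d x *\<^sub>R e) - v x)\<^sup>2) \<le>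
        (\<integral>\<^sup>+s. ennreal (w s) \<partial>lborel) * (\<integral>\<^sup>+s. ennreal (w s * (D (x + s *\<^sub>R e))\<^sup>2) \<partial>lborel)"
      using weighted_Cauchy_Schwarz[of "\<lambda>s. D (x + s *\<^sub>R e)" lborel w] by (simp add: w_def)
    also have "\<dots> \<le> ennreal \<tau> * (\<integral>\<^sup>+s. ennreal (I s * (D (x + s *\<^sub>R e))\<^sup>2) \<partial>lborel)"
    proof (rule mult_mono)
      show "(\<integral>\<^sup>+s. ennreal (w s) \<partial>lborel) \<le> ennreal \<tau>"
        using ab by (simp add: w_def ennreal_indicator ennreal_leI)
      show "(\<integral>\<^sup>+s. ennreal (w s * (D (x + s *\<^sub>R e))\<^sup>2) \<partial>lborel) \<le> (\<integral>\<^sup>+s. ennreal (I s * (D (x + s *\<^sub>R e))\<^sup>2) \<partial>lborel)"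
        using ab by (intro nn_integral_mono ennreal_leI mult_right_mono) (auto simp: w_def I_def indicator_def)
    qed auto
    finally show ?thesis .
  qed
  have "(\<integral>\<^sup>+x. ennreal ((v (x + d x *\<^sub>R e) - v x)\<^sup>2) \<partial>lborel) \<le>
      (\<integral>\<^sup>+x. ennreal \<tau> * (\<integral>\<^sup>+s. ennreal (I s * (D (x + s *\<^sub>R e))\<^sup>2) \<partial>lborel) \<partial>lborel)"
    by (rule nn_integral_mono[OF pw])
  also have "\<dots> = ennreal \<tau> * (\<integral>\<^sup>+x. (\<integral>\<^sup>+s. ennreal (I s * (D (x + s *\<^sub>R e))\<^sup>2) \<partial>lborel) \<partial>lborel)"
    by (rule nn_integral_cmult) measurable
  also have "(\<integral>\<^sup>+x. (\<integral>\<^sup>+s. ennreal (I s * (D (x + s *\<^sub>R e))\<^sup>2) \<partial>lborel) \<partial>lborel) =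
      (\<integral>\<^sup>+s. (\<integral>\<^sup>+x. ennreal (I s) * ennreal ((D (x + s *\<^sub>R e))\<^sup>2) \<partial>lborel) \<partial>lborel)"
    by (subst lborel_pair.Fubini') (auto simp: ennreal_mult I0)
  also have "\<dots> = ennreal (2 * \<tau>) * (\<integral>\<^sup>+x. ennreal ((D x)\<^sup>2) \<partial>lborel)"
    by (simp add: nn_integral_cmult nn_integral_translate[where f = "\<lambda>x. ennreal ((D x)\<^sup>2)"] nn_integral_multc I1)
  also have "ennreal \<tau> * (ennreal (2 * \<tau>) * (\<integral>\<^sup>+x. ennreal ((D x)\<^sup>2) \<partial>lborel)) \<le>
      ennreal \<tau> * (ennreal (2 * \<tau>) * ennreal A)"
    by (intro mult_left_mono DA) auto
  also have "\<dots> = ennreal (2 * \<tau>\<^sup>2 * A)"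
    using \<tau> by (simp add: ennreal_mult[symmetric] A_def power2_eq_square mult_ac)
  finally show ?thesis by (simp add: v_def A_def)
qed

text \<open>The stretch \<open>\<psi>\<close> moves \<open>y\<close> along the axis \<open>e\<close> by \<open>t R arctan (y \<bullet> e / R)\<close>, and \<open>\<phi>\<close> is its inverse. The
displacement is bounded by \<open>2 \<bar>t\<bar> R\<close>, so composition with \<open>\<phi>\<close> preserves \<open>X\<close> and changes \<open>u\<close> by
\<open>O(t)\<close> in \<open>L\<^sup>2\<close>. The relative change of length \<open>t * rate\<close> tends to the constant \<open>t\<close> as \<open>R\<close> grows. For
\<open>\<bar>t\<bar> \<le> 1 / 2\<close> the Jacobian \<open>J\<close> lies between \<open>1 / 2\<close> and \<open>3 / 2\<close>.\<close>

locale axis_stretch =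
  fixes R t :: real and e :: "real^2"
  assumes R: "R > 0" and t: "\<bar>t\<bar> \<le> 1 / 2" and e: "e \<in> Basis"
begin

definition rate :: "real \<Rightarrow> real" where
  "rate a = 1 / (1 + (a / R)\<^sup>2)"

definition line_map :: "real \<Rightarrow> real" where
  "line_map a = a + t * R * arctan (a / R)"

definition line_inv :: "real \<Rightarrow> real" where
  "line_inv = inv line_map"

definition J :: "real^2 \<Rightarrow> real" where
  "J y = 1 + t * rate (y \<bullet> e)"

definition \<psi> :: "real^2 \<Rightarrow> real^2" where
  "\<psi> y = y + (line_map (y \<bullet> e) - y \<bullet> e) *\<^sub>R e"

definition \<phi> :: "real^2 \<Rightarrow> real^2" where
  "\<phi> x = x + (line_inv (x \<bullet> e) - x \<bullet> e) *\<^sub>R e"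

lemma e_norm: "e \<bullet> e = 1" "norm e = 1"
  using e by simp_all

lemma rate_bounds: "0 \<le> rate a" "rate a \<le> 1"
  by (auto simp: rate_def divide_le_eq add_pos_nonneg)

lemma t_rate: "\<bar>t * rate a\<bar> \<le> \<bar>t\<bar>"
  using rate_bounds[of a] by (simp add: abs_mult mult_left_le)

lemma J_bounds: "1 / 2 \<le> J y" "J y \<le> 3 / 2" "J y > 0"
  using t_rate[of "y \<bullet> e"] t by (auto simp: J_def)

lemma rate_measurable [measurable]: "rate \<in> borel_measurable borel"
  unfolding rate_def by measurable

lemma J_measurable [measurable]: "J \<in> borel_measurable borel"
  unfolding J_def by measurable

lemma line_map_has_derivative: "(line_map has_real_derivative 1 + t * rate a) (at a)"
proof -
  have "((\<lambda>a. arctan (a / R)) has_real_derivative inverse (1 + (a / R)\<^sup>2) * (1 / R)) (at a)"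
    by (rule DERIV_chain2[OF DERIV_arctan]) (use R in \<open>auto intro!: derivative_eq_intros\<close>)
  then have "((\<lambda>a. a + t * R * arctan (a / R)) has_real_derivative
      1 + t * R * (inverse (1 + (a / R)\<^sup>2) * (1 / R))) (at a)"
    by (intro DERIV_add DERIV_ident DERIV_cmult)
  then show ?thesis
    unfolding line_map_def[abs_def] rate_def using R by (simp add: inverse_eq_divide)
qed

lemma line_map_displacement: "\<bar>line_map a - a\<bar> \<le> 2 * \<bar>t\<bar> * R"
proof -
  have "\<bar>arctan (a / R)\<bar> \<le> 2"
    using arctan_bounded[of "a / R"] pi_half_less_two by auto
  then have "\<bar>t * R\<bar> * \<bar>arctan (a / R)\<bar> \<le> \<bar>t * R\<bar> * 2" by (intro mult_left_mono) auto
  then show ?thesis using R by (simp add: line_map_def abs_mult)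
qed

lemma line_map_strict_mono: "strict_mono line_map"
proof (rule strict_monoI)
  fix a b :: real assume ab: "a < b"
  have "\<exists>y. (line_map has_real_derivative y) (at x) \<and> 0 < y" for x
    using line_map_has_derivative[of x] t_rate[of x] t by (intro exI[of _ "1 + t * rate x"]) auto
  with ab show "line_map a < line_map b" by (rule DERIV_pos_imp_increasing)
qed

lemma line_map_bij: "bij line_map"
proof (rule bijI)
  show "inj line_map" using line_map_strict_mono by (rule strict_mono_imp_inj_on)
  show "surj line_map"
    unfolding surj_def
  proof
    fix b
    define c where "c = 2 * \<bar>t\<bar> * R"
    have "line_map (b - c) \<le> b" "b \<le> line_map (b + c)"
      using line_map_displacement[of "b - c"] line_map_displacement[of "b + c"]
      unfolding c_def by linarith+
    moreover have "b - c \<le> b + c" using R by (simp add: c_def)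
    ultimately show "\<exists>a. b = line_map a"
      using IVT[of line_map "b - c" b "b + c"] DERIV_isCont[OF line_map_has_derivative] by blast
  qed
qed

lemma line_inv: "line_map (line_inv a) = a" "line_inv (line_map a) = a"
  unfolding line_inv_def using line_map_bij by (simp_all add: bij_is_surj surj_f_inv_f bij_is_inj)

lemma line_inv_measurable [measurable]: "line_inv \<in> borel_measurable borel"
proof (rule borel_measurable_mono, rule monoI)
  fix a b :: real assume "a \<le> b"
  then show "line_inv a \<le> line_inv b"
    using line_map_strict_mono line_inv(1) by (metis strict_mono_less_eq)
qed

lemma line_inv_displacement: "\<bar>line_inv a - a\<bar> \<le> 2 * \<bar>t\<bar> * R"
  using line_map_displacement[of "line_inv a"] by (simp add: line_inv abs_minus_commute)

lemma \<psi>_inner_e: "\<psi> y \<bullet> e = line_map (y \<bullet> e)" and \<phi>_inner_e: "\<phi> x \<bullet> e = line_inv (x \<bullet> e)"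
  by (simp_all add: \<psi>_def \<phi>_def inner_add_left e_norm)

lemma \<psi>_\<phi>: "\<psi> (\<phi> x) = x"
proof -
  have "\<psi> (\<phi> x) = \<phi> x + (line_map (line_inv (x \<bullet> e)) - line_inv (x \<bullet> e)) *\<^sub>R e"
    by (simp only: \<psi>_def[of "\<phi> x"] \<phi>_inner_e)
  then show ?thesis by (simp add: line_inv \<phi>_def algebra_simps)
qed

lemma \<phi>_\<psi>: "\<phi> (\<psi> y) = y"
proof -
  have "\<phi> (\<psi> y) = \<psi> y + (line_inv (line_map (y \<bullet> e)) - line_map (y \<bullet> e)) *\<^sub>R e"
    by (simp only: \<phi>_def[of "\<psi> y"] \<psi>_inner_e)
  then show ?thesis by (simp add: line_inv \<psi>_def algebra_simps)
qed

lemma line_map_measurable [measurable]: "line_map \<in> borel_measurable borel"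
  unfolding line_map_def by measurable

lemma \<phi>_measurable [measurable]: "\<phi> \<in> borel_measurable borel"
  unfolding \<phi>_def by measurable

lemma \<psi>_measurable [measurable]: "\<psi> \<in> borel_measurable borel"
  unfolding \<psi>_def by measurable

lemma \<psi>_displacement: "norm (\<psi> y - y) \<le> 2 * \<bar>t\<bar> * R"
  using line_map_displacement[of "y \<bullet> e"] by (simp add: \<psi>_def e_norm)

lemma \<psi>_has_derivative: "(\<psi> has_derivative (\<lambda>v. v + (t * rate (y \<bullet> e) * (v \<bullet> e)) *\<^sub>R e)) (at y)"
proof -
  have "((\<lambda>y. line_map (y \<bullet> e)) has_derivative (\<lambda>v. (1 + t * rate (y \<bullet> e)) * (v \<bullet> e))) (at y)"
  proof -
    have "((\<lambda>y. y \<bullet> e) has_derivative (\<lambda>v. v \<bullet> e)) (at y)" by (auto intro!: derivative_eq_intros)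
    from has_derivative_compose[OF this line_map_has_derivative[unfolded has_field_derivative_def]]
    show ?thesis .
  qed
  then have "(\<psi> has_derivative (\<lambda>v. v + ((1 + t * rate (y \<bullet> e)) * (v \<bullet> e) - v \<bullet> e) *\<^sub>R e)) (at y)"
    unfolding \<psi>_def[abs_def] by (intro derivative_eq_intros | assumption | simp)+
  then show ?thesis by (simp add: algebra_simps)
qed

lemma \<psi>_det: "det (matrix (\<lambda>v. v + (t * rate (y \<bullet> e) * (v \<bullet> e)) *\<^sub>R e)) = J y"
proof -
  have "e = axis 1 1 \<or> e = axis 2 1" using e by (simp add: Basis_real2)
  moreover have "axis i (1::real) $ j = (if j = i then 1 else 0)" for i j :: 2
    by (simp add: axis_def)
  ultimately show ?thesis
    by (auto simp: det_2 matrix_def J_def inner_axis_axis)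
qed

text \<open>The change of variables formula, in the form that also covers nonnegative extended functions. It
suffices to compare the two measures on boxes.\<close>

lemma J_lborel: "distr (density lborel (\<lambda>y. ennreal (J y))) borel \<psi> = lborel"
proof (rule lborel_eqI[symmetric])
  fix l u :: "real^2" assume le: "\<And>b. b \<in> Basis \<Longrightarrow> l \<bullet> b \<le> u \<bullet> b"
  define c where "c = (\<Prod>b\<in>Basis. (u - l) \<bullet> b)"
  have inj: "inj \<psi>" by (metis \<phi>_\<psi> injI)
  have image: "\<psi> ` (\<psi> -` box l u) = box l u" by (metis \<psi>_\<phi> surjI surj_image_vimage_eq)
  have em: "emeasure lborel (box l u) = ennreal c"
    unfolding c_def using le by (rule emeasure_lborel_box)
  have c0: "0 \<le> c" unfolding c_def using le by (intro prod_nonneg) (simp add: inner_diff_left)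
  have "measure lebesgue (box l u) = c"
    using em c0 by (simp add: measure_def)
  moreover have "box l u \<in> lmeasurable" by simp
  moreover have "\<psi> -` box l u \<in> sets lebesgue"
    using measurable_sets_borel[OF \<psi>_measurable, of "box l u"] by auto
  ultimately have "((\<lambda>y. \<bar>det (matrix (\<lambda>v. v + (t * rate (y \<bullet> e) * (v \<bullet> e)) *\<^sub>R e))\<bar>) has_integral c) (\<psi> -` box l u)"
    using has_measure_differentiable_image[OF _ has_derivative_at_withinI[OF \<psi>_has_derivative]
        inj_on_subset[OF inj subset_UNIV], of "\<psi> -` box l u" c]
    unfolding image by blast
  then have "((\<lambda>y. if y \<in> \<psi> -` box l u then J y else 0) has_integral c) UNIV"
    unfolding has_integral_restrict_UNIV \<psi>_det using J_bounds(3) by (simp add: less_imp_le)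
  moreover have "(\<lambda>y. if y \<in> \<psi> -` box l u then J y else 0) = (\<lambda>y. J y * indicator (box l u) (\<psi> y))"
    by (auto simp: indicator_def)
  ultimately have "((\<lambda>y. J y * indicator (box l u) (\<psi> y)) has_integral c) UNIV" by simp
  then have "(\<integral>\<^sup>+y. ennreal (J y * indicator (box l u) (\<psi> y)) \<partial>lborel) = ennreal c"
    by (intro nn_integral_has_integral_lborel) (auto simp: J_bounds less_imp_le)
  moreover have "emeasure (distr (density lborel (\<lambda>y. ennreal (J y))) borel \<psi>) (box l u) =
      (\<integral>\<^sup>+y. ennreal (J y) * indicator (\<psi> -` box l u) y \<partial>lborel)"
    by (subst emeasure_distr) (auto simp: emeasure_density measurable_sets_borel[OF \<psi>_measurable])
  moreover have "ennreal (J y * indicator (box l u) (\<psi> y)) = ennreal (J y) * indicator (\<psi> -` box l u) y" for y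
    by (auto simp: indicator_def)
  ultimately show "emeasure (distr (density lborel (\<lambda>y. ennreal (J y))) borel \<psi>) (box l u) =
      (\<Prod>b\<in>Basis. (u - l) \<bullet> b)"
    by (simp add: c_def)
qed simp

lemma nn_integral_stretch:
  assumes [measurable]: "f \<in> borel_measurable borel"
  shows "(\<integral>\<^sup>+x. f x \<partial>lborel) = (\<integral>\<^sup>+y. ennreal (J y) * f (\<psi> y) \<partial>lborel)"
  by (subst J_lborel[symmetric]) (simp add: nn_integral_distr nn_integral_density)

lemma integral_stretch:
  fixes f :: "real^2 \<Rightarrow> real"
  assumes [measurable]: "f \<in> borel_measurable borel"
  shows "(\<integral>x. f x \<partial>lborel) = (\<integral>y. J y * f (\<psi> y) \<partial>lborel)"
  by (subst J_lborel[symmetric]) (simp add: integral_distr integral_density J_bounds less_imp_le)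

lemma integrable_stretch:
  fixes f :: "real^2 \<Rightarrow> real"
  assumes [measurable]: "f \<in> borel_measurable borel"
  shows "integrable lborel f \<longleftrightarrow> integrable lborel (\<lambda>y. J y * f (\<psi> y))"
  by (subst J_lborel[symmetric]) (simp add: integrable_distr_eq integrable_density J_bounds less_imp_le)

lemma integrable_J_mult:
  fixes f :: "real^2 \<Rightarrow> real"
  assumes "integrable lborel f"
  shows "integrable lborel (\<lambda>y. J y * f y)"
proof (rule Bochner_Integration.integrable_bound)
  show "integrable lborel (\<lambda>y. (3 / 2) * f y)" using assms by simp
  show "(\<lambda>y. J y * f y) \<in> borel_measurable lborel" using assms by measurable
  show "AE y in lborel. norm (J y * f y) \<le> norm ((3 / 2) * f y)"
  proof (rule AE_I2)
    fix y
    have "J y * \<bar>f y\<bar> \<le> 3 / 2 * \<bar>f y\<bar>" by (intro mult_right_mono J_bounds) auto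
    then show "norm (J y * f y) \<le> norm ((3 / 2) * f y)"
      using J_bounds(3)[of y] by (simp add: abs_mult)
  qed
qed

lemma integrable_rate_mult:
  fixes f :: "real^2 \<Rightarrow> real"
  assumes "integrable lborel f"
  shows "integrable lborel (\<lambda>y. rate (y \<bullet> e) * f y)"
proof (rule Bochner_Integration.integrable_bound[OF assms])
  show "(\<lambda>y. rate (y \<bullet> e) * f y) \<in> borel_measurable lborel" using assms by measurable
  show "AE y in lborel. norm (rate (y \<bullet> e) * f y) \<le> norm (f y)"
    using rate_bounds by (intro AE_I2) (auto simp: abs_mult intro!: mult_left_le_one_le)
qed

lemma L2_stretch:
  fixes f :: "real^2 \<Rightarrow> 'b::euclidean_space"
  assumes "f \<in> L2"
  shows "(\<lambda>x. f (\<phi> x)) \<in> L2"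
proof -
  note [measurable] = L2_measurable[OF assms]
  have "integrable lborel (\<lambda>y. J y * (norm (f y))\<^sup>2)"
    using assms by (intro integrable_J_mult) (simp add: L2_def)
  then have "integrable lborel (\<lambda>x. (norm (f (\<phi> x)))\<^sup>2)"
    by (subst integrable_stretch) (simp_all add: \<phi>_\<psi>)
  then show ?thesis by (simp add: L2_def)
qed

subsection \<open>Smoothness of the stretch\<close>

lemma rate_has_derivative: "(rate has_real_derivative - 2 / R\<^sup>2 * a * (rate a * rate a)) (at a)"
proof -
  have "1 + (a / R)\<^sup>2 > 0" by (intro add_pos_nonneg) auto
  then show ?thesis
    unfolding rate_def[abs_def] using R
    by (auto intro!: derivative_eq_intros simp: divide_simps power2_eq_square)
qed

lemma C_diff_rate: "C_diff k (\<lambda>y. rate (y \<bullet> e))"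
proof (induction k)
  case 0
  have "continuous_on UNIV rate"
    unfolding rate_def[abs_def] using R by (intro continuous_intros) (auto simp: add_nonneg_eq_0_iff)
  then show ?case by (auto intro!: continuous_on_compose2[of UNIV rate] continuous_intros)
next
  case (Suc k)
  let ?D = "\<lambda>y h. (- 2 / R\<^sup>2 * (h \<bullet> e)) * ((y \<bullet> e) * (rate (y \<bullet> e) * rate (y \<bullet> e)))"
  have "((\<lambda>y. rate (y \<bullet> e)) has_derivative ?D y) (at y)" for y
  proof -
    have ip: "((\<lambda>y. y \<bullet> e) has_derivative (\<lambda>v. v \<bullet> e)) (at y)" by (auto intro!: derivative_eq_intros)
    from has_derivative_compose[OF ip rate_has_derivative[unfolded has_field_derivative_def]]
    show ?thesis by (simp add: mult_ac)
  qed
  from C_diff_has_derivative[OF this] show ?case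
    by (simp only:) (intro ballI C_diff_mult C_diff_const C_diff_inner Suc.IH)
qed

lemma C_diff_J: "C_diff k J"
  unfolding J_def[abs_def] by (intro C_diff_add C_diff_mult C_diff_const C_diff_rate)

lemma C_diff_\<psi>: "C_diff k (\<lambda>y. \<psi> y \<bullet> j)"
proof (cases k)
  case 0
  have "continuous_on UNIV \<psi>"
    by (intro continuous_at_imp_continuous_on ballI has_derivative_continuous[OF \<psi>_has_derivative])
  with 0 show ?thesis by (auto intro!: continuous_intros)
next
  case (Suc n)
  have "((\<lambda>y. \<psi> y \<bullet> j) has_derivative (\<lambda>v. (v + (t * rate (y \<bullet> e) * (v \<bullet> e)) *\<^sub>R e) \<bullet> j)) (at y)" for y
    by (rule has_derivative_inner_left[OF \<psi>_has_derivative])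
  then have *: "((\<lambda>y. \<psi> y \<bullet> j) has_derivative (\<lambda>v. v \<bullet> j + (t * (v \<bullet> e) * (e \<bullet> j)) * rate (y \<bullet> e))) (at y)" for y
    by (simp add: inner_add_left mult_ac)
  show ?thesis
    unfolding Suc C_diff_has_derivative[OF *]
    by (intro ballI C_diff_add C_diff_mult C_diff_const C_diff_rate)
qed

lemma test_function_\<psi>: "test_function \<eta> \<Longrightarrow> test_function (\<lambda>y. \<eta> (\<psi> y))"
proof (rule test_function_compose[where M = "2 * \<bar>t\<bar> * R" and \<phi> = \<eta> and T = \<psi>])
  show "norm y \<le> norm (\<psi> y) + 2 * \<bar>t\<bar> * R" for y
    using norm_triangle_ineq4[of "\<psi> y" "\<psi> y - y"] \<psi>_displacement[of y] by simp
qed (assumption, rule C_diff_\<psi>)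

end

context axis_stretch
begin

subsection \<open>Stretched functions and their energies\<close>

definition stretched_grad :: "(real^2 \<Rightarrow> real^2) \<Rightarrow> real^2 \<Rightarrow> real^2" where
  "stretched_grad g x = g (\<phi> x) + ((1 / J (\<phi> x) - 1) * (g (\<phi> x) \<bullet> e)) *\<^sub>R e"

lemma stretched_grad_L2:
  assumes "g \<in> L2"
  shows "stretched_grad g \<in> L2"
proof -
  note [measurable] = L2_measurable[OF assms]
  have [measurable]: "stretched_grad g \<in> borel_measurable borel"
    unfolding stretched_grad_def[abs_def] by measurable
  have gL: "(\<lambda>x. g (\<phi> x)) \<in> L2" by (rule L2_stretch[OF assms])
  have "norm (stretched_grad g x) \<le> 2 * norm (g (\<phi> x))" for x
  proof -
    have "\<bar>1 / J (\<phi> x) - 1\<bar> \<le> 1"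
      using J_bounds[of "\<phi> x"] by (auto simp: abs_le_iff divide_le_eq le_divide_eq)
    then have "\<bar>1 / J (\<phi> x) - 1\<bar> * \<bar>g (\<phi> x) \<bullet> e\<bar> \<le> 1 * norm (g (\<phi> x))"
      using Basis_le_norm[OF e] by (intro mult_mono) auto
    then have "norm (((1 / J (\<phi> x) - 1) * (g (\<phi> x) \<bullet> e)) *\<^sub>R e) \<le> norm (g (\<phi> x))"
      by (simp add: e_norm abs_mult)
    then show ?thesis
      unfolding stretched_grad_def
      using norm_triangle_ineq[of "g (\<phi> x)" "((1 / J (\<phi> x) - 1) * (g (\<phi> x) \<bullet> e)) *\<^sub>R e"] by linarith
  qed
  then have le: "(norm (stretched_grad g x))\<^sup>2 \<le> 4 * (norm (g (\<phi> x)))\<^sup>2" for x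
    using power_mono[of "norm (stretched_grad g x)" "2 * norm (g (\<phi> x))" 2] by (simp add: power_mult_distrib)
  have "integrable lborel (\<lambda>x. (norm (stretched_grad g x))\<^sup>2)"
  proof (rule Bochner_Integration.integrable_bound)
    show "integrable lborel (\<lambda>x. 4 * (norm (g (\<phi> x)))\<^sup>2)"
      using gL by (intro integrable_mult_right) (simp add: L2_def)
    show "AE x in lborel. norm ((norm (stretched_grad g x))\<^sup>2) \<le> norm (4 * (norm (g (\<phi> x)))\<^sup>2)"
      by (rule AE_I2) (simp add: le)
  qed measurable
  then show ?thesis by (simp add: L2_def)
qed

text \<open>After the substitution \<open>x = \<psi> y\<close> the derivative falls on \<open>\<eta> \<circ> \<psi>\<close>, which is again a test function because
\<open>\<psi>\<close> is smooth. In the direction \<open>e\<close> the Jacobian is absorbed by the chain rule. In the other direction it is constant and can be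
moved under the derivative.\<close>

lemma stretched_weak_gradient:
  assumes u: "u \<in> L2" and g: "g \<in> L2" "is_weak_gradient u g"
  shows "is_weak_gradient (\<lambda>x. u (\<phi> x)) (stretched_grad g)"
  unfolding is_weak_gradient_def
proof (intro allI impI ballI)
  fix \<eta> :: "real^2 \<Rightarrow> real" and i :: "real^2" assume \<eta>: "test_function \<eta>" and i: "i \<in> Basis"
  note [measurable] = L2_measurable[OF u] L2_measurable[OF g(1)] test_function_measurable[OF \<eta>]
    L2_measurable[OF test_function_derivative_L2[OF \<eta> i]]
  have [measurable]: "stretched_grad g \<in> borel_measurable borel"
    by (rule L2_measurable[OF stretched_grad_L2[OF g(1)]])
  have lhs: "(\<integral>x. u (\<phi> x) * frechet_derivative \<eta> (at x) i \<partial>lborel) =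
      (\<integral>y. u y * (J y * frechet_derivative \<eta> (at (\<psi> y)) i) \<partial>lborel)"
    by (subst integral_stretch) (simp_all add: \<phi>_\<psi> mult.left_commute)
  have rhs: "(\<integral>x. (stretched_grad g x \<bullet> i) * \<eta> x \<partial>lborel) =
      (\<integral>y. J y * ((stretched_grad g (\<psi> y) \<bullet> i) * \<eta> (\<psi> y)) \<partial>lborel)"
    by (subst integral_stretch) simp_all
  have d\<psi>: "((\<lambda>y. \<eta> (\<psi> y)) has_derivative (\<lambda>v. frechet_derivative \<eta> (at (\<psi> y))
      (v + (t * rate (y \<bullet> e) * (v \<bullet> e)) *\<^sub>R e))) (at y)" for y
    by (rule has_derivative_compose[OF \<psi>_has_derivative test_function_has_derivative[OF \<eta>]])
  have lin: "linear (frechet_derivative \<eta> (at x))" for x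
    by (rule has_derivative_linear[OF test_function_has_derivative[OF \<eta>]])
  show "(\<integral>x. u (\<phi> x) * frechet_derivative \<eta> (at x) i \<partial>lborel) =
      - (\<integral>x. (stretched_grad g x \<bullet> i) * \<eta> x \<partial>lborel)"
  proof (cases "i = e")
    case True
    have "frechet_derivative (\<lambda>y. \<eta> (\<psi> y)) (at y) e = J y * frechet_derivative \<eta> (at (\<psi> y)) e" for y
    proof -
      have "frechet_derivative (\<lambda>y. \<eta> (\<psi> y)) (at y) e =
          frechet_derivative \<eta> (at (\<psi> y)) (e + (t * rate (y \<bullet> e)) *\<^sub>R e)"
        using fun_cong[OF frechet_derivative_at[OF d\<psi>[of y]], of e] by (simp only: e_norm(1) mult_1_right)
      also have "e + (t * rate (y \<bullet> e)) *\<^sub>R e = J y *\<^sub>R e" by (simp add: J_def scaleR_add_left)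
      finally show ?thesis by (simp add: linear_cmul[OF lin])
    qed
    then have A: "(\<integral>y. u y * (J y * frechet_derivative \<eta> (at (\<psi> y)) e) \<partial>lborel) =
        - (\<integral>y. (g y \<bullet> e) * \<eta> (\<psi> y) \<partial>lborel)"
      using g(2)[unfolded is_weak_gradient_def, rule_format, OF test_function_\<psi>[OF \<eta>] e] by simp
    have pw: "J y * ((stretched_grad g (\<psi> y) \<bullet> e) * \<eta> (\<psi> y)) = (g y \<bullet> e) * \<eta> (\<psi> y)" for y
      using J_bounds(3)[of y]
      by (simp add: stretched_grad_def \<phi>_\<psi> inner_add_left e_norm field_simps)
    show ?thesis using lhs rhs A by (simp only: True pw)
  next
    case False
    then have ie: "i \<bullet> e = 0" "e \<bullet> i = 0" using i e by (simp_all add: inner_Basis)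
    have J': "(J has_derivative (\<lambda>v. (t * (- 2 / R\<^sup>2 * (y \<bullet> e) * (rate (y \<bullet> e) * rate (y \<bullet> e)))) * (v \<bullet> e))) (at y)" for y
    proof -
      have ip: "((\<lambda>y. y \<bullet> e) has_derivative (\<lambda>v. v \<bullet> e)) (at y)" by (auto intro!: derivative_eq_intros)
      have d: "((\<lambda>a. 1 + t * rate a) has_real_derivative (t * (- 2 / R\<^sup>2 * a * (rate a * rate a)))) (at a)" for a
        using DERIV_add[OF DERIV_const[of 1] DERIV_cmult[OF rate_has_derivative, of t]] by simp
      show ?thesis
        unfolding J_def[abs_def] by (rule has_derivative_compose[OF ip d[unfolded has_field_derivative_def]])
    qed
    have "frechet_derivative (\<lambda>y. J y * \<eta> (\<psi> y)) (at y) i = J y * frechet_derivative \<eta> (at (\<psi> y)) i" for y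
      using fun_cong[OF frechet_derivative_at[OF has_derivative_mult[OF J' d\<psi>]], of y i] ie
      by simp
    moreover have tJ: "test_function (\<lambda>y. J y * \<eta> (\<psi> y))"
      by (rule test_function_mult[OF _ test_function_\<psi>[OF \<eta>]]) (simp only: smooth_def C_diff_J simp_thms)
    ultimately have A: "(\<integral>y. u y * (J y * frechet_derivative \<eta> (at (\<psi> y)) i) \<partial>lborel) =
        - (\<integral>y. (g y \<bullet> i) * (J y * \<eta> (\<psi> y)) \<partial>lborel)"
      using g(2)[unfolded is_weak_gradient_def, rule_format, OF tJ i] by simp
    have pw: "J y * ((stretched_grad g (\<psi> y) \<bullet> i) * \<eta> (\<psi> y)) = (g y \<bullet> i) * (J y * \<eta> (\<psi> y))" for y
      by (simp add: stretched_grad_def \<phi>_\<psi> inner_add_left ie)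
    show ?thesis using lhs rhs A by (simp only: pw)
  qed
qed

text \<open>The logarithmic weight changes by a bounded amount, since
\<open>1 + norm (\<psi> y) \<le> (1 + norm y) (1 + 2 \<bar>t\<bar> R)\<close>.\<close>

lemma stretch_X_fun:
  assumes u: "u \<in> X_fun"
  shows "(\<lambda>x. u (\<phi> x)) \<in> X_fun"
proof -
  note H = X_fun_H1[OF u] and G = weak_grad[OF X_fun_H1[OF u]]
  note [measurable] = X_fun_measurable[OF u]
  have "(\<lambda>x. u (\<phi> x)) \<in> H1"
    by (rule H1I[OF L2_stretch[OF H1_L2[OF H]] stretched_grad_L2[OF G(1)] stretched_weak_gradient[OF H1_L2[OF H] G]])
  moreover have "integrable lborel (\<lambda>x. ln (1 + norm x) * (u (\<phi> x))\<^sup>2)"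
  proof (subst integrable_stretch)
    define C where "C = 2 * \<bar>t\<bar> * R"
    have C: "0 \<le> C" using R by (simp add: C_def)
    have le: "ln (1 + norm (\<psi> y)) \<le> ln (1 + norm y) + ln (1 + C)" for y
    proof -
      have "norm (\<psi> y) \<le> norm y + C"
        using norm_triangle_ineq[of y "\<psi> y - y"] \<psi>_displacement[of y] by (simp add: C_def)
      moreover have "0 \<le> norm y * C" using C by simp
      ultimately have "1 + norm (\<psi> y) \<le> (1 + norm y) * (1 + C)" by (simp add: algebra_simps)
      then have "ln (1 + norm (\<psi> y)) \<le> ln ((1 + norm y) * (1 + C))"
        using C by (subst ln_le_cancel_iff) (auto intro!: add_pos_nonneg mult_pos_pos)
      also have "\<dots> = ln (1 + norm y) + ln (1 + C)"
        using C by (intro ln_mult_pos add_pos_nonneg) auto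
      finally show ?thesis .
    qed
    have int: "integrable lborel (\<lambda>y. J y * (ln (1 + norm y) * (u y)\<^sup>2 + ln (1 + C) * (u y)\<^sup>2))"
      using u H1_L2[OF H] by (intro integrable_J_mult) (auto simp: X_fun_def L2_def)
    show "integrable lborel (\<lambda>y. J y * (ln (1 + norm (\<psi> y)) * (u (\<phi> (\<psi> y)))\<^sup>2))"
    proof (rule Bochner_Integration.integrable_bound[OF int])
      show "AE y in lborel. norm (J y * (ln (1 + norm (\<psi> y)) * (u (\<phi> (\<psi> y)))\<^sup>2)) \<le>
          norm (J y * (ln (1 + norm y) * (u y)\<^sup>2 + ln (1 + C) * (u y)\<^sup>2))"
      proof (rule AE_I2)
        fix y
        have "J y * (ln (1 + norm (\<psi> y)) * (u y)\<^sup>2) \<le> J y * ((ln (1 + norm y) + ln (1 + C)) * (u y)\<^sup>2)"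
          using J_bounds(3)[of y] le[of y] by (intro mult_left_mono mult_right_mono) auto
        moreover have "0 \<le> J y * (ln (1 + norm (\<psi> y)) * (u y)\<^sup>2)"
          using J_bounds(3)[of y] by (intro mult_nonneg_nonneg) auto
        ultimately show "norm (J y * (ln (1 + norm (\<psi> y)) * (u (\<phi> (\<psi> y)))\<^sup>2)) \<le>
          norm (J y * (ln (1 + norm y) * (u y)\<^sup>2 + ln (1 + C) * (u y)\<^sup>2))"
          by (simp only: \<phi>_\<psi> real_norm_def distrib_right)
      qed
    qed measurable
  qed measurable
  ultimately show ?thesis by (simp add: X_fun_def)
qed

lemma norm_stretched_grad:
  "(norm (stretched_grad g (\<psi> y)))\<^sup>2 = (norm (g y))\<^sup>2 + (1 / (J y)\<^sup>2 - 1) * (g y \<bullet> e)\<^sup>2"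
proof -
  define k where "k = (1 / J y - 1) * (g y \<bullet> e)"
  have "(norm (stretched_grad g (\<psi> y)))\<^sup>2 = (g y + k *\<^sub>R e) \<bullet> (g y + k *\<^sub>R e)"
    by (simp add: stretched_grad_def \<phi>_\<psi> k_def power2_norm_eq_inner)
  also have "\<dots> = g y \<bullet> g y + 2 * k * (g y \<bullet> e) + k\<^sup>2"
    by (simp add: inner_add inner_commute[of e "g y"] e_norm power2_eq_square[of k] algebra_simps)
  also have "g y \<bullet> g y = (norm (g y))\<^sup>2" by (rule dot_square_norm)
  also have "(norm (g y))\<^sup>2 + 2 * k * (g y \<bullet> e) + k\<^sup>2 = (norm (g y))\<^sup>2 + (1 / (J y)\<^sup>2 - 1) * (g y \<bullet> e)\<^sup>2"
  proof -
    define c where "c = 1 / J y"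
    have "1 / (J y)\<^sup>2 = c\<^sup>2" by (simp add: c_def power_one_over)
    moreover have "2 * ((c - 1) * x) * x + ((c - 1) * x)\<^sup>2 = (c\<^sup>2 - 1) * x\<^sup>2" for x
      by (simp add: power2_eq_square algebra_simps)
    ultimately have "2 * k * (g y \<bullet> e) + k\<^sup>2 = (1 / (J y)\<^sup>2 - 1) * (g y \<bullet> e)\<^sup>2"
      by (simp only: k_def c_def)
    then show ?thesis by linarith
  qed
  finally show ?thesis .
qed

definition stretch :: "X \<Rightarrow> X" where
  "stretch u = abs_X (\<lambda>x. rep_X u (\<phi> x))"

lemma rep_stretch: "AE x in lborel. rep_X (stretch u) x = rep_X u (\<phi> x)"
  unfolding stretch_def by (rule rep_abs_X[OF stretch_X_fun[OF rep_X_fun]])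

lemma mass_stretch: "mass (stretch u) - mass u = t * (\<integral>y. rate (y \<bullet> e) * (rep_X u y)\<^sup>2 \<partial>lborel)"
proof -
  note [measurable] = rep_X_measurable
  have int: "integrable lborel (\<lambda>y. (rep_X u y)\<^sup>2)"
    using H1_L2[OF rep_X_H1, of u] by (simp add: L2_def)
  have "mass (stretch u) = (\<integral>x. (rep_X u (\<phi> x))\<^sup>2 \<partial>lborel)"
    unfolding mass_rep H1_mass_def using rep_stretch[of u]
    by (intro integral_cong_AE) (auto elim!: eventually_mono)
  also have "\<dots> = (\<integral>y. (rep_X u y)\<^sup>2 + t * (rate (y \<bullet> e) * (rep_X u y)\<^sup>2) \<partial>lborel)"
    by (subst integral_stretch) (simp_all add: \<phi>_\<psi> J_def distrib_right mult.assoc)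
  also have "\<dots> = mass u + t * (\<integral>y. rate (y \<bullet> e) * (rep_X u y)\<^sup>2 \<partial>lborel)"
    using int integrable_rate_mult[OF int] by (simp add: mass_rep H1_mass_def)
  finally show ?thesis by simp
qed

lemma C_fun_stretch:
  assumes "p > 2"
  shows "C_fun p (stretch u) - C_fun p u = t * (\<integral>y. rate (y \<bullet> e) * \<bar>rep_X u y\<bar> powr p \<partial>lborel)"
proof -
  note [measurable] = rep_X_measurable
  note int = C_fun_integrable[OF assms, of u]
  have "C_fun p (stretch u) = (\<integral>x. \<bar>rep_X u (\<phi> x)\<bar> powr p \<partial>lborel)"
    unfolding C_fun_rep using rep_stretch[of u]
    by (intro integral_cong_AE) (auto elim!: eventually_mono)
  also have "\<dots> = (\<integral>y. \<bar>rep_X u y\<bar> powr p + t * (rate (y \<bullet> e) * \<bar>rep_X u y\<bar> powr p) \<partial>lborel)"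
    by (subst integral_stretch) (simp_all add: \<phi>_\<psi> J_def distrib_right mult.assoc)
  also have "\<dots> = C_fun p u + t * (\<integral>y. rate (y \<bullet> e) * \<bar>rep_X u y\<bar> powr p \<partial>lborel)"
    using int integrable_rate_mult[OF int] by (simp add: C_fun_rep)
  finally show ?thesis by simp
qed

text \<open>With \<open>s = t * rate\<close>, the energy density of the stretched function is
\<open>(1 + s) \<bar>g\<bar>\<^sup>2 + (1 / (1 + s) - (1 + s)) (g \<bullet> e)\<^sup>2\<close>, whose part of first order in \<open>s\<close> is \<open>\<bar>g\<bar>\<^sup>2 - 2 (g \<bullet> e)\<^sup>2\<close>; beyond
the first order there is only \<open>s\<^sup>2 / (1 + s)\<close> times \<open>(g \<bullet> e)\<^sup>2\<close>.\<close>

lemma A_fun_stretch: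
  "\<bar>A_fun (stretch u) - A_fun u - t * (\<integral>y. rate (y \<bullet> e) *
      ((norm (weak_grad (rep_X u) y))\<^sup>2 - 2 * (weak_grad (rep_X u) y \<bullet> e)\<^sup>2) \<partial>lborel)\<bar> \<le> 2 * t\<^sup>2 * A_fun u"
proof -
  define g where "g = weak_grad (rep_X u)"
  note uL = H1_L2[OF rep_X_H1, of u] and G = weak_grad[OF rep_X_H1, of u, folded g_def]
  note [measurable] = rep_X_measurable L2_measurable[OF G(1)]
  have [measurable]: "stretched_grad g \<in> borel_measurable borel"
    by (rule L2_measurable[OF stretched_grad_L2[OF G(1)]])
  define s where "s y = t * rate (y \<bullet> e)" for y
  have s: "\<bar>s y\<bar> \<le> \<bar>t\<bar>" "J y = 1 + s y" for y
    using t_rate[of "y \<bullet> e"] by (simp_all add: s_def J_def)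
  have [measurable]: "s \<in> borel_measurable borel" unfolding s_def[abs_def] by measurable
  define E where "E y = (s y)\<^sup>2 / (1 + s y) * (g y \<bullet> e)\<^sup>2" for y
  have ig: "integrable lborel (\<lambda>y. (norm (g y))\<^sup>2)" and ige: "integrable lborel (\<lambda>y. (g y \<bullet> e)\<^sup>2)"
    using G(1) L2_component[OF G(1), of e] by (simp_all add: L2_def)
  define P where "P y = rate (y \<bullet> e) * ((norm (g y))\<^sup>2 - 2 * (g y \<bullet> e)\<^sup>2)" for y
  have iP: "integrable lborel P"
    unfolding P_def by (intro integrable_rate_mult Bochner_Integration.integrable_diff ig integrable_mult_right ige)
  have E: "0 \<le> E y" "E y \<le> 2 * t\<^sup>2 * (norm (g y))\<^sup>2" for y
  proof -
    have J: "1 / 2 \<le> 1 + s y" using J_bounds(1)[of y] s(2) by simp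
    then show "0 \<le> E y" by (simp add: E_def)
    have st: "(s y)\<^sup>2 \<le> t\<^sup>2" using s(1)[of y] by (simp add: abs_le_square_iff[symmetric])
    have "t\<^sup>2 * 1 \<le> t\<^sup>2 * (2 * (1 + s y))" by (rule mult_left_mono) (use J in auto)
    moreover have "t\<^sup>2 * (2 * (1 + s y)) = 2 * t\<^sup>2 * (1 + s y)" by (simp only: mult_ac)
    ultimately have "(s y)\<^sup>2 \<le> 2 * t\<^sup>2 * (1 + s y)" using st by linarith
    then have "(s y)\<^sup>2 / (1 + s y) \<le> 2 * t\<^sup>2"
      using J by (subst pos_divide_le_eq) auto
    moreover have "(g y \<bullet> e)\<^sup>2 \<le> (norm (g y))\<^sup>2"
      using Basis_le_norm[OF e, of "g y"] by (simp add: abs_le_square_iff[symmetric])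
    ultimately show "E y \<le> 2 * t\<^sup>2 * (norm (g y))\<^sup>2"
      unfolding E_def by (intro mult_mono) auto
  qed
  have iE: "integrable lborel E"
  proof (rule Bochner_Integration.integrable_bound)
    show "integrable lborel (\<lambda>y. 2 * t\<^sup>2 * (norm (g y))\<^sup>2)" using ig by simp
    show "AE y in lborel. norm (E y) \<le> norm (2 * t\<^sup>2 * (norm (g y))\<^sup>2)"
      using E by (intro AE_I2) (simp add: abs_of_nonneg)
    show "E \<in> borel_measurable lborel" unfolding E_def[abs_def] by measurable
  qed
  have "weak_grad (rep_X (stretch u)) = weak_grad (\<lambda>x. rep_X u (\<phi> x))"
    by (intro weak_grad_cong rep_stretch H1_L2 rep_X_H1 L2_stretch)
  then have "AE x in lborel. weak_grad (rep_X (stretch u)) x = stretched_grad g x"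
    using weak_grad_eqI[OF L2_stretch[OF uL] stretched_grad_L2[OF G(1)] stretched_weak_gradient[OF uL G]] by simp
  then have "A_fun (stretch u) = (\<integral>x. (norm (stretched_grad g x))\<^sup>2 \<partial>lborel)"
    unfolding A_fun_rep H1_grad_def using weak_grad_rep_measurable
    by (intro integral_cong_AE) (auto elim!: eventually_mono)
  also have "\<dots> = (\<integral>y. J y * (norm (stretched_grad g (\<psi> y)))\<^sup>2 \<partial>lborel)"
    by (rule integral_stretch) measurable
  also have "\<dots> = (\<integral>y. (norm (g y))\<^sup>2 + t * P y + E y \<partial>lborel)"
  proof (rule Bochner_Integration.integral_cong[OF refl])
    fix y
    have J: "1 + s y \<noteq> 0" using J_bounds(3)[of y] s(2)[of y] by simp
    have "J y * (norm (stretched_grad g (\<psi> y)))\<^sup>2 =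
        (1 + s y) * (norm (g y))\<^sup>2 + (1 / (1 + s y) - (1 + s y)) * (g y \<bullet> e)\<^sup>2"
    proof -
      have "q * (N + (1 / q\<^sup>2 - 1) * x) = q * N + (1 / q - q) * x" if "q \<noteq> 0" for q N x :: real
        using that by (simp add: field_simps power2_eq_square)
      from this[OF J] show ?thesis unfolding norm_stretched_grad s(2) .
    qed
    also have "1 / (1 + s y) - (1 + s y) = (s y)\<^sup>2 / (1 + s y) - 2 * s y"
      using J by (simp add: field_simps power2_eq_square)
    finally show "J y * (norm (stretched_grad g (\<psi> y)))\<^sup>2 = (norm (g y))\<^sup>2 + t * P y + E y"
      by (simp add: P_def E_def s_def algebra_simps)
  qed
  also have "\<dots> = A_fun u + t * (\<integral>y. P y \<partial>lborel) + (\<integral>y. E y \<partial>lborel)"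
    using ig iP iE by (simp add: A_fun_rep H1_grad_def g_def)
  finally have eq: "A_fun (stretch u) - A_fun u - t * (\<integral>y. P y \<partial>lborel) = (\<integral>y. E y \<partial>lborel)" by simp
  have "0 \<le> (\<integral>y. E y \<partial>lborel)" by (rule Bochner_Integration.integral_nonneg) (rule E(1))
  moreover have "(\<integral>y. E y \<partial>lborel) \<le> (\<integral>y. 2 * t\<^sup>2 * (norm (g y))\<^sup>2 \<partial>lborel)"
    using ig by (intro integral_mono iE E(2)) simp
  ultimately have "\<bar>\<integral>y. E y \<partial>lborel\<bar> \<le> 2 * t\<^sup>2 * A_fun u"
    by (simp add: A_fun_rep H1_grad_def g_def)
  then show ?thesis unfolding eq[unfolded P_def g_def] .
qed

text \<open>The displacement estimate is available for mollifications. A mollification at the scale \<open>\<tau>\<close> of the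
displacement itself has an error of the same order, before and after composition with \<open>\<phi>\<close>.\<close>

lemma mass_stretch_displacement:
  assumes "t \<noteq> 0"
  shows "mass (stretch u - u) \<le> 80 * R\<^sup>2 * A_fun u * t\<^sup>2"
proof -
  define f where "f = rep_X u"
  define g where "g = weak_grad f"
  define A where "A = (\<integral>x. (norm (g x))\<^sup>2 \<partial>lborel)"
  have A: "0 \<le> A" "A = A_fun u" by (simp_all add: A_def g_def f_def A_fun_rep H1_grad_def)
  have uL: "f \<in> L2" and G: "g \<in> L2" "is_weak_gradient f g"
    unfolding g_def f_def by (rule H1_L2[OF rep_X_H1] weak_grad[OF rep_X_H1])+
  define \<tau> where "\<tau> = 2 * \<bar>t\<bar> * R"
  have \<tau>: "\<tau> > 0" using assms R by (simp add: \<tau>_def)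
  obtain \<rho> where \<rho>: "mollifier \<tau> \<rho>" using mollifier_exists[OF \<tau>] by blast
  have \<rho>': "test_function \<rho>" using \<rho> by (simp add: mollifier_def)
  define v where "v = mollify \<rho> f"
  have cv: "continuous_on UNIV v" unfolding v_def by (rule continuous_mollify[OF uL \<rho>'])
  note [measurable] = borel_measurable_continuous_onI[OF cv] L2_measurable[OF uL]
  define d where "d x = line_inv (x \<bullet> e) - x \<bullet> e" for x
  have [measurable]: "d \<in> borel_measurable borel" unfolding d_def[abs_def] by measurable
  have \<phi>d: "\<phi> x = x + d x *\<^sub>R e" for x by (simp add: \<phi>_def d_def)
  have fv: "(\<integral>\<^sup>+x. ennreal ((v x - f x)\<^sup>2) \<partial>lborel) \<le> ennreal (\<tau>\<^sup>2 * A)"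
    unfolding v_def A_def using \<tau> by (intro mollify_approx[OF uL G \<rho>]) auto
  have vv: "(\<integral>\<^sup>+x. ennreal ((v (\<phi> x) - v x)\<^sup>2) \<partial>lborel) \<le> ennreal (2 * \<tau>\<^sup>2 * A)"
    unfolding v_def A_def \<phi>d
  proof (rule axis_displacement_estimate[OF uL G \<rho>])
    show "\<bar>d x\<bar> \<le> \<tau>" for x using line_inv_displacement[of "x \<bullet> e"] by (simp add: d_def \<tau>_def)
  qed (use e \<tau> in auto)
  have fv\<phi>: "(\<integral>\<^sup>+x. ennreal ((v (\<phi> x) - f (\<phi> x))\<^sup>2) \<partial>lborel) \<le> ennreal (3 / 2) * ennreal (\<tau>\<^sup>2 * A)"
  proof -
    have "(\<integral>\<^sup>+x. ennreal ((v (\<phi> x) - f (\<phi> x))\<^sup>2) \<partial>lborel) =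
        (\<integral>\<^sup>+y. ennreal (J y) * ennreal ((v y - f y)\<^sup>2) \<partial>lborel)"
      by (subst nn_integral_stretch) (simp_all add: \<phi>_\<psi>)
    also have "\<dots> \<le> (\<integral>\<^sup>+y. ennreal (3 / 2) * ennreal ((v y - f y)\<^sup>2) \<partial>lborel)"
      by (intro nn_integral_mono mult_right_mono ennreal_leI J_bounds) auto
    also have "\<dots> = ennreal (3 / 2) * (\<integral>\<^sup>+y. ennreal ((v y - f y)\<^sup>2) \<partial>lborel)"
      by (rule nn_integral_cmult) measurable
    also have "\<dots> \<le> ennreal (3 / 2) * ennreal (\<tau>\<^sup>2 * A)" by (intro mult_left_mono fv) auto
    finally show ?thesis .
  qed
  have "(\<integral>\<^sup>+x. ennreal ((f (\<phi> x) - f x)\<^sup>2) \<partial>lborel) \<le>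
      (\<integral>\<^sup>+x. ennreal 3 * (ennreal ((v (\<phi> x) - f (\<phi> x))\<^sup>2) + ennreal ((v (\<phi> x) - v x)\<^sup>2) + ennreal ((v x - f x)\<^sup>2)) \<partial>lborel)"
  proof (rule nn_integral_mono)
    fix x
    have "(f (\<phi> x) - f x)\<^sup>2 \<le> 3 * ((v (\<phi> x) - f (\<phi> x))\<^sup>2 + (v (\<phi> x) - v x)\<^sup>2 + (v x - f x)\<^sup>2)"
    proof -
      have "(- a + b + c)\<^sup>2 \<le> 3 * (a\<^sup>2 + b\<^sup>2 + c\<^sup>2)" for a b c :: real
      proof -
        have "3 * (a\<^sup>2 + b\<^sup>2 + c\<^sup>2) - (- a + b + c)\<^sup>2 = (a + b)\<^sup>2 + (a + c)\<^sup>2 + (b - c)\<^sup>2"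
          by (simp add: power2_eq_square algebra_simps)
        moreover have "0 \<le> (a + b)\<^sup>2 + (a + c)\<^sup>2 + (b - c)\<^sup>2" by simp
        ultimately show ?thesis by linarith
      qed
      from this[of "v (\<phi> x) - f (\<phi> x)" "v (\<phi> x) - v x" "v x - f x"] show ?thesis by simp
    qed
    then have "ennreal ((f (\<phi> x) - f x)\<^sup>2) \<le>
        ennreal (3 * ((v (\<phi> x) - f (\<phi> x))\<^sup>2 + (v (\<phi> x) - v x)\<^sup>2 + (v x - f x)\<^sup>2))"
      by (rule ennreal_leI)
    then show "ennreal ((f (\<phi> x) - f x)\<^sup>2) \<le>
        ennreal 3 * (ennreal ((v (\<phi> x) - f (\<phi> x))\<^sup>2) + ennreal ((v (\<phi> x) - v x)\<^sup>2) + ennreal ((v x - f x)\<^sup>2))"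
      by (simp only: ennreal_mult'[symmetric] ennreal_plus[symmetric] zero_le_power2 add_nonneg_nonneg)
  qed
  also have "\<dots> = ennreal 3 * ((\<integral>\<^sup>+x. ennreal ((v (\<phi> x) - f (\<phi> x))\<^sup>2) \<partial>lborel) +
      (\<integral>\<^sup>+x. ennreal ((v (\<phi> x) - v x)\<^sup>2) \<partial>lborel) + (\<integral>\<^sup>+x. ennreal ((v x - f x)\<^sup>2) \<partial>lborel))"
    by (simp add: nn_integral_cmult nn_integral_add)
  also have "\<dots> \<le> ennreal 3 * (ennreal (3 / 2) * ennreal (\<tau>\<^sup>2 * A) + ennreal (2 * \<tau>\<^sup>2 * A) + ennreal (\<tau>\<^sup>2 * A))"
    by (intro mult_left_mono add_mono fv vv fv\<phi>) auto
  also have "\<dots> = ennreal (3 * (3 / 2 * (\<tau>\<^sup>2 * A) + 2 * \<tau>\<^sup>2 * A + \<tau>\<^sup>2 * A))"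
  proof -
    have sum: "ennreal 3 * (ennreal a + ennreal b + ennreal c) = ennreal (3 * (a + b + c))"
      if "0 \<le> a" "0 \<le> b" "0 \<le> c" for a b c
      using that by (simp only: ennreal_plus[symmetric] ennreal_mult'[symmetric] add_nonneg_nonneg zero_le_numeral)
    have prod: "ennreal (3 / 2) * ennreal (\<tau>\<^sup>2 * A) = ennreal (3 / 2 * (\<tau>\<^sup>2 * A))"
      by (rule ennreal_mult'[symmetric]) simp
    show ?thesis unfolding prod by (rule sum) (use A(1) in auto)
  qed
  finally have nn: "(\<integral>\<^sup>+x. ennreal ((f (\<phi> x) - f x)\<^sup>2) \<partial>lborel) \<le>
      ennreal (3 * (3 / 2 * (\<tau>\<^sup>2 * A) + 2 * \<tau>\<^sup>2 * A + \<tau>\<^sup>2 * A))" .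
  have "AE x in lborel. rep_X (stretch u - u) x = f (\<phi> x) - f x"
    using rep_stretch[of u] rep_X_add[of "stretch u" "(-1) *\<^sub>R u"] rep_X_scale[of "-1" u]
    by eventually_elim (simp add: f_def)
  then have "(\<integral>\<^sup>+x. ennreal ((rep_X (stretch u - u) x)\<^sup>2) \<partial>lborel) = (\<integral>\<^sup>+x. ennreal ((f (\<phi> x) - f x)\<^sup>2) \<partial>lborel)"
    by (intro nn_integral_cong_AE) (auto elim!: eventually_mono)
  moreover have "(\<integral>\<^sup>+x. ennreal ((rep_X (stretch u - u) x)\<^sup>2) \<partial>lborel) = ennreal (mass (stretch u - u))"
    using nn_integral_L2[OF H1_L2[OF rep_X_H1, of "stretch u - u"]] by (simp add: mass_rep H1_mass_def)
  ultimately have "ennreal (mass (stretch u - u)) \<le> ennreal (3 * (3 / 2 * (\<tau>\<^sup>2 * A) + 2 * \<tau>\<^sup>2 * A + \<tau>\<^sup>2 * A))"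
    using nn by (simp only:)
  moreover have "0 \<le> 3 * (3 / 2 * (\<tau>\<^sup>2 * A) + 2 * \<tau>\<^sup>2 * A + \<tau>\<^sup>2 * A)" using A(1) by simp
  ultimately have "mass (stretch u - u) \<le> 3 * (3 / 2 * (\<tau>\<^sup>2 * A) + 2 * \<tau>\<^sup>2 * A + \<tau>\<^sup>2 * A)"
    by (simp only: ennreal_le_iff)
  also have "\<dots> = 27 / 2 * (\<tau>\<^sup>2 * A)" by simp
  also have "\<dots> \<le> 20 * (\<tau>\<^sup>2 * A)" using A(1) by (intro mult_right_mono) auto
  also have "\<dots> = 80 * R\<^sup>2 * A_fun u * t\<^sup>2"
    by (simp add: \<tau>_def A(2) power_mult_distrib)
  finally show ?thesis .
qed

end

section \<open>The Pohozaev identity at a critical point\<close>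

lemma A_fun_diff_le: "A_fun (U - u) \<le> 2 * A_fun U + 2 * A_fun u"
proof -
  have neg: "A_fun ((-1) *\<^sub>R u) = A_fun u"
    by (simp add: grad_form_self[symmetric] grad_form_scale grad_form_commute[of "_ *\<^sub>R _"] del: scaleR_minus_left scaleR_minus1_left)
  have "U - u = U + (-1) *\<^sub>R u" by simp
  then have "A_fun (U - u) = A_fun U - 2 * grad_form U u + A_fun u"
    by (simp only: A_fun_add grad_form_scale neg)
  moreover have "0 \<le> A_fun U + 2 * grad_form U u + A_fun u"
    using A_fun_nonneg[of "U + u"] by (simp add: A_fun_add)
  ultimately show ?thesis by linarith
qed

lemma zero_if_bounded_by_sqrt:
  fixes B :: real
  assumes "\<And>s. 0 < s \<Longrightarrow> s \<le> 1 / 2 \<Longrightarrow> \<bar>B\<bar> \<le> k * s + l * sqrt s"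
  shows "B = 0"
proof -
  have lim: "((\<lambda>s. k * s + l * sqrt s) \<longlongrightarrow> k * 0 + l * sqrt 0) (at_right 0)"
    by (intro tendsto_intros)
  have "\<forall>\<^sub>F s in at_right (0::real). \<bar>B\<bar> \<le> k * s + l * sqrt s"
    unfolding eventually_at_right_field by (intro exI[of _ "1 / 2"]) (auto intro: assms)
  from tendsto_lowerbound[OF lim this] show ?thesis by simp
qed

text \<open>The derivative at \<open>t = 0\<close> of the density of \<open>A - \<kappa> C - \<mu> mass\<close> along the stretch in the direction \<open>e\<close>,
for a uniform rate of stretching.\<close>

definition energy_density :: "real \<Rightarrow> real \<Rightarrow> real \<Rightarrow> X \<Rightarrow> real^2 \<Rightarrow> real^2 \<Rightarrow> real" where
  "energy_density q \<kappa> \<mu> u e y = (norm (weak_grad (rep_X u) y))\<^sup>2 - 2 * (weak_grad (rep_X u) y \<bullet> e)\<^sup>2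
     - \<kappa> * \<bar>rep_X u y\<bar> powr (q + 2) - \<mu> * (rep_X u y)\<^sup>2"

lemma energy_density_terms_integrable:
  assumes "q > 1"
  shows "integrable lborel (\<lambda>y. (norm (weak_grad (rep_X u) y))\<^sup>2 - 2 * (weak_grad (rep_X u) y \<bullet> e)\<^sup>2)"
    "integrable lborel (\<lambda>y. \<bar>rep_X u y\<bar> powr (q + 2))" "integrable lborel (\<lambda>y. (rep_X u y)\<^sup>2)"
    "integrable lborel (\<lambda>y. (norm (weak_grad (rep_X u) y))\<^sup>2)" "integrable lborel (\<lambda>y. (weak_grad (rep_X u) y \<bullet> e)\<^sup>2)"
proof -
  note g = weak_grad(1)[OF rep_X_H1[of u]]
  show 1: "integrable lborel (\<lambda>y. (norm (weak_grad (rep_X u) y))\<^sup>2)"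
    using g by (simp add: L2_def)
  show 2: "integrable lborel (\<lambda>y. (weak_grad (rep_X u) y \<bullet> e)\<^sup>2)"
    using L2_component[OF g, of e] by (simp add: L2_def)
  show "integrable lborel (\<lambda>y. (norm (weak_grad (rep_X u) y))\<^sup>2 - 2 * (weak_grad (rep_X u) y \<bullet> e)\<^sup>2)"
    by (intro Bochner_Integration.integrable_diff integrable_mult_right 1 2)
  show "integrable lborel (\<lambda>y. \<bar>rep_X u y\<bar> powr (q + 2))"
    using assms by (intro C_fun_integrable) auto
  show "integrable lborel (\<lambda>y. (rep_X u y)\<^sup>2)"
    using H1_L2[OF rep_X_H1[of u]] by (simp add: L2_def)
qed

text \<open>Let \<open>w = stretch u - u\<close> and let \<open>B\<close> be the integral in question. On the one hand
\<open>A - \<kappa> C - \<mu> mass\<close> grows by at most \<open>t B + O(t\<^sup>2)\<close> along the stretch. On the other hand, by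
criticality, it grows by \<open>A w - \<kappa> E - \<mu> * mass w\<close> with \<open>E\<close> the remainder of \<open>C\<close>, which is at least \<open>- O(\<bar>t\<bar>\<^bsup>3 / 2\<^esup>)\<close> because
\<open>A w \<ge> 0\<close>. So \<open>t B\<close> is at least of that order for both signs of \<open>t\<close>, which forces \<open>B = 0\<close>.\<close>

proposition stretched_density_integral_zero:
  assumes q: "q > 1" and crit: "\<And>w. A_deriv u w = \<kappa> * C_deriv q u w + \<mu> * mass_deriv u w"
    and R: "R > 0" and e: "e \<in> Basis"
  shows "(\<integral>y. axis_stretch.rate R (y \<bullet> e) * energy_density q \<kappa> \<mu> u e y \<partial>lborel) = 0" (is "?B = 0")
proof -
  define K0 where "K0 = 80 * R\<^sup>2 * A_fun u"
  define r where "r = max (max (A_fun u) (mass u)) (max (6 * A_fun u) K0)"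
  have K0: "0 \<le> K0" using A_fun_nonneg[of u] by (simp add: K0_def)
  have r: "A_fun u \<le> r" "mass u \<le> r" "6 * A_fun u \<le> r" "K0 \<le> r" "0 \<le> r"
    using A_fun_nonneg[of u] by (auto simp: r_def)
  define k1 where "k1 = (q + 2) * (q + 1) * (remainder_const q r * sqrt (sqrt (6 * A_fun u * K0)) * sqrt K0)"
  have lower: "- (\<bar>t\<bar> * ((2 * A_fun u + \<bar>\<mu>\<bar> * K0) * \<bar>t\<bar> + \<bar>\<kappa>\<bar> * k1 * sqrt \<bar>t\<bar>)) \<le> t * ?B"
    if small: "t \<noteq> 0" "\<bar>t\<bar> \<le> 1 / 2" for t
  proof -
    interpret axis_stretch R t e by unfold_locales (use R e small in auto)
    define U where "U = stretch u"
    define w where "w = U - u"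
    have U: "U = u + w" by (simp add: w_def)
    define P where "P = (\<integral>y. rate (y \<bullet> e) * ((norm (weak_grad (rep_X u) y))\<^sup>2 - 2 * (weak_grad (rep_X u) y \<bullet> e)\<^sup>2) \<partial>lborel)"
    define Cp where "Cp = (\<integral>y. rate (y \<bullet> e) * \<bar>rep_X u y\<bar> powr (q + 2) \<partial>lborel)"
    define M where "M = (\<integral>y. rate (y \<bullet> e) * (rep_X u y)\<^sup>2 \<partial>lborel)"
    note di = energy_density_terms_integrable[OF q, of u]
    have B: "?B = P - \<kappa> * Cp - \<mu> * M"
    proof -
      have "?B = (\<integral>y. rate (y \<bullet> e) * ((norm (weak_grad (rep_X u) y))\<^sup>2 - 2 * (weak_grad (rep_X u) y \<bullet> e)\<^sup>2)
          - \<kappa> * (rate (y \<bullet> e) * \<bar>rep_X u y\<bar> powr (q + 2)) - \<mu> * (rate (y \<bullet> e) * (rep_X u y)\<^sup>2) \<partial>lborel)"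
        by (intro Bochner_Integration.integral_cong refl) (simp add: energy_density_def algebra_simps)
      then show ?thesis
        using integrable_rate_mult[OF di(1)] integrable_rate_mult[OF di(2)] integrable_rate_mult[OF di(3)]
        by (simp add: P_def Cp_def M_def)
    qed
    \<comment> \<open>The next facts bound the gradient energy of \<open>w\<close> uniformly in \<open>t\<close>; smallness comes from \<open>mass w\<close>.\<close>
    have t2: "t\<^sup>2 \<le> 1 / 4" using power_mono[OF small(2), of 2] by (simp add: power2_eq_square)
    have P: "\<bar>P\<bar> \<le> A_fun u"
    proof -
      have "\<bar>P\<bar> \<le> (\<integral>y. \<bar>rate (y \<bullet> e) * ((norm (weak_grad (rep_X u) y))\<^sup>2 - 2 * (weak_grad (rep_X u) y \<bullet> e)\<^sup>2)\<bar> \<partial>lborel)"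
        unfolding P_def by (rule integral_abs_bound)
      also have "\<dots> \<le> (\<integral>y. (norm (weak_grad (rep_X u) y))\<^sup>2 \<partial>lborel)"
      proof (intro integral_mono integrable_abs integrable_rate_mult di)
        fix y
        have "(weak_grad (rep_X u) y \<bullet> e)\<^sup>2 \<le> (norm (weak_grad (rep_X u) y))\<^sup>2"
          using Basis_le_norm[OF e] by (simp add: abs_le_square_iff[symmetric])
        then have "\<bar>(norm (weak_grad (rep_X u) y))\<^sup>2 - 2 * (weak_grad (rep_X u) y \<bullet> e)\<^sup>2\<bar> \<le> (norm (weak_grad (rep_X u) y))\<^sup>2"
          using zero_le_power2[of "weak_grad (rep_X u) y \<bullet> e"] by linarith
        then show "\<bar>rate (y \<bullet> e) * ((norm (weak_grad (rep_X u) y))\<^sup>2 - 2 * (weak_grad (rep_X u) y \<bullet> e)\<^sup>2)\<bar> \<le>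
            (norm (weak_grad (rep_X u) y))\<^sup>2"
          using mult_mono[OF rate_bounds(2)] rate_bounds(1) by (fastforce simp: abs_mult)
      qed
      finally show ?thesis by (simp add: A_fun_rep H1_grad_def)
    qed
    have AU: "A_fun U \<le> A_fun u + t * P + 2 * t\<^sup>2 * A_fun u"
      using A_fun_stretch[of u] by (simp add: U_def P_def abs_le_iff)
    have "t * P \<le> 1 / 2 * A_fun u"
      using mult_mono[OF small(2) P] abs_ge_self[of "t * P"] by (simp add: abs_mult)
    moreover have "t\<^sup>2 * A_fun u \<le> 1 / 4 * A_fun u"
      using t2 by (intro mult_right_mono A_fun_nonneg)
    ultimately have "A_fun U \<le> 2 * A_fun u" using AU by linarith
    then have Aw: "A_fun w \<le> 6 * A_fun u"
      using A_fun_diff_le[of U u] by (simp add: w_def)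
    have mw: "mass w \<le> K0 * t\<^sup>2"
      using mass_stretch_displacement[OF small(1), of u] by (simp add: w_def U_def K0_def)
    have "K0 * t\<^sup>2 \<le> K0 * 1" using t2 K0 by (intro mult_left_mono) auto
    then have rw: "A_fun w \<le> r" "mass w \<le> r" using Aw mw r by linarith+
    define E where "E = C_fun (q + 2) U - C_fun (q + 2) u - C_deriv q u w"
    have E: "\<bar>E\<bar> \<le> k1 * (\<bar>t\<bar> * sqrt \<bar>t\<bar>)"
    proof -
      have "\<bar>E\<bar> \<le> (q + 2) * (q + 1) * (remainder_const q r * sqrt (sqrt (A_fun w * mass w)) * sqrt (mass w))"
        unfolding E_def U C_deriv_apply[OF q] by (rule C_fun_remainder[OF q r(1,2) rw])
      also have "\<dots> \<le> (q + 2) * (q + 1) * (remainder_const q r * sqrt (sqrt (6 * A_fun u * (K0 * t\<^sup>2))) * sqrt (K0 * t\<^sup>2))"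
        using q Aw mw K0 A_fun_nonneg[of w] mass_nonneg[of w] A_fun_nonneg[of u] r(5)
        by (intro mult_left_mono mult_mono real_sqrt_le_mono mult_nonneg_nonneg remainder_const_nonneg real_sqrt_ge_zero) auto
      also have "\<dots> = k1 * (\<bar>t\<bar> * sqrt \<bar>t\<bar>)"
        by (simp add: k1_def real_sqrt_mult mult_ac)
      finally show ?thesis .
    qed
    have "t * ?B + 2 * t\<^sup>2 * A_fun u \<ge> (A_fun U - A_fun u) - \<kappa> * (t * Cp) - \<mu> * (t * M)"
      using AU unfolding B by (simp add: algebra_simps)
    also have "t * Cp = C_fun (q + 2) U - C_fun (q + 2) u"
      using C_fun_stretch[of "q + 2" u] q by (simp add: U_def Cp_def)
    also have "t * M = mass U - mass u"
      using mass_stretch[of u] by (simp add: U_def M_def)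
    also have "(A_fun U - A_fun u) - \<kappa> * (C_fun (q + 2) U - C_fun (q + 2) u) - \<mu> * (mass U - mass u) =
        A_fun w - \<kappa> * E - \<mu> * mass w"
    proof -
      have "A_fun U - A_fun u = A_deriv u w + A_fun w" by (simp add: U A_fun_add A_deriv_apply)
      moreover have "mass U - mass u = mass_deriv u w + mass w" by (simp add: U mass_add mass_deriv_apply)
      moreover have "C_fun (q + 2) U - C_fun (q + 2) u = C_deriv q u w + E" by (simp add: E_def)
      ultimately show ?thesis using crit[of w] by (simp add: algebra_simps)
    qed
    finally have ge: "A_fun w - \<kappa> * E - \<mu> * mass w \<le> t * ?B + 2 * t\<^sup>2 * A_fun u" .
    have "\<kappa> * E \<le> \<bar>\<kappa>\<bar> * (k1 * (\<bar>t\<bar> * sqrt \<bar>t\<bar>))"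
      using abs_ge_self[of "\<kappa> * E"] mult_left_mono[OF E abs_ge_zero[of \<kappa>]] by (simp add: abs_mult)
    moreover have "\<mu> * mass w \<le> \<bar>\<mu>\<bar> * (K0 * t\<^sup>2)"
      using mult_right_mono[OF abs_ge_self[of \<mu>] mass_nonneg[of w]] mult_left_mono[OF mw abs_ge_zero[of \<mu>]]
      by linarith
    ultimately have "- (2 * t\<^sup>2 * A_fun u + \<bar>\<mu>\<bar> * (K0 * t\<^sup>2) + \<bar>\<kappa>\<bar> * (k1 * (\<bar>t\<bar> * sqrt \<bar>t\<bar>))) \<le> t * ?B"
      using ge A_fun_nonneg[of w] by linarith
    moreover have "\<bar>t\<bar> * ((2 * A_fun u + \<bar>\<mu>\<bar> * K0) * \<bar>t\<bar> + \<bar>\<kappa>\<bar> * k1 * sqrt \<bar>t\<bar>) =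
        2 * (\<bar>t\<bar> * \<bar>t\<bar>) * A_fun u + \<bar>\<mu>\<bar> * (K0 * (\<bar>t\<bar> * \<bar>t\<bar>)) + \<bar>\<kappa>\<bar> * (k1 * (\<bar>t\<bar> * sqrt \<bar>t\<bar>))"
      by (simp only: distrib_left distrib_right mult_ac)
    ultimately show ?thesis by (simp only: power2_eq_square abs_mult_self_eq)
  qed
  show ?thesis
  proof (rule zero_if_bounded_by_sqrt)
    fix s :: real assume s: "0 < s" "s \<le> 1 / 2"
    define b where "b = (2 * A_fun u + \<bar>\<mu>\<bar> * K0) * s + \<bar>\<kappa>\<bar> * k1 * sqrt s"
    have "- (s * b) \<le> s * ?B" using lower[of s] s by (simp add: b_def)
    then have "s * (- b) \<le> s * ?B" by simp
    then have 1: "- b \<le> ?B" using s(1) by (simp only: mult_le_cancel_left_pos)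
    have "- (s * b) \<le> - s * ?B" using lower[of "- s"] s by (simp add: b_def)
    then have "s * ?B \<le> s * b" by simp
    then have "?B \<le> b" using s(1) by (simp only: mult_le_cancel_left_pos)
    with 1 show "\<bar>?B\<bar> \<le> (2 * A_fun u + \<bar>\<mu>\<bar> * K0) * s + \<bar>\<kappa>\<bar> * k1 * sqrt s"
      by (simp add: b_def abs_le_iff)
  qed
qed

text \<open>As \<open>R\<close> tends to infinity the weighted integrals converge to the integral of \<open>energy_density\<close>, which
therefore vanishes for both axes. In the sum over the axes, \<open>\<bar>g\<bar>\<^sup>2 - 2 (g \<bullet> e)\<^sup>2\<close> cancels.\<close>

theorem Pohozaev_identity:
  assumes q: "q > 1" and crit: "\<And>w. A_deriv u w = \<kappa> * C_deriv q u w + \<mu> * mass_deriv u w"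
  shows "\<kappa> * C_fun (q + 2) u + \<mu> * mass u = 0"
proof -
  note [measurable] = rep_X_measurable weak_grad_rep_measurable
  note di = energy_density_terms_integrable[OF q, of u]
  have zero: "(\<integral>y. energy_density q \<kappa> \<mu> u e y \<partial>lborel) = 0" if e: "e \<in> Basis" for e
  proof -
    have int: "integrable lborel (energy_density q \<kappa> \<mu> u e)"
      unfolding energy_density_def[abs_def]
      by (intro Bochner_Integration.integrable_diff integrable_mult_right di)
    define \<rho> where "\<rho> n a = axis_stretch.rate (real (Suc n)) a" for n a
    have st: "axis_stretch (real (Suc n)) 0 e" for n
      by unfold_locales (use e in auto)
    have \<rho>: "\<rho> n a = 1 / (1 + (a / real (Suc n))\<^sup>2)" for n a
      unfolding \<rho>_def by (rule axis_stretch.rate_def[OF st])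
    have [measurable]: "\<rho> n \<in> borel_measurable borel" for n
      unfolding \<rho>[abs_def] by measurable
    have "(\<lambda>n. \<integral>y. \<rho> n (y \<bullet> e) * energy_density q \<kappa> \<mu> u e y \<partial>lborel) \<longlonglongrightarrow>
        (\<integral>y. energy_density q \<kappa> \<mu> u e y \<partial>lborel)"
    proof (rule integral_dominated_convergence[OF _ _ integrable_abs[OF int]])
      show "AE y in lborel. (\<lambda>n. \<rho> n (y \<bullet> e) * energy_density q \<kappa> \<mu> u e y) \<longlonglongrightarrow> energy_density q \<kappa> \<mu> u e y"
      proof (rule AE_I2)
        fix y
        have "(\<lambda>n. 1 / (1 + ((y \<bullet> e) * (1 / real (Suc n)))\<^sup>2) * energy_density q \<kappa> \<mu> u e y)
            \<longlonglongrightarrow> 1 / (1 + ((y \<bullet> e) * 0)\<^sup>2) * energy_density q \<kappa> \<mu> u e y"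
          by (intro tendsto_intros LIMSEQ_Suc[OF lim_1_over_n]) simp
        then show "(\<lambda>n. \<rho> n (y \<bullet> e) * energy_density q \<kappa> \<mu> u e y) \<longlonglongrightarrow> energy_density q \<kappa> \<mu> u e y"
          by (simp add: \<rho>)
      qed
      show "AE y in lborel. norm (\<rho> n (y \<bullet> e) * energy_density q \<kappa> \<mu> u e y) \<le> \<bar>energy_density q \<kappa> \<mu> u e y\<bar>" for n
        using axis_stretch.rate_bounds[OF st, of n]
        by (intro AE_I2) (auto simp: abs_mult \<rho>_def intro!: mult_left_le_one_le)
    qed (use int in measurable)
    moreover have "(\<integral>y. \<rho> n (y \<bullet> e) * energy_density q \<kappa> \<mu> u e y \<partial>lborel) = 0" for n
      unfolding \<rho>_def by (rule stretched_density_integral_zero[OF q crit _ e]) simp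
    ultimately show ?thesis by (simp add: LIMSEQ_const_iff)
  qed
  define G where "G e = (\<integral>y. (weak_grad (rep_X u) y \<bullet> e)\<^sup>2 \<partial>lborel)" for e
  have eq: "A_fun u - 2 * G e - \<kappa> * C_fun (q + 2) u - \<mu> * mass u = 0" if "e \<in> Basis" for e
    using zero[OF that] di
    by (simp add: energy_density_def G_def A_fun_rep H1_grad_def C_fun_rep mass_rep H1_mass_def)
  have "A_fun u = (\<integral>y. (weak_grad (rep_X u) y \<bullet> e1)\<^sup>2 + (weak_grad (rep_X u) y \<bullet> e2)\<^sup>2 \<partial>lborel)"
    unfolding A_fun_rep H1_grad_def power2_norm_eq_inner
    by (subst euclidean_inner) (simp add: Basis_real2 e1_neq_e2 power2_eq_square)
  then have "A_fun u = G e1 + G e2" using di(5) by (simp add: G_def)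
  with eq[of e1] eq[of e2] show ?thesis by (simp add: Basis_real2)
qed

section \<open>Critical points on the constraint have large mass\<close>

lemma C_fun_pos:
  assumes "p > 2" "mass u > 0"
  shows "C_fun p u > 0"
proof -
  have "0 \<le> C_fun p u" unfolding C_fun_rep by (rule Bochner_Integration.integral_nonneg) simp
  moreover have "C_fun p u \<noteq> 0"
  proof
    assume "C_fun p u = 0"
    then have "AE x in lborel. \<bar>rep_X u x\<bar> powr p = 0"
      unfolding C_fun_rep by (subst (asm) integral_nonneg_eq_0_iff_AE[OF C_fun_integrable[OF assms(1)]]) auto
    then have "AE x in lborel. (rep_X u x)\<^sup>2 = 0" by eventually_elim simp
    then have "mass u = 0" unfolding mass_rep H1_mass_def by (rule integral_eq_zero_AE)
    with assms(2) show False by simp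
  qed
  ultimately show ?thesis by linarith
qed

text \<open>The set of admissible constants is nonempty by \<open>Gagliardo_Nirenberg\<close>, and each of its elements
bounds the quotient of \<open>u\<close>, so its infimum does as well.\<close>

lemma K_GN_lower_bound:
  assumes p: "p > 2" and pos: "A_fun u > 0" "mass u > 0"
  shows "C_fun p u / (A_fun u powr ((p - 2) / 2) * mass u) \<le> K_GN p"
  unfolding K_GN_def
proof (rule cInf_greatest)
  have sq: "sqrt A powr (p - 2) = A powr ((p - 2) / 2)" if "0 \<le> A" for A
    using that by (simp add: powr_half_sqrt[symmetric] powr_powr)
  show "{K. \<forall>u\<in>H1. integrable lborel (\<lambda>x. \<bar>u x\<bar> powr p) \<and>
     (\<integral>x. \<bar>u x\<bar> powr p \<partial>lborel) \<le>
       K * sqrt (\<integral>x. (norm (weak_grad u x))\<^sup>2 \<partial>lborel) powr (p - 2) * (sqrt (\<integral>x. (u x)\<^sup>2 \<partial>lborel))\<^sup>2} \<noteq> {}"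
    using Gagliardo_Nirenberg[OF _ p] by (auto simp: sq intro!: exI[of _ "GN_bound p"])
  fix K assume "K \<in> {K. \<forall>u\<in>H1. integrable lborel (\<lambda>x. \<bar>u x\<bar> powr p) \<and>
     (\<integral>x. \<bar>u x\<bar> powr p \<partial>lborel) \<le>
       K * sqrt (\<integral>x. (norm (weak_grad u x))\<^sup>2 \<partial>lborel) powr (p - 2) * (sqrt (\<integral>x. (u x)\<^sup>2 \<partial>lborel))\<^sup>2}"
  then have "C_fun p u \<le> K * sqrt (A_fun u) powr (p - 2) * (sqrt (mass u))\<^sup>2"
    using rep_X_H1[of u] by (simp add: C_fun_rep A_fun_rep H1_grad_def mass_rep H1_mass_def)
  then have "C_fun p u \<le> K * (A_fun u powr ((p - 2) / 2) * mass u)"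
    using pos by (simp add: sq mult.assoc)
  then show "C_fun p u / (A_fun u powr ((p - 2) / 2) * mass u) \<le> K"
    using pos by (subst pos_divide_le_eq) auto
qed

text \<open>The criticality relation and \<open>Q u = 0\<close> are two linear equations that determine \<open>A\<close> and \<open>C\<close>. With
\<open>s = (p - 4) / 2\<close> the Gagliardo--Nirenberg inequality becomes a lower bound for \<open>(c / 2)\<^bsup>p - 3\<^esup>\<close>, and this bound is
\<open>(c0 / 2)\<^bsup>p - 3\<^esup>\<close>.\<close>

proposition critical_mass_bound:
  assumes a: "a > 0" and \<gamma>: "\<gamma> > 0" and p: "p > 4" and c: "c > 0" and u: "u \<in> Lam \<gamma> a p c"
    and crit: "2 * A_fun u = a * ((p - 2)\<^sup>2 / p) * C_fun p u"
  shows "c0 \<gamma> a p \<le> c"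
proof -
  define A where "A = A_fun u"
  define C where "C = C_fun p u"
  define K where "K = K_GN p"
  define s where "s = (p - 4) / 2"
  have m: "mass u = c" using u by (simp add: Lam_def S_def)
  have Q: "A - a * ((p - 2) / p) * C - \<gamma> * (c\<^sup>2 / 4) = 0"
    using u by (simp add: Lam_def Q_fun_def A_def C_def)
  have C: "C > 0" unfolding C_def using p c m by (intro C_fun_pos) auto
  have AC: "C = 2 * p / (a * (p - 2)\<^sup>2) * A"
    using crit a p by (simp add: A_def C_def field_simps)
  have "a * ((p - 2) / p) * C = 2 / (p - 2) * A"
  proof -
    have "a * (x / p) * (2 * p / (a * x\<^sup>2) * A) = 2 / x * A" if "x > 0" for x
      using that a p by (simp add: field_simps power2_eq_square)
    from this[of "p - 2"] show ?thesis unfolding AC using p by simp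
  qed
  with Q have "A - 2 / (p - 2) * A = \<gamma> * (c / 2)\<^sup>2" by (simp add: power_divide)
  then have A: "A = (p - 2) / (p - 4) * \<gamma> * (c / 2)\<^sup>2"
    using p by (simp add: field_simps)
  have Apos: "A > 0" unfolding A using p \<gamma> c by simp
  have "C / (A powr ((p - 2) / 2) * c) \<le> K"
    using K_GN_lower_bound[of p u] p c Apos m by (simp add: A_def C_def K_def)
  moreover have "A powr ((p - 2) / 2) = A powr s * A"
    using Apos powr_add[of A s 1] by (simp add: s_def field_simps)
  ultimately have GN: "2 * p / (a * (p - 2)\<^sup>2) / (A powr s * c) \<le> K"
    unfolding AC using Apos by (simp add: mult.assoc)
  have As: "A powr s = (p - 2) powr s / (p - 4) powr s * \<gamma> powr s * (c / 2) powr (p - 4)"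
  proof -
    have "((c / 2)\<^sup>2) powr s = (c / 2) powr (p - 4)"
    proof -
      have "(c / 2)\<^sup>2 = (c / 2) powr 2" using c by (simp add: powr_numeral)
      then have "((c / 2)\<^sup>2) powr s = (c / 2) powr (2 * s)" by (simp only: powr_powr)
      moreover have "2 * s = p - 4" by (simp add: s_def field_simps)
      ultimately show ?thesis by (simp only:)
    qed
    then show ?thesis unfolding A using p \<gamma> c by (simp add: powr_mult powr_divide)
  qed
  define D where "D = a * \<gamma> powr s * (p - 2) powr (p / 2)"
  have D: "D > 0" using a \<gamma> p by (simp add: D_def)
  have "(p - 2) powr (p / 2) = (p - 2) powr s * (p - 2)\<^sup>2"
    using p powr_add[of "p - 2" s 2] by (simp add: s_def field_simps powr_numeral)
  then have "2 * p / (a * (p - 2)\<^sup>2) / (A powr s * c) =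
      (p * (p - 4) powr s / D) / (c / 2) powr (p - 3)"
  proof -
    assume e: "(p - 2) powr (p / 2) = (p - 2) powr s * (p - 2)\<^sup>2"
    have "(c / 2) powr (p - 3) = (c / 2) powr (p - 4) * (c / 2)"
      using c powr_add[of "c / 2" "p - 4" 1] by simp
    then show ?thesis
      unfolding As D_def e using a p c \<gamma> by (simp add: field_simps)
  qed
  with GN have K1: "(p * (p - 4) powr s / D) / (c / 2) powr (p - 3) \<le> K" by simp
  have num: "p * (p - 4) powr s / D > 0" using p D by simp
  have cp: "(c / 2) powr (p - 3) > 0" using c by simp
  have Kpos: "K > 0" using K1 num cp by (meson divide_pos_pos less_le_trans)
  have X: "(p * (p - 4) powr ((p - 4) / 2) / (p - 2) powr (p / 2)) * (1 / (a * \<gamma> powr ((p - 4) / 2) * K_GN p)) =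
      p * (p - 4) powr s / D / K"
    by (simp add: D_def K_def s_def mult_ac)
  have "p * (p - 4) powr s / D / K \<le> (c / 2) powr (p - 3)"
  proof -
    have "p * (p - 4) powr s / D \<le> K * (c / 2) powr (p - 3)"
      using K1 by (simp only: pos_divide_le_eq[OF cp])
    then show ?thesis by (simp only: pos_divide_le_eq[OF Kpos] mult.commute[of K])
  qed
  then have "(p * (p - 4) powr s / D / K) powr (1 / (p - 3)) \<le> ((c / 2) powr (p - 3)) powr (1 / (p - 3))"
    using p divide_pos_pos[OF num Kpos] by (intro powr_mono2) (auto simp: less_imp_le)
  also have "\<dots> = c / 2" using p c by (simp add: powr_powr)
  finally show ?thesis unfolding c0_def X by simp
qed

section \<open>Codimension of preimages\<close>

text \<open>A complement of \<open>W0\<close> in \<open>W1\<close> is transported by the right inverse \<open>R\<close> of \<open>L\<close>.\<close>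

lemma has_codim_vimage:
  fixes L :: "'a::real_vector \<Rightarrow> 'b::real_vector"
  assumes L: "linear L" and R: "linear R" "\<And>t. L (R t) = t" and W: "has_codim W0 W1 k"
  shows "has_codim {x. L x \<in> W0} {x. L x \<in> W1} k"
proof -
  from W obtain B where s: "subspace W0" "subspace W1" "W0 \<subseteq> W1"
    and B: "finite B" "card B = k" "independent B" "W0 \<inter> span B = {0}"
      "W1 = {x + y | x y. x \<in> W0 \<and> y \<in> span B}"
    unfolding has_codim_def by blast
  have inj: "inj R" by (metis R(2) injI)
  have sub: "subspace {x. L x \<in> W}" if "subspace W" for W
    using linear_subspace_vimage[OF L that] by (simp add: vimage_def)
  have span: "span (R ` B) = R ` span B" by (rule linear_span_image[OF R(1)])
  have "{x. L x \<in> W0} \<inter> span (R ` B) = {0}"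
  proof -
    have "x = 0" if x: "L x \<in> W0" "x \<in> R ` span B" for x
    proof -
      from x(2) obtain b where b: "b \<in> span B" "x = R b" by blast
      then have "b = 0" using x(1) B(4) R(2) by auto
      then show ?thesis using b linear_0[OF R(1)] by simp
    qed
    moreover have "0 \<in> R ` span B" using span_zero linear_0[OF R(1)] by (metis imageI)
    ultimately show ?thesis
      using subspace_0[OF s(1)] linear_0[OF L] unfolding span by auto
  qed
  moreover have "{x. L x \<in> W1} = {x + y | x y. x \<in> {x. L x \<in> W0} \<and> y \<in> span (R ` B)}"
  proof (intro equalityI subsetI)
    fix x assume "x \<in> {x. L x \<in> W1}"
    then obtain w b where wb: "w \<in> W0" "b \<in> span B" "L x = w + b" unfolding B(5) by blast
    have "L (x - R b) = w" by (simp add: linear_diff[OF L] R(2) wb(3))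
    then show "x \<in> {x + y | x y. x \<in> {x. L x \<in> W0} \<and> y \<in> span (R ` B)}"
      using wb unfolding span
      by (intro CollectI exI[of _ "x - R b"] exI[of _ "R b"]) auto
  next
    fix x assume "x \<in> {x + y | x y. x \<in> {x. L x \<in> W0} \<and> y \<in> span (R ` B)}"
    then obtain v b where "L v \<in> W0" "b \<in> span B" "x = v + R b" unfolding span by blast
    then show "x \<in> {x. L x \<in> W1}" by (auto simp: B(5) linear_add[OF L] R(2))
  qed
  moreover have "independent (R ` B)"
    by (rule linear_independent_injective_image[OF R(1) B(3) inj_on_subset[OF inj subset_UNIV]])
  moreover have "card (R ` B) = k" using B(2) inj by (simp add: card_image inj_on_subset)
  ultimately show ?thesis
    unfolding has_codim_def using s(3) B(1) sub[OF s(1)] sub[OF s(2)]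
    by (intro conjI exI[of _ "R ` B"] finite_imageI) blast+
qed

lemma has_codim_zero_UNIV: "has_codim {0} (UNIV :: 'a::euclidean_space set) DIM('a)"
  unfolding has_codim_def
  by (intro conjI exI[of _ Basis]) (auto simp: independent_Basis span_Basis)

lemma has_codim_zero_line: "has_codim {0} ({0} \<times> (UNIV :: real set) :: (real \<times> real) set) 1"
proof -
  have span: "span {(0, 1) :: real \<times> real} = {0} \<times> UNIV"
    by (auto simp: span_singleton image_iff)
  have "subspace ({0} \<times> UNIV :: (real \<times> real) set)" by (metis span subspace_span)
  moreover have "{0} \<inter> ({0} \<times> UNIV) = {0 :: real \<times> real}"
    and "{0} \<times> UNIV = {x + y | x y. x \<in> {0 :: real \<times> real} \<and> y \<in> {0} \<times> UNIV}"
    by (auto simp: zero_prod_def)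
  moreover have "independent {(0, 1) :: real \<times> real}" by (simp add: zero_prod_def)
  moreover have "{0 :: real \<times> real} \<subseteq> {0} \<times> UNIV" by (auto simp: zero_prod_def)
  ultimately show ?thesis
    unfolding has_codim_def span[symmetric]
    by (intro conjI exI[of _ "{(0, 1)}"]) simp_all
qed

section \<open>The constraint sets as submanifolds\<close>

lemma mass_deriv_self: "mass_deriv u u = 2 * mass u"
  by (simp add: mass_deriv_apply mass_form_self)

lemma C1_submanifold_S:
  assumes "c > 0"
  shows "C1_submanifold 1 (S c)"
  unfolding C1_submanifold_def
proof
  fix u0 assume "u0 \<in> S c"
  then have m: "mass u0 = c" by (simp add: S_def)
  define R where "R t = t *\<^sub>R (1 / (2 * c)) *\<^sub>R u0" for t :: real
  have R: "bounded_linear R" unfolding R_def by (rule bounded_linear_scaleR_left)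
  have LR: "mass_deriv u0 (R t) = t" for t
    using assms by (simp add: R_def blinfun.scaleR_right mass_deriv_self m)
  have dF: "((\<lambda>u. mass u - c) has_derivative mass_deriv u) (at u)" for u
    by (auto intro!: derivative_eq_intros mass_C1(1))
  define \<Phi> where "\<Phi> u = u + R ((mass u - c) - mass_deriv u0 u)" for u
  obtain U V where UV: "u0 \<in> U" "C1_diffeo U V \<Phi>"
    using C1_diffeo_straightening_map[OF dF mass_C1(2) R, of u0] unfolding \<Phi>_def by blast
  have "mass_deriv u0 (\<Phi> u) = mass u - c" for u
    by (simp add: \<Phi>_def blinfun.add_right LR)
  then have "straightens \<Phi> U V {u. mass u - c \<in> {0}} {x. mass_deriv u0 x \<in> {0}}"
    by (intro C1_diffeo_straightens_level_set UV) auto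
  moreover have "{u. mass u - c \<in> {0}} = S c" by (auto simp: S_def)
  moreover have "has_codim {x. mass_deriv u0 x \<in> {0}} {x. mass_deriv u0 x \<in> UNIV} 1"
    using has_codim_zero_UNIV[where 'a = real]
    by (intro has_codim_vimage[OF _ bounded_linear.linear[OF R] LR])
      (auto intro: bounded_linear.linear blinfun.bounded_linear_right)
  ultimately show "\<exists>\<Phi> U V E. u0 \<in> U \<and> straightens \<Phi> U V (S c) E \<and> has_codim E UNIV 1"
    using UV(1) by auto
qed

definition Q_deriv :: "real \<Rightarrow> real \<Rightarrow> X \<Rightarrow> X \<Rightarrow>\<^sub>L real" where
  "Q_deriv a p u = A_deriv u - (a * ((p - 2) / p)) *\<^sub>R C_deriv (p - 2) u"

lemma Q_fun_C1:
  assumes "p > 4"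
  shows "(Q_fun \<gamma> a p c has_derivative Q_deriv a p u) (at u)" "continuous_on UNIV (Q_deriv a p)"
proof -
  have q: "p - 2 > 1" using assms by simp
  note C = C_fun_C1[OF q, simplified]
  show "(Q_fun \<gamma> a p c has_derivative Q_deriv a p u) (at u)"
  proof -
    have "((\<lambda>u. A_fun u - a * ((p - 2) / p) * C_fun p u - \<gamma> * (c\<^sup>2 / 4)) has_derivative
        (\<lambda>v. A_deriv u v - a * ((p - 2) / p) * C_deriv (p - 2) u v - 0)) (at u)"
      by (intro has_derivative_diff has_derivative_mult_right has_derivative_const A_fun_C1(1) C(1))
    moreover have "blinfun_apply (Q_deriv a p u) = (\<lambda>v. A_deriv u v - a * ((p - 2) / p) * C_deriv (p - 2) u v - 0)"
      by (rule ext) (simp add: Q_deriv_def blinfun.diff_left blinfun.scaleR_left)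
    ultimately show ?thesis by (simp only: Q_fun_def[abs_def])
  qed
  show "continuous_on UNIV (Q_deriv a p)"
    unfolding Q_deriv_def[abs_def]
    by (intro continuous_on_diff continuous_on_scaleR continuous_on_const A_fun_C1(2) C(2))
qed

text \<open>If every \<open>v\<close> with \<open>mass_deriv u v = 0\<close> also satisfied \<open>Q_deriv a p u v = 0\<close>, then \<open>Q_deriv a p u\<close> would be a multiple of
\<open>mass_deriv u\<close>, the Pohozaev identity would hold, and \<open>critical_mass_bound\<close> would give \<open>c0 \<le> c\<close>.\<close>

proposition constraints_transversal:
  assumes "\<gamma> > 0" "a > 0" "p > 4" "0 < c" "c < c0 \<gamma> a p" and u: "u \<in> Lam \<gamma> a p c"
  obtains v where "mass_deriv u v = 0" "Q_deriv a p u v \<noteq> 0"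
proof -
  have m: "mass u = c" using u by (simp add: Lam_def S_def)
  have mu: "mass_deriv u u = 2 * c" by (simp add: mass_deriv_self m)
  define \<mu> where "\<mu> = Q_deriv a p u u / mass_deriv u u"
  define \<kappa> where "\<kappa> = a * ((p - 2) / p)"
  have q: "p - 2 > 1" using assms by simp
  have "\<exists>w. Q_deriv a p u w \<noteq> \<mu> * mass_deriv u w"
  proof (rule ccontr)
    assume "\<not> ?thesis"
    then have crit: "A_deriv u w = \<kappa> * C_deriv (p - 2) u w + \<mu> * mass_deriv u w" for w
      by (simp add: Q_deriv_def \<kappa>_def blinfun.diff_left blinfun.scaleR_left algebra_simps)
    have "\<kappa> * C_fun p u + \<mu> * mass u = 0"
      using Pohozaev_identity[OF q crit] by simp
    moreover have "2 * A_fun u = \<kappa> * (p * C_fun p u) + \<mu> * (2 * mass u)"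
      using crit[of u] by (simp add: A_deriv_apply grad_form_self C_deriv_apply[OF q] power_form_self mass_deriv_self)
    ultimately have "2 * A_fun u = \<kappa> * (p - 2) * C_fun p u" by (simp add: algebra_simps)
    then have "2 * A_fun u = a * ((p - 2)\<^sup>2 / p) * C_fun p u"
      by (simp add: \<kappa>_def power2_eq_square)
    from critical_mass_bound[OF assms(2,1,3,4) u this] assms(5) show False by simp
  qed
  then obtain w where w: "Q_deriv a p u w \<noteq> \<mu> * mass_deriv u w" by blast
  define v where "v = w - (mass_deriv u w / mass_deriv u u) *\<^sub>R u"
  have "mass_deriv u v = 0" using mu assms(4) by (simp add: v_def blinfun.diff_right blinfun.scaleR_right)
  moreover have "Q_deriv a p u v \<noteq> 0"
    using w by (simp add: v_def blinfun.diff_right blinfun.scaleR_right \<mu>_def mult.commute)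
  ultimately show ?thesis by (rule that)
qed

definition constraint_deriv :: "real \<Rightarrow> real \<Rightarrow> X \<Rightarrow> X \<Rightarrow>\<^sub>L (real \<times> real)" where
  "constraint_deriv a p u =
     (Blinfun (\<lambda>s. (s, 0)) o\<^sub>L mass_deriv u) + (Blinfun (\<lambda>s. (0, s)) o\<^sub>L Q_deriv a p u)"

lemma constraint_deriv_apply: "constraint_deriv a p u v = (mass_deriv u v, Q_deriv a p u v)"
proof -
  have "bounded_linear (\<lambda>s::real. (s, 0::real))" "bounded_linear (\<lambda>s::real. (0::real, s))"
    by (intro bounded_linear_Pair bounded_linear_ident bounded_linear_zero)+
  then show ?thesis
    by (simp add: constraint_deriv_def blinfun.add_left bounded_linear_Blinfun_apply)
qed

theorem lemma3p8:
  fixes \<gamma> a p c :: real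
  assumes "\<gamma> > 0" and "a > 0" and "p > 4"
    and "0 < c" and "c < c0 \<gamma> a p"
  shows "C1_submanifold 2 (Lam \<gamma> a p c) \<and> C1_submanifold_in 1 (S c) (Lam \<gamma> a p c)"
proof -
  let ?W = "{0} \<times> UNIV :: (real \<times> real) set"
  define F where "F u = (mass u - c, Q_fun \<gamma> a p c u)" for u
  have dF: "(F has_derivative constraint_deriv a p u) (at u)" for u
    unfolding F_def[abs_def] constraint_deriv_apply
    by (intro has_derivative_Pair Q_fun_C1(1) assms(3)) (auto intro!: derivative_eq_intros mass_C1(1))
  have cF: "continuous_on UNIV (constraint_deriv a p)"
    unfolding constraint_deriv_def[abs_def]
    by (intro continuous_intros bounded_bilinear.continuous_on[OF bounded_bilinear_blinfun_compose]
        mass_C1(2) Q_fun_C1(2) assms(3))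
  have Lam: "Lam \<gamma> a p c = {u. F u \<in> {0}}" by (auto simp: Lam_def S_def F_def zero_prod_def)
  have S: "S c = {u. F u \<in> ?W}" by (auto simp: S_def F_def)
  have subspace: "subspace ?W" using has_codim_zero_line by (simp add: has_codim_def)
  have chart: "\<exists>\<Phi> U V E F. u0 \<in> U \<and> straightens \<Phi> U V (S c) E \<and> straightens \<Phi> U V (Lam \<gamma> a p c) F \<and>
      has_codim F E 1 \<and> has_codim F UNIV 2" if u0: "u0 \<in> Lam \<gamma> a p c" for u0
  proof -
    let ?L = "constraint_deriv a p u0"
    obtain v where v: "mass_deriv u0 v = 0" "Q_deriv a p u0 v \<noteq> 0"
      using constraints_transversal[OF assms u0] by blast
    have mu: "mass_deriv u0 u0 = 2 * c" using u0 by (simp add: mass_deriv_self Lam_def S_def)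
    \<comment> \<open>A basis dual to the two differentials, which spans a complement of the kernel of \<open>?L\<close>.\<close>
    define v2 where "v2 = (1 / Q_deriv a p u0 v) *\<^sub>R v"
    define v1 where "v1 = (1 / (2 * c)) *\<^sub>R u0 - (Q_deriv a p u0 u0 / (2 * c)) *\<^sub>R v2"
    have v2: "mass_deriv u0 v2 = 0" "Q_deriv a p u0 v2 = 1"
      using v by (simp_all add: v2_def blinfun.scaleR_right)
    have v1: "mass_deriv u0 v1 = 1" "Q_deriv a p u0 v1 = 0"
      using v2 mu assms(4) by (simp_all add: v1_def blinfun.scaleR_right blinfun.diff_right)
    define R where "R z = fst z *\<^sub>R v1 + snd z *\<^sub>R v2" for z :: "real \<times> real"
    have R: "bounded_linear R"
      unfolding R_def[abs_def]
      by (intro bounded_linear_add bounded_linear_compose[OF bounded_linear_scaleR_left]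
          bounded_linear_fst bounded_linear_snd)
    have LR: "?L (R z) = z" for z
      by (simp add: R_def constraint_deriv_apply blinfun.add_right blinfun.scaleR_right v1 v2)
    define \<Phi> where "\<Phi> u = u + R (F u - ?L u)" for u
    obtain U V where UV: "u0 \<in> U" "C1_diffeo U V \<Phi>"
      using C1_diffeo_straightening_map[OF dF cF R, of u0] unfolding \<Phi>_def by blast
    have L\<Phi>: "?L (\<Phi> u) = F u" for u
      by (simp add: \<Phi>_def blinfun.add_right LR)
    note vim = has_codim_vimage[OF bounded_linear.linear[OF blinfun.bounded_linear_right] bounded_linear.linear[OF R] LR]
    have "straightens \<Phi> U V (S c) {x. ?L x \<in> ?W}"
      unfolding S using subspace
      by (intro C1_diffeo_straightens_level_set UV L\<Phi>) (auto intro: closed_Times)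
    moreover have "straightens \<Phi> U V (Lam \<gamma> a p c) {x. ?L x \<in> {0}}"
      unfolding Lam by (intro C1_diffeo_straightens_level_set UV L\<Phi>) auto
    moreover have "has_codim {x. ?L x \<in> {0}} {x. ?L x \<in> ?W} 1"
      by (rule vim[OF has_codim_zero_line])
    moreover have "has_codim {x. ?L x \<in> {0}} UNIV 2"
      using vim[OF has_codim_zero_UNIV] by (simp add: numeral_2_eq_2)
    ultimately show ?thesis using UV(1) by blast
  qed
  show ?thesis
    unfolding C1_submanifold_in_def
  proof (intro conjI ballI)
    show "C1_submanifold 2 (Lam \<gamma> a p c)"
      unfolding C1_submanifold_def using chart by meson
    show "\<exists>m. C1_submanifold m (S c)" using C1_submanifold_S[OF assms(4)] by (rule exI)
    show "Lam \<gamma> a p c \<subseteq> S c" by (auto simp: Lam_def)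
    show "\<exists>\<Phi> U V E F. u0 \<in> U \<and> straightens \<Phi> U V (S c) E \<and> straightens \<Phi> U V (Lam \<gamma> a p c) F \<and>
        has_codim F E 1" if "u0 \<in> Lam \<gamma> a p c" for u0
      using chart[OF that] by meson
  qed
qed

end
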